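(* Let $\Omega$ be an open bounded set in $\mathbb{R}^n$ and let $1\le k\le n-1$ be an integer. There exists a constant $C$, independent of $u$, such that for every $u\in W^{k,1}_0(\Omega)$ with $|\nabla^ju|\in\mathcal{M}^{n-j}(\Omega)$ for all $1\le j\le k$, $$\|u\|_{BMO^{n-k}(\Omega)}\le C\sum_{j=1}^k\|\nabla^ju\|_{\mathcal{M}^{n-j}(\Omega)},$$ where $u$ on the left-hand side is understood as its precise representative.
   Context: Precise representative: $u^*(x)=\lim_{r\to0}\frac1{|B(x,r)|}\int_{B(x,r)}u\,dy$ if $x$ is a Lebesgue point of $u$, and $u^*(x)=0$ otherwise. Hausdorff content: for $0<\beta\le n$ and $E\subseteq\mathbb{R}^n$, $\mathcal{H}^\beta_\infty(E)=\inf\{\sum_{i=1}^\infty\omega_\beta r_i^\beta: E\subset\bigcup_{i=1}^\infty B(x_i,r_i)\}$ with $\omega_\beta=\pi^{\beta/2}/\Gamma(\beta/2+1)$. Choquet integral: for $f:A\to[0,\infty]$, $\int_A f\,d\mathcal{H}^\beta_\infty=\int_0^\infty\mathcal{H}^\beta_\infty(\{x\in A:f(x)>t\})\,dt$. $$\|u\|_{BMO^\beta(\Omega)}=\sup_{2Q\subset\Omega}\ \inf_{c\in\mathbb{R}}\frac1{l(Q)^\beta}\int_Q|u-c|\,d\mathcal{H}^\beta_\infty,$$ where the supremum is over cubes $Q$ (sides parallel to the axes) such that the concentric cube $2Q$ of twice the side length is contained in $\Omega$, and $l(Q)$ is the side length of $Q$. Morrey space: a locally integrable function $f$ belongs to $\mathcal{M}^\beta(\Omega)$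 if $\|f\|_{\mathcal{M}^\beta(\Omega)}=\sup_{x\in\Omega,\,r>0}r^{-\beta}\int_{\Omega\cap B(x,r)}|f|\,dy<\infty$. $\nabla^ju$ is the tensor of all weak derivatives of order $j$; $W^{k,1}_0(\Omega)$ is the closure of $C_c^\infty(\Omega)$ in $W^{k,1}(\Omega)$. *)

theory Defs
  imports "HOL-Analysis.Analysis"
begin

subsection \<open>Test functions and weak derivatives\<close>

definition partial_deriv :: "'n::finite \<Rightarrow> (real^'n \<Rightarrow> real) \<Rightarrow> real^'n \<Rightarrow> real" where
  "partial_deriv i f = (\<lambda>x. frechet_derivative f (at x) (axis i 1))"

text \<open>Derivatives of order \<open>j\<close> are indexed by the \<open>j\<close>-tuples of coordinate directions
  (lists of length \<open>j\<close>), that is, by the components of the tensor of derivatives of order \<open>j\<close>.\<close>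

definition iterated_partial :: "'n::finite list \<Rightarrow> (real^'n \<Rightarrow> real) \<Rightarrow> real^'n \<Rightarrow> real" where
  "iterated_partial js f = foldr partial_deriv js f"

text \<open>Differentiability of all iterated partial derivatives (with their continuity, which it
  implies) is the same as being of class \<open>C\<^sup>\<infinity>\<close>. Test functions are extended by zero to the
  whole space.\<close>

definition test_functions :: "(real^'n::finite) set \<Rightarrow> (real^'n \<Rightarrow> real) set" where
  "test_functions \<Omega> =
     {\<phi>. (\<forall>js x. iterated_partial js \<phi> differentiable (at x)) \<and>
         compact (closure {x. \<phi> x \<noteq> 0}) \<and> closure {x. \<phi> x \<noteq> 0} \<subseteq> \<Omega>}"

definition locally_integrable_on :: "('a::euclidean_space \<Rightarrow> real) \<Rightarrow> 'a set \<Rightarrow> bool"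
    (infix "locally'_integrable'_on" 46) where
  "f locally_integrable_on \<Omega> \<longleftrightarrow>
     (\<forall>K. compact K \<and> K \<subseteq> \<Omega> \<longrightarrow> f absolutely_integrable_on K)"

definition has_weak_deriv ::
    "(real^'n::finite) set \<Rightarrow> 'n list \<Rightarrow> (real^'n \<Rightarrow> real) \<Rightarrow> (real^'n \<Rightarrow> real) \<Rightarrow> bool" where
  "has_weak_deriv \<Omega> js u v \<longleftrightarrow>
     u locally_integrable_on \<Omega> \<and> v locally_integrable_on \<Omega> \<and>
     (\<forall>\<phi>\<in>test_functions \<Omega>.
        (LINT x:\<Omega>|lebesgue. u x * iterated_partial js \<phi> x) =
        (-1) ^ length js * (LINT x:\<Omega>|lebesgue. v x * \<phi> x))"

text \<open>A weak derivative is only determined up to a null set. The definition below selects one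
  version; it is meaningful only if a weak derivative exists.\<close>

definition weak_deriv ::
    "(real^'n::finite) set \<Rightarrow> 'n list \<Rightarrow> (real^'n \<Rightarrow> real) \<Rightarrow> real^'n \<Rightarrow> real" where
  "weak_deriv \<Omega> js u = (SOME v. has_weak_deriv \<Omega> js u v)"

text \<open>The pointwise Euclidean norm of the tensor of all weak derivatives of order \<open>j\<close>.\<close>

definition weak_grad_norm ::
    "(real^'n::finite) set \<Rightarrow> nat \<Rightarrow> (real^'n \<Rightarrow> real) \<Rightarrow> real^'n \<Rightarrow> real" where
  "weak_grad_norm \<Omega> j u = (\<lambda>x. L2_set (\<lambda>js. weak_deriv \<Omega> js u x) {js. length js = j})"


subsection \<open>Sobolev spaces\<close>

text \<open>Elements are functions, not classes modulo equality almost everywhere; the values outside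
  the domain are irrelevant.\<close>

definition sobolev1 :: "nat \<Rightarrow> (real^'n::finite) set \<Rightarrow> (real^'n \<Rightarrow> real) set" where
  "sobolev1 k \<Omega> =
     {u. u absolutely_integrable_on \<Omega> \<and>
         (\<forall>js. length js \<le> k \<longrightarrow>
            (\<exists>v. has_weak_deriv \<Omega> js u v \<and> v absolutely_integrable_on \<Omega>))}"

definition sobolev1_norm :: "nat \<Rightarrow> (real^'n::finite) set \<Rightarrow> (real^'n \<Rightarrow> real) \<Rightarrow> ennreal" where
  "sobolev1_norm k \<Omega> u =
     (\<Sum>js | length js \<le> k. \<integral>\<^sup>+x\<in>\<Omega>. ennreal \<bar>weak_deriv \<Omega> js u x\<bar> \<partial>lebesgue)"

definition sobolev1_0 :: "nat \<Rightarrow> (real^'n::finite) set \<Rightarrow> (real^'n \<Rightarrow> real) set" where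
  "sobolev1_0 k \<Omega> =
     {u \<in> sobolev1 k \<Omega>.
        \<forall>\<epsilon>>0. \<exists>\<phi>\<in>test_functions \<Omega>. sobolev1_norm k \<Omega> (\<lambda>x. u x - \<phi> x) < \<epsilon>}"


subsection \<open>Morrey spaces\<close>

definition morrey_norm :: "real \<Rightarrow> ('a::euclidean_space) set \<Rightarrow> ('a \<Rightarrow> real) \<Rightarrow> ennreal" where
  "morrey_norm \<beta> \<Omega> f =
     (SUP (x, r) \<in> \<Omega> \<times> {0<..}.
        ennreal (r powr (- \<beta>)) * (\<integral>\<^sup>+y\<in>\<Omega> \<inter> ball x r. ennreal \<bar>f y\<bar> \<partial>lebesgue))"

definition morrey_space :: "real \<Rightarrow> ('a::euclidean_space) set \<Rightarrow> ('a \<Rightarrow> real) set" where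
  "morrey_space \<beta> \<Omega> = {f. f locally_integrable_on \<Omega> \<and> morrey_norm \<beta> \<Omega> f < \<infinity>}"


subsection \<open>Hausdorff content and Choquet integral\<close>

definition hausdorff_content :: "real \<Rightarrow> ('a::euclidean_space) set \<Rightarrow> ennreal" where
  "hausdorff_content \<beta> E =
     (INF (x, r) \<in> {(x :: nat \<Rightarrow> 'a, r). (\<forall>i. 0 < r i) \<and> E \<subseteq> (\<Union>i. ball (x i) (r i))}.
        \<Sum>i. ennreal (pi powr (\<beta> / 2) / Gamma (\<beta> / 2 + 1) * r i powr \<beta>))"

definition choquet_integral ::
    "real \<Rightarrow> ('a::euclidean_space) set \<Rightarrow> ('a \<Rightarrow> ennreal) \<Rightarrow> ennreal" where
  "choquet_integral \<beta> A f =
     (\<integral>\<^sup>+t\<in>{0..}. hausdorff_content \<beta> {x \<in> A. f x > ennreal t} \<partial>lborel)"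


subsection \<open>Bounded mean oscillation with respect to Hausdorff content\<close>

definition cube :: "real^'n::finite \<Rightarrow> real \<Rightarrow> (real^'n) set" where
  "cube a l = {y. \<forall>i. \<bar>y $ i - a $ i\<bar> \<le> l / 2}"

definition bmo_norm :: "real \<Rightarrow> (real^'n::finite) set \<Rightarrow> (real^'n \<Rightarrow> real) \<Rightarrow> ennreal" where
  "bmo_norm \<beta> \<Omega> u =
     (SUP (a, l) \<in> {(a, l). 0 < l \<and> cube a (2 * l) \<subseteq> \<Omega>}.
        INF c :: real. choquet_integral \<beta> (cube a l) (\<lambda>x. ennreal \<bar>u x - c\<bar>) / ennreal (l powr \<beta>))"


subsection \<open>Precise representative\<close>

definition average :: "('a::euclidean_space) set \<Rightarrow> ('a \<Rightarrow> real) \<Rightarrow> real" where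
  "average B u = (LINT y:B|lebesgue. u y) / measure lebesgue B"

text \<open>The notion does not involve the value \<open>u x\<close>, so that it depends only on the class of \<open>u\<close>
  modulo equality almost everywhere. The first conjunct excludes points near which the Bochner
  integral would be zero by convention.\<close>

definition lebesgue_point :: "('a::euclidean_space \<Rightarrow> real) \<Rightarrow> 'a \<Rightarrow> bool" where
  "lebesgue_point u x \<longleftrightarrow>
     (\<exists>R>0. u absolutely_integrable_on ball x R) \<and>
     (\<exists>c. ((\<lambda>r. average (ball x r) (\<lambda>y. \<bar>u y - c\<bar>)) \<longlongrightarrow> 0) (at_right 0))"

definition precise_rep :: "('a::euclidean_space \<Rightarrow> real) \<Rightarrow> 'a \<Rightarrow> real" where
  "precise_rep u x =
     (if lebesgue_point u x then Lim (at_right 0) (\<lambda>r. average (ball x r) u) else 0)"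

end

theory Submission
  imports Defs
begin

text \<open>Everything is measured on dyadic grids. A function \<open>w\<close> on a cube is dominated by weights
  \<open>a\<^sub>i\<close> that are constant on the cells of level \<open>i\<close> (of side length \<open>l\<^sub>i\<close>), in the sense
  \<open>\<bar>w\<bar> \<le> \<Sum>\<^sub>i a\<^sub>i\<close>. A stopping-time argument shows that the Choquet integral of \<open>\<Sum>\<^sub>i a\<^sub>i\<close> with respect to
  the content of dimension \<open>n - k\<close> is bounded by the cost \<open>\<Sum>\<^sub>i l\<^sub>i\<^sup>-\<^sup>k \<integral> a\<^sub>i\<close>; since the cost is
  additive, this replaces the sublinearity of the Choquet integral.

  A boxing argument dominates \<open>w\<close> with cost of order 1 at most \<open>\<integral> \<bar>\<nabla>w\<bar>\<close> plus a lower order term.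
  Telescoping the cell averages turns weights for \<open>\<nabla>w\<close> of order \<open>j\<close> into weights for \<open>w\<close> of order
  \<open>j + 1\<close>, again up to a lower order term. After \<open>k\<close> steps the oscillation of a smooth function on a
  cube of side length \<open>l\<close> is bounded by \<open>\<Sum>\<^sub>j l\<^sup>j\<^sup>-\<^sup>k \<integral> \<bar>\<nabla>\<^sup>j w\<bar>\<close>, and the Morrey norms bound the
  integrals by \<open>l\<^sup>n\<^sup>-\<^sup>j\<close>.

  For general \<open>u\<close> take test functions \<open>\<phi>\<^sub>m\<close> converging rapidly to \<open>u\<close>. Maximal averages of weights are
  dominated by weights of comparable cost, so outside a set of content zero the point is a Lebesgue
  point of \<open>u\<close> and \<open>\<bar>u\<^sup>* - \<phi>\<^sub>m\<bar>\<close> is dominated by a tail with small Choquet integral.\<close>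

text \<open>Telescoping alone cannot start the induction. The weights
  \<open>side i * cell_avg i (grad_l1 w)\<close> have cost of order 1 in which every level
  contributes the full integral of \<open>grad_l1 w\<close>, so the sum over the levels diverges;
  this is the failure of fractional integration at the L^1 endpoint. From order
  \<open>j \<ge> 1\<close> on, a weight of level m is paid at the coarser levels with the factor
  \<open>\<Sum>i<m. (1 / side i) ^ j\<close>, a geometric sum bounded by the price at level m
  itself. Hence the endpoint difficulty sits entirely in the step to order 1, where it is met by
  truncation: each level is charged only for the gradient on its own band of values of
  \<open>\<bar>w\<bar>\<close>.

  The triangle inequality for the Choquet integral costs a factor 2 here, which would accumulate in
  the infinite series of increments of the approximation. All series are therefore summed as
  weights, and the factor 2 is spent once, when the error of the approximation is separated from the
  oscillation of a smooth function.\<close>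

lemma suminf_ennreal_swap:
  fixes f :: "nat \<Rightarrow> nat \<Rightarrow> ennreal"
  shows "(\<Sum>i. \<Sum>j. f i j) = (\<Sum>j. \<Sum>i. f i j)"
proof -
  have "(\<Sum>i. \<Sum>j. f i j) = (\<integral>\<^sup>+i. (\<Sum>j. f i j) \<partial>count_space UNIV)"
    by (simp add: nn_integral_count_space_nat)
  also have "\<dots> = (\<Sum>j. \<integral>\<^sup>+i. f i j \<partial>count_space UNIV)"
    by (rule nn_integral_suminf) simp
  also have "\<dots> = (\<Sum>j. \<Sum>i. f i j)"
    by (simp add: nn_integral_count_space_nat)
  finally show ?thesis .
qed

subsection \<open>Hausdorff content and the Choquet integral\<close>

lemma hausdorff_content_le:
  assumes "\<And>i. 0 < r i" "E \<subseteq> (\<Union>i. ball (x i) (r i))"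
  shows "hausdorff_content \<beta> E
    \<le> (\<Sum>i. ennreal (pi powr (\<beta> / 2) / Gamma (\<beta> / 2 + 1) * r i powr \<beta>))"
  unfolding hausdorff_content_def using assms
  by (intro INF_lower2[of "(x, r)"]) auto

lemma hausdorff_content_mono:
  assumes "A \<subseteq> B"
  shows "hausdorff_content \<beta> A \<le> hausdorff_content \<beta> B"
  unfolding hausdorff_content_def using assms
  by (intro INF_superset_mono) auto

lemma hausdorff_content_UN_le:
  fixes A :: "nat \<Rightarrow> 'a::euclidean_space set"
  shows "hausdorff_content \<beta> (\<Union>n. A n) \<le> (\<Sum>n. hausdorff_content \<beta> (A n))"
proof (cases "(\<Sum>n. hausdorff_content \<beta> (A n)) = top")
  case False
  let ?w = "\<lambda>r. ennreal (pi powr (\<beta> / 2) / Gamma (\<beta> / 2 + 1) * r powr \<beta>)"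
  show ?thesis
  proof (rule ennreal_le_epsilon)
    fix e :: real assume e: "e > 0"
    have "\<exists>xr. (\<forall>i. 0 < snd xr i) \<and> A n \<subseteq> (\<Union>i. ball (fst xr i) (snd xr i)) \<and>
        (\<Sum>i. ?w (snd xr i)) \<le> hausdorff_content \<beta> (A n) + ennreal (e * (1/2) ^ Suc n)" for n
    proof -
      have fin: "hausdorff_content \<beta> (A n) < top"
        using False ennreal_suminf_lessD[of "\<lambda>n. hausdorff_content \<beta> (A n)" top n]
        by (simp add: less_top)
      have "hausdorff_content \<beta> (A n) < hausdorff_content \<beta> (A n) + ennreal (e * (1/2) ^ Suc n)"
        using fin e by (simp add: ennreal_add_left_cancel_less[of _ 0, simplified])
      then obtain xr where "xr \<in> {(x, r). (\<forall>i. 0 < r i) \<and> A n \<subseteq> (\<Union>i. ball (x i) (r i))}"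
        and "(case xr of (x, r) \<Rightarrow> \<Sum>i. ?w (r i)) < hausdorff_content \<beta> (A n) + ennreal (e * (1/2) ^ Suc n)"
        unfolding hausdorff_content_def[of \<beta> "A n"] INF_less_iff by blast
      then show ?thesis by (intro exI[of _ xr]) (auto intro: less_imp_le simp: case_prod_beta)
    qed
    then obtain xr where *: "\<And>n. (\<forall>i. 0 < snd (xr n) i) \<and> A n \<subseteq> (\<Union>i. ball (fst (xr n) i) (snd (xr n) i)) \<and>
        (\<Sum>i. ?w (snd (xr n) i)) \<le> hausdorff_content \<beta> (A n) + ennreal (e * (1/2) ^ Suc n)"
      using choice[of "\<lambda>n xr. (\<forall>i. 0 < snd xr i) \<and> A n \<subseteq> (\<Union>i. ball (fst xr i) (snd xr i)) \<and>
        (\<Sum>i. ?w (snd xr i)) \<le> hausdorff_content \<beta> (A n) + ennreal (e * (1/2) ^ Suc n)"] by blast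
    define x where "x n = fst (xr n)" for n
    define r where "r n = snd (xr n)" for n
    have xr: "\<And>n i. 0 < r n i" "\<And>n. A n \<subseteq> (\<Union>i. ball (x n i) (r n i))"
      "\<And>n. (\<Sum>i. ?w (r n i)) \<le> hausdorff_content \<beta> (A n) + ennreal (e * (1/2) ^ Suc n)"
      using * by (simp_all add: x_def r_def)
    let ?X = "\<lambda>m. case_prod x (prod_decode m)" and ?R = "\<lambda>m. case_prod r (prod_decode m)"
    have "hausdorff_content \<beta> (\<Union>n. A n) \<le> (\<Sum>m. ?w (?R m))"
    proof (rule hausdorff_content_le)
      show "0 < ?R m" for m using xr(1) by (simp split: prod.split)
      show "(\<Union>n. A n) \<subseteq> (\<Union>m. ball (?X m) (?R m))"
      proof
        fix y assume "y \<in> (\<Union>n. A n)"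
        then obtain n i where "y \<in> ball (x n i) (r n i)" using xr(2) by blast
        then show "y \<in> (\<Union>m. ball (?X m) (?R m))"
          by (intro UN_I[of "prod_encode (n, i)"]) auto
      qed
    qed
    also have "(\<Sum>m. ?w (?R m)) = (\<Sum>m. case_prod (\<lambda>n i. ?w (r n i)) (prod_decode m))"
      by (simp add: case_prod_beta)
    also have "\<dots> = (\<Sum>n. \<Sum>i. ?w (r n i))"
      using suminf_ennreal_2dimen[of "\<lambda>n. \<Sum>i. ?w (r n i)" "case_prod (\<lambda>n i. ?w (r n i))"]
      by (simp add: comp_def)
    also have "\<dots> \<le> (\<Sum>n. hausdorff_content \<beta> (A n) + ennreal (e * (1/2) ^ Suc n))"
      by (intro suminf_le xr(3)) auto
    also have "\<dots> = (\<Sum>n. hausdorff_content \<beta> (A n)) + (\<Sum>n. ennreal (e * (1/2) ^ Suc n))"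
      by (intro suminf_add[symmetric]) auto
    also have "(\<Sum>n. ennreal (e * (1/2) ^ Suc n)) = ennreal e"
      using sums_mult[OF power_half_series, of e] e by (intro suminf_ennreal_eq) auto
    finally show "hausdorff_content \<beta> (\<Union>n. A n) \<le> (\<Sum>n. hausdorff_content \<beta> (A n)) + ennreal e" .
  qed
qed simp

lemma content_normalization_pos:
  fixes \<beta> :: real
  assumes "0 < \<beta>"
  shows "0 < pi powr (\<beta> / 2) / Gamma (\<beta> / 2 + 1)"
  using assms by (intro divide_pos_pos Gamma_real_pos) auto

text \<open>The definition of the content requires infinitely many balls of positive radius. The
  single ball is therefore followed by balls whose weights are \<open>e / 2 ^ (n + 1)\<close>, at
  total cost \<open>e\<close>.\<close>

lemma hausdorff_content_subset_ball:
  fixes A :: "'a::euclidean_space set"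
  assumes "A \<subseteq> ball x r" "0 < r" "0 < \<beta>"
  shows "hausdorff_content \<beta> A
    \<le> ennreal (pi powr (\<beta> / 2) / Gamma (\<beta> / 2 + 1) * r powr \<beta>)"
proof (rule ennreal_le_epsilon)
  fix e :: real assume e: "e > 0"
  define c where "c = pi powr (\<beta> / 2) / Gamma (\<beta> / 2 + 1)"
  have c: "c > 0" unfolding c_def by (rule content_normalization_pos[OF assms(3)])
  define s where "s n = (e / c * (1/2) ^ Suc n) powr (1 / \<beta>)" for n
  have s: "s n > 0" "c * s n powr \<beta> = e * (1/2) ^ Suc n" for n
    using c e assms by (simp_all add: s_def powr_powr)
  let ?R = "\<lambda>n. case n of 0 \<Rightarrow> r | Suc n \<Rightarrow> s n"
  have "hausdorff_content \<beta> A \<le> (\<Sum>n. ennreal (c * ?R n powr \<beta>))"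
    unfolding c_def by (rule hausdorff_content_le[where x="\<lambda>_. x"])
      (use assms s in \<open>auto split: nat.split intro!: UN_I[of 0]\<close>)
  also have "\<dots> = (\<Sum>n. ennreal (c * ?R (n + 1) powr \<beta>)) + (\<Sum>n<1. ennreal (c * ?R n powr \<beta>))"
    by (rule suminf_offset) simp
  also have "(\<Sum>n. ennreal (c * ?R (n + 1) powr \<beta>)) = (\<Sum>n. ennreal (e * (1/2) ^ Suc n))"
    by (simp add: s(2) del: power_Suc)
  also have "\<dots> = ennreal e"
      using sums_mult[OF power_half_series, of e] e by (intro suminf_ennreal_eq) auto
  finally show "hausdorff_content \<beta> A
      \<le> ennreal (pi powr (\<beta> / 2) / Gamma (\<beta> / 2 + 1) * r powr \<beta>) + ennreal e"
    by (simp add: add.commute c_def)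
qed

text \<open>Not immediate from the definition, since the radii are positive: the empty set lies in
  balls of arbitrarily small weight, and \<open>0 < \<beta>\<close> makes the weight tend to 0 with
  the radius.\<close>

lemma hausdorff_content_empty:
  fixes \<beta> :: real
  assumes "0 < \<beta>"
  shows "hausdorff_content \<beta> ({} :: 'a::euclidean_space set) = 0"
proof -
  define c where "c = pi powr (\<beta> / 2) / Gamma (\<beta> / 2 + 1)"
  have c: "c > 0" unfolding c_def by (rule content_normalization_pos[OF assms])
  have "hausdorff_content \<beta> ({} :: 'a set) \<le> 0"
  proof (rule ennreal_le_epsilon)
    fix e :: real assume e: "e > 0"
    define r where "r = (e / c) powr (1 / \<beta>)"
    have r: "0 < r" "c * r powr \<beta> = e" using c e assms by (simp_all add: r_def powr_powr)
    have "hausdorff_content \<beta> ({} :: 'a set) \<le> ennreal (c * r powr \<beta>)"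
      unfolding c_def using r(1) assms by (intro hausdorff_content_subset_ball) auto
    then show "hausdorff_content \<beta> ({} :: 'a set) \<le> 0 + ennreal e"
      using r by simp
  qed
  then show ?thesis by simp
qed

lemma hausdorff_content_Un_le:
  fixes A B :: "'a::euclidean_space set"
  assumes "0 < \<beta>"
  shows "hausdorff_content \<beta> (A \<union> B) \<le> hausdorff_content \<beta> A + hausdorff_content \<beta> B"
proof -
  let ?F = "\<lambda>n::nat. if n = 0 then A else if n = 1 then B else {}"
  have "hausdorff_content \<beta> (A \<union> B) \<le> hausdorff_content \<beta> (\<Union>n. ?F n)"
    by (intro hausdorff_content_mono) (force split: if_splits)
  also have "\<dots> \<le> (\<Sum>n. hausdorff_content \<beta> (?F n))" by (rule hausdorff_content_UN_le)
  also have "\<dots> = (\<Sum>n<2. hausdorff_content \<beta> (?F n))"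
    by (intro suminf_finite) (auto simp: hausdorff_content_empty[OF assms])
  finally show ?thesis by (simp add: numeral_2_eq_2)
qed

text \<open>All superlevel sets of a decreasing function are intervals. Content is no measure, so
  this monotonicity is the source of measurability in the Choquet integral.\<close>

lemma borel_measurable_antimono_ennreal:
  fixes f :: "real \<Rightarrow> ennreal"
  assumes "antimono f"
  shows "f \<in> borel_measurable borel"
proof (rule borel_measurableI_greater)
  fix a
  let ?S = "{x \<in> space borel. a < f x}"
  have "is_interval ?S"
    unfolding is_interval_1 using assms by (auto simp: antimono_def intro: less_le_trans)
  then show "?S \<in> sets borel" by (rule real_interval_borel_measurable)
qed

lemma antimono_content_superlevel:
  "antimono (\<lambda>t. hausdorff_content \<beta> {x \<in> A. f x > ennreal t})"
  by (intro antimonoI hausdorff_content_mono) (auto intro: le_less_trans ennreal_leI)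

lemma borel_measurable_content_superlevel [measurable]:
  "(\<lambda>t. hausdorff_content \<beta> {x \<in> A. f x > ennreal t}) \<in> borel_measurable borel"
  by (intro borel_measurable_antimono_ennreal antimono_content_superlevel)

lemma choquet_integral_mono:
  assumes "A \<subseteq> B" "\<And>x. x \<in> A \<Longrightarrow> f x \<le> g x"
  shows "choquet_integral \<beta> A f \<le> choquet_integral \<beta> B g"
  unfolding choquet_integral_def using assms
  by (intro nn_integral_mono mult_right_mono hausdorff_content_mono) (auto intro: less_le_trans)

text \<open>If \<open>h > t\<close> off \<open>Z\<close>, then \<open>f > t/2\<close> or
  \<open>g > t/2\<close>; subadditivity of the content handles the union, and rescaling t by 2
  produces the factor. The set \<open>Z\<close> lets the pointwise bound fail on a set of content
  zero.\<close>

lemma choquet_integral_add_le: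
  fixes f g :: "'a::euclidean_space \<Rightarrow> ennreal"
  assumes \<beta>: "0 < \<beta>" and Z: "hausdorff_content \<beta> Z = 0"
    and le: "\<And>x. x \<in> A - Z \<Longrightarrow> h x \<le> f x + g x"
  shows "choquet_integral \<beta> A h \<le> 2 * (choquet_integral \<beta> A f + choquet_integral \<beta> A g)"
proof -
  let ?H = "\<lambda>f t. hausdorff_content \<beta> {x \<in> A. f x > ennreal t}"
  have *: "?H h t \<le> ?H f (t/2) + ?H g (t/2)" if "t \<ge> 0" for t
  proof -
    have "{x \<in> A. h x > ennreal t} \<subseteq> {x \<in> A. f x > ennreal (t/2)} \<union> {x \<in> A. g x > ennreal (t/2)} \<union> Z"
    proof
      fix x assume x: "x \<in> {x \<in> A. h x > ennreal t}"
      { assume "x \<notin> Z" "\<not> f x > ennreal (t/2)" "\<not> g x > ennreal (t/2)"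
        then have "h x \<le> ennreal (t/2) + ennreal (t/2)"
          using le[of x] x by (auto intro: order_trans add_mono simp: not_less)
        then have "h x \<le> ennreal t"
          using that by (simp flip: ennreal_plus)
        then have False using x by (simp add: not_less[symmetric]) }
      then show "x \<in> {x \<in> A. f x > ennreal (t/2)} \<union> {x \<in> A. g x > ennreal (t/2)} \<union> Z"
        using x by blast
    qed
    then have "?H h t \<le> hausdorff_content \<beta> ({x \<in> A. f x > ennreal (t/2)} \<union> {x \<in> A. g x > ennreal (t/2)} \<union> Z)"
      by (rule hausdorff_content_mono)
    also have "\<dots> \<le> ?H f (t/2) + ?H g (t/2) + hausdorff_content \<beta> Z"
      by (intro order_trans[OF hausdorff_content_Un_le[OF \<beta>]] add_right_mono hausdorff_content_Un_le[OF \<beta>])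
    finally show ?thesis using Z by simp
  qed
  have scale: "(\<integral>\<^sup>+t\<in>{0..}. ?H F (t/2) \<partial>lborel) = 2 * choquet_integral \<beta> A F" for F
  proof -
    have "(\<integral>\<^sup>+t\<in>{0..}. ?H F (t/2) \<partial>lborel)
      = 2 * (\<integral>\<^sup>+t. ?H F ((0 + 2 * t)/2) * indicator {0..} (0 + 2 * t) \<partial>lborel)"
      by (subst nn_integral_real_affine[where c=2 and t=0]) auto
    also have "(\<integral>\<^sup>+t. ?H F ((0 + 2 * t)/2) * indicator {0..} (0 + 2 * t) \<partial>lborel) = choquet_integral \<beta> A F"
      unfolding choquet_integral_def by (intro nn_integral_cong) (auto simp: indicator_def)
    finally show ?thesis .
  qed
  have "choquet_integral \<beta> A h \<le> (\<integral>\<^sup>+t. ?H f (t/2) * indicator {0..} t + ?H g (t/2) * indicator {0..} t \<partial>lborel)"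
    unfolding choquet_integral_def
    by (intro nn_integral_mono) (auto simp: indicator_def * simp del: divide_numeral_1)
  also have "\<dots> = (\<integral>\<^sup>+t\<in>{0..}. ?H f (t/2) \<partial>lborel) + (\<integral>\<^sup>+t\<in>{0..}. ?H g (t/2) \<partial>lborel)"
    by (intro nn_integral_add) (auto intro!: borel_measurable_times_ennreal)
  also have "\<dots> = 2 * (choquet_integral \<beta> A f + choquet_integral \<beta> A g)"
    unfolding scale by (simp add: distrib_left)
  finally show ?thesis .
qed

lemma emeasure_lborel_atLeast: "emeasure lborel {a::real..} = top"
proof -
  have "of_nat n \<le> emeasure lborel {a..}" for n
    using emeasure_mono[of "{a..a + real n}" "{a..}" lborel]
    by (simp add: ennreal_of_nat_eq_real_of_nat)
  then show ?thesis
    by (metis ennreal_Ex_less_of_nat leD less_top)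
qed

text \<open>Markov's inequality at infinite height: the set lies in every superlevel set, so a
  positive content would be integrated over a half-line. This produces the exceptional set outside
  which a series of weights converges.\<close>

lemma hausdorff_content_infinity_eq_0:
  fixes f :: "'a::euclidean_space \<Rightarrow> ennreal"
  assumes "choquet_integral \<beta> A f < top"
  shows "hausdorff_content \<beta> {x \<in> A. f x = top} = 0"
proof (rule ccontr)
  assume ne: "hausdorff_content \<beta> {x \<in> A. f x = top} \<noteq> 0"
  have "(\<integral>\<^sup>+t\<in>{0::real..}. hausdorff_content \<beta> {x \<in> A. f x = top} \<partial>lborel) \<le> choquet_integral \<beta> A f"
    unfolding choquet_integral_def
    by (intro nn_integral_mono mult_right_mono hausdorff_content_mono) auto
  moreover have "(\<integral>\<^sup>+t\<in>{0::real..}. hausdorff_content \<beta> {x \<in> A. f x = top} \<partial>lborel) = top"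
    using ne by (subst nn_integral_cmult_indicator) (auto simp: ennreal_mult_top emeasure_lborel_atLeast)
  ultimately show False using assms by (simp add: top_unique)
qed

subsection \<open>Dyadic grids\<close>

lemma borel_measurable_vec_nth [measurable (raw)]:
  fixes f :: "'a \<Rightarrow> real^'n::finite"
  assumes "f \<in> borel_measurable M"
  shows "(\<lambda>x. f x $ c) \<in> borel_measurable M"
proof -
  have "(\<lambda>x::real^'n. x $ c) \<in> borel_measurable borel"
    by (intro borel_measurable_continuous_onI continuous_intros)
  from measurable_compose[OF assms this] show ?thesis .
qed

lemma prod_Basis_vec: "(\<Prod>b\<in>Basis. f b) = (\<Prod>c\<in>UNIV. f (axis c (1::real) :: real^'n::finite))"
proof -
  have *: "(Basis :: (real^'n) set) = (\<lambda>c. axis c 1) ` UNIV" by (auto simp: Basis_vec_def)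
  show ?thesis
    unfolding * by (subst prod.reindex) (auto simp: inj_on_def axis_eq_axis)
qed

lemma nn_integral_swap_lborel:
  fixes f :: "'a::euclidean_space \<Rightarrow> 'b::euclidean_space \<Rightarrow> ennreal"
  assumes "case_prod f \<in> borel_measurable (borel \<Otimes>\<^sub>M borel)"
  shows "(\<integral>\<^sup>+x. \<integral>\<^sup>+y. f x y \<partial>lborel \<partial>lborel) = (\<integral>\<^sup>+y. \<integral>\<^sup>+x. f x y \<partial>lborel \<partial>lborel)"
proof -
  have "case_prod f \<in> borel_measurable (lborel \<Otimes>\<^sub>M lborel)"
    by (subst measurable_cong_sets[OF sets_pair_measure_cong[OF sets_lborel sets_lborel] refl]) (rule assms)
  then show ?thesis by (rule lborel_pair.Fubini'[symmetric])
qed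

text \<open>Cells are half-open and each level covers all of space, so that every point lies in
  exactly one cell per level. Pointwise bounds then need no exceptional set of cell boundaries, and
  every cell has neighbours on all sides. Only the cell of level 0 with corner \<open>p\<close> is
  distinguished, as \<open>top_cell\<close>.\<close>

locale grid =
  fixes p :: "real^'n::finite" and L :: real
  assumes L_pos: "0 < L"
begin

definition idx :: "nat \<Rightarrow> real^'n \<Rightarrow> int^'n" where
  "idx i x = (\<chi> c. \<lfloor>2 ^ i * (x $ c - p $ c) / L\<rfloor>)"

definition side :: "nat \<Rightarrow> real" where "side i = L / 2 ^ i"

definition cell :: "nat \<Rightarrow> real^'n \<Rightarrow> (real^'n) set" where
  "cell i x = {y. idx i y = idx i x}"

definition top_cell :: "(real^'n) set" where "top_cell = {x. idx 0 x = 0}"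

definition saturated :: "nat \<Rightarrow> (real^'n) set \<Rightarrow> bool" where
  "saturated i S \<longleftrightarrow> S \<in> sets borel \<and> (\<forall>x y. idx i x = idx i y \<longrightarrow> x \<in> S \<longrightarrow> y \<in> S)"

definition cell_avg :: "nat \<Rightarrow> (real^'n \<Rightarrow> ennreal) \<Rightarrow> real^'n \<Rightarrow> ennreal" where
  "cell_avg i f x = ennreal ((1 / side i) ^ CARD('n)) * (\<integral>\<^sup>+y\<in>cell i x. f y \<partial>lborel)"

text \<open>The name is the probabilistic one: the cells of level i generate a filtration, and
  \<open>a i\<close> is measurable with respect to its i-th member.\<close>

definition adapted :: "(nat \<Rightarrow> real^'n \<Rightarrow> ennreal) \<Rightarrow> bool" where
  "adapted a \<longleftrightarrow> (\<forall>i x y. idx i x = idx i y \<longrightarrow> a i x = a i y)"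

lemma side_pos [simp]: "0 < side i" using L_pos by (simp add: side_def)
lemma side_nonneg [simp]: "0 \<le> side i" using side_pos[of i] by linarith
lemma side_neq_0 [simp]: "side i \<noteq> 0" using side_pos[of i] by linarith
lemma side_Suc: "side (Suc i) = side i / 2" by (simp add: side_def)
lemma side_0: "side 0 = L" by (simp add: side_def)

lemma side_antimono: "i \<le> j \<Longrightarrow> side j \<le> side i"
  using L_pos by (auto simp: side_def intro!: divide_left_mono)

lemma idx_nth: "idx i x $ c = \<lfloor>(x $ c - p $ c) / side i\<rfloor>"
  by (simp add: idx_def side_def field_simps)

lemma idx_eq_iff: "idx i x = idx i y \<longleftrightarrow>
    (\<forall>c. real_of_int \<lfloor>(x $ c - p $ c) / side i\<rfloor> = real_of_int \<lfloor>(y $ c - p $ c) / side i\<rfloor>)"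
  by (simp add: vec_eq_iff idx_nth)

lemma idx_eq_int_iff: "idx i x = z \<longleftrightarrow>
    (\<forall>c. p $ c + side i * of_int (z $ c) \<le> x $ c \<and> x $ c < p $ c + side i * (of_int (z $ c) + 1))"
  by (auto simp: vec_eq_iff idx_nth floor_eq_iff pos_le_divide_eq pos_divide_less_eq algebra_simps)

lemma idx_Suc: "idx i x $ c = idx (Suc i) x $ c div 2"
proof -
  define t where "t = (x $ c - p $ c) / side i"
  have "\<lfloor>2 * t\<rfloor> div 2 = \<lfloor>t\<rfloor>" by linarith
  then show ?thesis by (simp add: idx_nth side_Suc t_def field_simps)
qed

lemma idx_refine: "i \<le> j \<Longrightarrow> idx j x = idx j y \<Longrightarrow> idx i x = idx i y"
proof (induction j rule: dec_induct)
  case (step j)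
  then show ?case by (metis idx_Suc vec_eq_iff)
qed

lemma cell_self [simp]: "x \<in> cell i x" by (simp add: cell_def)
lemma cell_cong: "idx i x = idx i y \<Longrightarrow> cell i x = cell i y" by (simp add: cell_def)
lemma mem_cellD: "y \<in> cell i x \<Longrightarrow> idx i y = idx i x" by (simp add: cell_def)

lemma cell_antimono: "i \<le> j \<Longrightarrow> cell j x \<subseteq> cell i x"
  unfolding cell_def by (blast intro: idx_refine)

lemma idx_shift: "idx i (x + side i *\<^sub>R (\<chi> c. of_int (v $ c))) = idx i x + v"
proof -
  have "(x $ c + side i * real_of_int (v $ c) - p $ c) / side i
      = (x $ c - p $ c) / side i + real_of_int (v $ c)" for c
    by (simp add: field_simps)
  then show ?thesis by (simp add: vec_eq_iff idx_nth)
qed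

lemma mem_cell_dist:
  assumes "y \<in> cell i x"
  shows "\<bar>y $ c - x $ c\<bar> < side i"
proof -
  have "p $ c + side i * of_int (idx i x $ c) \<le> y $ c"
    "y $ c < p $ c + side i * (of_int (idx i x $ c) + 1)"
    using idx_eq_int_iff[of i y "idx i x"] mem_cellD[OF assms] by blast+
  moreover have "p $ c + side i * of_int (idx i x $ c) \<le> x $ c"
    "x $ c < p $ c + side i * (of_int (idx i x $ c) + 1)"
    using idx_eq_int_iff[of i x "idx i x"] by blast+
  ultimately show ?thesis by (simp add: distrib_left abs_less_iff)
qed

lemma cell_subset_ball: "cell i x \<subseteq> ball x (real CARD('n) * side i)"
proof
  fix y assume y: "y \<in> cell i x"
  have "norm (y - x) \<le> (\<Sum>c\<in>UNIV. \<bar>(y - x) $ c\<bar>)" by (rule norm_le_l1_cart)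
  also have "\<dots> < (\<Sum>c\<in>(UNIV::'n set). side i)"
    using mem_cell_dist[OF y] by (intro sum_strict_mono) auto
  finally show "y \<in> ball x (real CARD('n) * side i)"
    by (simp add: dist_norm norm_minus_commute)
qed

lemma bounded_cell: "bounded (cell i x)"
  by (rule bounded_subset[OF bounded_ball cell_subset_ball])

lemma convex_cell: "convex (cell i x)"
proof -
  have "cell i x = (\<Inter>c. {y. y $ c \<ge> p $ c + side i * of_int (idx i x $ c)}) \<inter>
      (\<Inter>c. {y. y $ c < p $ c + side i * (of_int (idx i x $ c) + 1)})"
    by (auto simp: cell_def idx_eq_int_iff)
  moreover have "convex {y::real^'n. y $ c \<ge> a}" "convex {y::real^'n. y $ c < a}" for c a
    using convex_halfspace_ge[of a "axis c (1::real)"] convex_halfspace_lt[of "axis c (1::real)" a]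
    by (simp_all add: inner_axis')
  ultimately show ?thesis by (auto intro!: convex_Int convex_INT)
qed

lemma cell_pair_measurable [measurable]:
  "Measurable.pred (borel \<Otimes>\<^sub>M borel) (\<lambda>(x, y). idx i x = idx i y)"
proof -
  have "(\<lambda>(x, y). idx i x = idx i y) = (\<lambda>w. \<forall>c. real_of_int \<lfloor>(fst w $ c - p $ c) / side i\<rfloor>
      - real_of_int \<lfloor>(snd w $ c - p $ c) / side i\<rfloor> = 0)"
    by (auto simp: fun_eq_iff idx_eq_iff)
  also have "Measurable.pred (borel \<Otimes>\<^sub>M borel) \<dots>" by measurable
  finally show ?thesis .
qed

lemma cell_borel [measurable]: "cell i x \<in> sets borel"
proof -
  have "Measurable.pred borel (\<lambda>y. idx i y = idx i x)"
    unfolding idx_eq_iff by measurable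
  then show ?thesis by (simp add: cell_def pred_def)
qed

lemma cell_lborel [measurable, simp]: "cell i x \<in> sets lborel" by simp

lemma idx_measurable [measurable]: "idx i \<in> borel \<rightarrow>\<^sub>M count_space UNIV"
proof (subst measurable_count_space_eq2_countable, safe)
  fix z :: "int^'n"
  show "idx i -` {z} \<inter> space borel \<in> sets borel"
  proof (cases "\<exists>x. idx i x = z")
    case True
    then obtain x where "idx i x = z" by blast
    then have "idx i -` {z} \<inter> space borel = cell i x" by (auto simp: cell_def)
    then show ?thesis by simp
  next
    case False
    then have "idx i -` {z} \<inter> space borel = {}" by auto
    then show ?thesis by simp
  qed
qed auto

lemma top_cell_borel [measurable]: "top_cell \<in> sets borel"
  using measurable_sets[OF idx_measurable, of "{0}" 0] by (simp add: top_cell_def vimage_def)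

lemma saturatedD: "saturated i S \<Longrightarrow> idx i x = idx i y \<Longrightarrow> x \<in> S \<longleftrightarrow> y \<in> S"
  unfolding saturated_def by metis

lemma saturatedI:
  "S \<in> sets borel \<Longrightarrow> (\<And>x y. idx i x = idx i y \<Longrightarrow> x \<in> S \<Longrightarrow> y \<in> S) \<Longrightarrow> saturated i S"
  unfolding saturated_def by blast

lemma saturated_top_cell: "saturated i top_cell"
proof (rule saturatedI[OF top_cell_borel])
  fix x y :: "real^'n" assume "idx i x = idx i y" "x \<in> top_cell"
  then show "y \<in> top_cell" using idx_refine[of 0 i x y] by (simp add: top_cell_def)
qed

lemma saturated_UNIV: "saturated i UNIV" by (simp add: saturated_def)

lemma cell_subset_top_cell: "x \<in> top_cell \<Longrightarrow> cell i x \<subseteq> top_cell"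
  using saturatedD[OF saturated_top_cell] mem_cellD by blast

lemma top_cell_eq: "x \<in> top_cell \<Longrightarrow> cell 0 x = top_cell"
  by (auto simp: top_cell_def cell_def)

lemma adaptedI: "(\<And>i x y. idx i x = idx i y \<Longrightarrow> a i x = a i y) \<Longrightarrow> adapted a"
  unfolding adapted_def by blast

lemma adaptedD: "adapted a \<Longrightarrow> idx i x = idx i y \<Longrightarrow> a i x = a i y"
  unfolding adapted_def by blast

text \<open>Such a function factors through the countable discrete space of cell indices.\<close>

lemma level_measurable:
  assumes inv: "\<And>x y. idx i x = idx i y \<Longrightarrow> g x = g y"
  shows "g \<in> borel_measurable borel"
proof -
  have "g = (\<lambda>z. g (SOME x. idx i x = z)) \<circ> idx i"
  proof
    fix x
    have "idx i (SOME y. idx i y = idx i x) = idx i x" by (rule someI[of _ x]) simp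
    from inv[OF this] show "g x = ((\<lambda>z. g (SOME x. idx i x = z)) \<circ> idx i) x" by simp
  qed
  also have "\<dots> \<in> borel_measurable borel"
    by (rule measurable_comp[OF idx_measurable]) simp
  finally show ?thesis .
qed

lemma adapted_measurable:
  assumes "adapted a"
  shows "a i \<in> borel_measurable borel"
  by (rule level_measurable) (rule adaptedD[OF assms])

lemma emeasure_cell: "emeasure lborel (cell i x) = ennreal (side i ^ CARD('n))"
proof -
  define a :: "real^'n" where "a = (\<chi> c. p $ c + side i * of_int (idx i x $ c))"
  define b :: "real^'n" where "b = (\<chi> c. p $ c + side i * (of_int (idx i x $ c) + 1))"
  have ab: "b $ c - a $ c = side i" for c by (simp add: a_def b_def algebra_simps)
  then have le: "a $ c \<le> b $ c" for c using side_pos[of i] by (metis diff_ge_0_iff_ge less_imp_le)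
  have 1: "\<forall>u\<in>Basis. a \<bullet> u \<le> b \<bullet> u" using le by (auto simp: Basis_vec_def inner_axis)
  have 2: "(\<Prod>u\<in>Basis. (b - a) \<bullet> u) = side i ^ CARD('n)"
    by (simp add: prod_Basis_vec inner_axis ab)
  have sub: "box a b \<subseteq> cell i x" "cell i x \<subseteq> cbox a b"
    by (auto simp: mem_box_cart cell_def idx_eq_int_iff[of i _ "idx i x"] a_def b_def less_imp_le)
  have "emeasure lborel (cell i x) \<le> ennreal (side i ^ CARD('n))"
    using emeasure_mono[OF sub(2), of lborel] 1 2 by (simp add: emeasure_lborel_cbox_eq)
  moreover have "ennreal (side i ^ CARD('n)) \<le> emeasure lborel (cell i x)"
    using emeasure_mono[OF sub(1), of lborel] 1 2 by (simp add: emeasure_lborel_box_eq)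
  ultimately show ?thesis by simp
qed

lemma side_power_mult_inverse: "ennreal (side i ^ m) * ennreal ((1 / side i) ^ m) = 1"
  by (simp add: power_one_over flip: ennreal_mult)

lemma cell_avg_const:
  assumes "\<And>y. y \<in> cell i x \<Longrightarrow> f y = c"
  shows "cell_avg i f x = c"
proof -
  have "(\<integral>\<^sup>+y\<in>cell i x. f y \<partial>lborel) = (\<integral>\<^sup>+y\<in>cell i x. c \<partial>lborel)"
    using assms by (intro nn_integral_cong) (auto simp: indicator_def)
  also have "\<dots> = c * ennreal (side i ^ CARD('n))"
    by (subst nn_integral_cmult_indicator) (auto simp: emeasure_cell)
  finally show ?thesis
    using side_power_mult_inverse[of i "CARD('n)"] by (simp add: cell_avg_def mult_ac)
qed

lemma cell_avg_adapted: "idx i x = idx i y \<Longrightarrow> cell_avg i f x = cell_avg i f y"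
  unfolding cell_avg_def by (simp only: cell_cong[of i x y])

lemma cell_avg_mono:
  "(\<And>y. y \<in> cell i x \<Longrightarrow> f y \<le> g y) \<Longrightarrow> cell_avg i f x \<le> cell_avg i g x"
  unfolding cell_avg_def
  by (intro mult_left_mono nn_integral_mono) (auto simp: indicator_def)

lemma cell_avg_add:
  assumes "f \<in> borel_measurable borel" "g \<in> borel_measurable borel"
  shows "cell_avg i (\<lambda>y. f y + g y) x = cell_avg i f x + cell_avg i g x"
  unfolding cell_avg_def distrib_right distrib_left[symmetric] using assms
  by (subst nn_integral_add) (auto intro!: borel_measurable_times_ennreal borel_measurable_indicator)

lemma cell_avg_measurable [measurable]: "cell_avg i f \<in> borel_measurable borel"
  by (rule level_measurable) (rule cell_avg_adapted)

text \<open>Tonelli's theorem for the kernel \<open>ind\<close>, which is symmetric: after the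
  exchange the inner integral is the volume of the cell of y, and saturation moves the indicator of
  \<open>S\<close> from x to y.\<close>

lemma nn_integral_cell_avg:
  assumes [measurable]: "f \<in> borel_measurable borel" and S: "saturated i S"
  shows "(\<integral>\<^sup>+x\<in>S. cell_avg i f x \<partial>lborel) = (\<integral>\<^sup>+x\<in>S. f x \<partial>lborel)"
proof -
  have [measurable]: "S \<in> sets borel" using S by (simp add: saturated_def)
  let ?k = "ennreal ((1 / side i) ^ CARD('n))"
  define ind where "ind x y = (if idx i x = idx i y then 1 else 0::ennreal)" for x y
  have ind [measurable]: "case_prod ind \<in> borel_measurable (borel \<Otimes>\<^sub>M borel)"
    unfolding ind_def case_prod_beta
    using cell_pair_measurable[of i] by (simp add: case_prod_beta)
  have "(\<integral>\<^sup>+x\<in>S. cell_avg i f x \<partial>lborel)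
    = (\<integral>\<^sup>+x. \<integral>\<^sup>+y. ?k * (f y * ind x y * indicator S x) \<partial>lborel \<partial>lborel)"
  proof (intro nn_integral_cong)
    fix x
    have "(\<integral>\<^sup>+y. ?k * (f y * ind x y * indicator S x) \<partial>lborel)
      = ?k * ((\<integral>\<^sup>+y. f y * ind x y \<partial>lborel) * indicator S x)"
      by (subst nn_integral_cmult, simp, subst nn_integral_multc) auto
    also have "(\<integral>\<^sup>+y. f y * ind x y \<partial>lborel) = (\<integral>\<^sup>+y\<in>cell i x. f y \<partial>lborel)"
      by (intro nn_integral_cong) (auto simp: ind_def cell_def)
    finally show "cell_avg i f x * indicator S x = (\<integral>\<^sup>+y. ?k * (f y * ind x y * indicator S x) \<partial>lborel)"
      by (simp add: cell_avg_def mult_ac)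
  qed
  also have "\<dots> = (\<integral>\<^sup>+y. \<integral>\<^sup>+x. ?k * (f y * ind x y * indicator S x) \<partial>lborel \<partial>lborel)"
    by (rule nn_integral_swap_lborel) measurable
  also have "\<dots> = (\<integral>\<^sup>+y\<in>S. f y \<partial>lborel)"
  proof (intro nn_integral_cong)
    fix y
    have "(\<integral>\<^sup>+x. ?k * (f y * ind x y * indicator S x) \<partial>lborel)
       = (\<integral>\<^sup>+x. ?k * (f y * indicator S y) * indicator (cell i y) x \<partial>lborel)"
    proof (intro nn_integral_cong)
      fix x show "?k * (f y * ind x y * indicator S x) = ?k * (f y * indicator S y) * indicator (cell i y) x"
        using saturatedD[OF S, of x y]
        by (cases "idx i x = idx i y") (auto simp: ind_def cell_def indicator_def)
    qed
    also have "\<dots> = ?k * (f y * indicator S y) * ennreal (side i ^ CARD('n))"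
      by (subst nn_integral_cmult_indicator) (auto simp: emeasure_cell)
    also have "\<dots> = f y * indicator S y * (ennreal (side i ^ CARD('n)) * ?k)"
      by (simp add: mult_ac)
    finally show "(\<integral>\<^sup>+x. ?k * (f y * ind x y * indicator S x) \<partial>lborel) = f y * indicator S y"
      unfolding side_power_mult_inverse by simp
  qed
  finally show ?thesis .
qed

text \<open>The normalisation of the content times the factor \<open>n ^ \<beta>\<close>, with n the
  dimension, that comes from enclosing a cell of side length s in a ball of radius
  \<open>n * s\<close>.\<close>

definition content_const :: "real \<Rightarrow> real" where
  "content_const \<beta> = pi powr (\<beta> / 2) / Gamma (\<beta> / 2 + 1) * real CARD('n) powr \<beta>"

lemma content_const_nonneg: "0 < \<beta> \<Longrightarrow> 0 \<le> content_const \<beta>"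
  unfolding content_const_def
  by (intro mult_nonneg_nonneg less_imp_le[OF content_normalization_pos]) auto

text \<open>A cell of side length s has content at most a constant times \<open>s ^ (n - k)\<close>,
  which is \<open>(1 / s) ^ k\<close> times its volume. In this form the bound is additive over
  cells and passes to unions of cells.\<close>

lemma content_saturated_le:
  assumes S: "saturated i S" and k: "k < CARD('n)" and \<beta>: "\<beta> = real CARD('n) - real k"
  shows "hausdorff_content \<beta> S
    \<le> ennreal (content_const \<beta>) * (ennreal ((1 / side i) ^ k) * emeasure lborel S)"
proof -
  have \<beta>0: "0 < \<beta>" using k \<beta> by simp
  let ?K = "ennreal (content_const \<beta>)" and ?s = "ennreal ((1 / side i) ^ k)"
  have [measurable]: "S \<in> sets borel" using S by (simp add: saturated_def)
  define A where "A m = {y \<in> S. to_nat (idx i y) = m}" for m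
  have A [measurable]: "A m \<in> sets lborel" for m
    unfolding A_def by measurable
  have le: "hausdorff_content \<beta> (A m) \<le> ?K * (?s * emeasure lborel (A m))" for m
  proof (cases "A m = {}")
    case True then show ?thesis by (simp add: hausdorff_content_empty[OF \<beta>0])
  next
    case False
    then obtain x where x: "x \<in> S" "m = to_nat (idx i x)" by (auto simp: A_def)
    have "y \<in> A m \<longleftrightarrow> y \<in> cell i x" for y
      using saturatedD[OF S, of y x] x by (cases "idx i y = idx i x") (simp_all add: A_def cell_def)
    then have eq: "A m = cell i x" by blast
    have "hausdorff_content \<beta> (A m)
      \<le> ennreal (pi powr (\<beta> / 2) / Gamma (\<beta> / 2 + 1) * (real CARD('n) * side i) powr \<beta>)"
      unfolding eq by (intro hausdorff_content_subset_ball[OF cell_subset_ball] \<beta>0) simp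
    also have "pi powr (\<beta> / 2) / Gamma (\<beta> / 2 + 1) * (real CARD('n) * side i) powr \<beta>
      = content_const \<beta> * side i powr \<beta>"
      by (simp add: powr_mult content_const_def)
    also have "side i powr \<beta> = (1 / side i) ^ k * side i ^ CARD('n)"
      by (simp add: \<beta> powr_diff powr_realpow power_one_over field_simps)
    also have "ennreal (content_const \<beta> * ((1 / side i) ^ k * side i ^ CARD('n)))
      = ?K * (?s * emeasure lborel (A m))"
      using content_const_nonneg[OF \<beta>0] by (simp add: eq emeasure_cell ennreal_mult)
    finally show ?thesis .
  qed
  have US: "S = (\<Union>m. A m)" by (auto simp: A_def)
  have "hausdorff_content \<beta> S \<le> (\<Sum>m. hausdorff_content \<beta> (A m))"
    unfolding US by (rule hausdorff_content_UN_le)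
  also have "\<dots> \<le> (\<Sum>m. ?K * (?s * emeasure lborel (A m)))"
    by (intro suminf_le le) auto
  also have "\<dots> = ?K * (?s * (\<Sum>m. emeasure lborel (A m)))" by simp
  also have "(\<Sum>m. emeasure lborel (A m)) = emeasure lborel (\<Union>m. A m)"
    by (intro suminf_emeasure) (auto simp: disjoint_family_on_def A_def)
  finally show ?thesis unfolding US[symmetric] .
qed

lemma nn_integral_between_le:
  fixes s a :: ennreal
  shows "(\<integral>\<^sup>+t\<in>{0..}. of_bool (s \<le> ennreal t \<and> ennreal t < s + a) \<partial>lborel) \<le> a"
proof (cases "s = top \<or> a = top")
  case True
  then show ?thesis
  proof
    assume "s = top"
    then show ?thesis by (simp add: top_unique)
  qed simp
next
  case False
  then obtain s' a' where sa: "s = ennreal s'" "a = ennreal a'" "0 \<le> s'" "0 \<le> a'"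
    by (metis ennreal_cases)
  have "(\<integral>\<^sup>+t\<in>{0..}. of_bool (s \<le> ennreal t \<and> ennreal t < s + a) \<partial>lborel)
    \<le> (\<integral>\<^sup>+t. indicator {s'..s' + a'} t \<partial>lborel)"
    by (intro nn_integral_mono)
      (use sa in \<open>auto simp: indicator_def ennreal_less_iff simp flip: ennreal_plus split: if_splits\<close>)
  then show ?thesis using sa by simp
qed

text \<open>A stopping-time argument: the superlevel set at height \<open>t\<close> is covered by the cells of the
  first level at which the partial sum exceeds \<open>t\<close>.\<close>

lemma choquet_adapted_le:
  assumes a: "adapted a" and k: "k < CARD('n)" and \<beta>: "\<beta> = real CARD('n) - real k"
  shows "choquet_integral \<beta> A (\<lambda>x. \<Sum>i. a i x) \<le>
    ennreal (content_const \<beta>) * (\<Sum>i. ennreal ((1 / side i) ^ k) * (\<integral>\<^sup>+x. a i x \<partial>lborel))"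
proof -
  let ?K = "ennreal (content_const \<beta>)" and ?s = "\<lambda>i. ennreal ((1 / side i) ^ k)"
  have am [measurable]: "\<And>i. a i \<in> borel_measurable borel" using a by (rule adapted_measurable)
  define s where "s i x = (\<Sum>m<i. a m x)" for i x
  have sm [measurable]: "\<And>i. s i \<in> borel_measurable borel" unfolding s_def by measurable
  define S where "S i t = {x. s i x \<le> ennreal t \<and> ennreal t < s i x + a i x}" for i t
  have S [measurable]: "S i t \<in> sets borel" for i t unfolding S_def by measurable
  have sat: "saturated i (S i t)" for i t
  proof -
    have "s i x = s i y" "a i x = a i y" if "idx i x = idx i y" for x y
    proof -
      have *: "a m x = a m y" if "m \<le> i" for m
        by (rule adaptedD[OF a idx_refine[OF that \<open>idx i x = idx i y\<close>]])
      show "s i x = s i y" unfolding s_def by (intro sum.cong refl *) simp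
      show "a i x = a i y" by (rule *) simp
    qed
    note inv = this
    show ?thesis
    proof (rule saturatedI[OF S])
      fix x y assume "idx i x = idx i y" "x \<in> S i t"
      then show "y \<in> S i t" using inv[OF \<open>idx i x = idx i y\<close>] by (simp add: S_def)
    qed
  qed
  have cover: "{x \<in> A. (\<Sum>i. a i x) > ennreal t} \<subseteq> (\<Union>i. S i t)" for t
  proof
    fix x assume "x \<in> {x \<in> A. (\<Sum>i. a i x) > ennreal t}"
    then obtain N where "ennreal t < s N x"
      by (auto simp: suminf_eq_SUP less_SUP_iff s_def)
    moreover have "\<not> ennreal t < s 0 x" by (simp add: s_def)
    ultimately obtain i where "\<not> ennreal t < s i x" "ennreal t < s (Suc i) x"
      using ex_least_nat_less[of "\<lambda>i. ennreal t < s i x" N] by blast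
    then show "x \<in> (\<Union>i. S i t)" by (auto simp: S_def s_def not_less)
  qed
  have "choquet_integral \<beta> A (\<lambda>x. \<Sum>i. a i x)
    \<le> (\<integral>\<^sup>+t. (\<Sum>i. ?K * (?s i * (\<integral>\<^sup>+x. indicator (S i t) x * indicator {0..} t \<partial>lborel))) \<partial>lborel)"
    unfolding choquet_integral_def
  proof (intro nn_integral_mono)
    fix t :: real
    have "hausdorff_content \<beta> {x \<in> A. (\<Sum>i. a i x) > ennreal t} \<le> hausdorff_content \<beta> (\<Union>i. S i t)"
      by (rule hausdorff_content_mono[OF cover])
    also have "\<dots> \<le> (\<Sum>i. hausdorff_content \<beta> (S i t))" by (rule hausdorff_content_UN_le)
    also have "\<dots> \<le> (\<Sum>i. ?K * (?s i * emeasure lborel (S i t)))"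
      by (intro suminf_le content_saturated_le[OF sat k \<beta>]) auto
    finally have "hausdorff_content \<beta> {x \<in> A. (\<Sum>i. a i x) > ennreal t} * indicator {0..} t
       \<le> (\<Sum>i. ?K * (?s i * emeasure lborel (S i t))) * indicator {0..} t"
      by (rule mult_right_mono) simp
    also have "\<dots> = (\<Sum>i. ?K * (?s i * (\<integral>\<^sup>+x. indicator (S i t) x * indicator {0..} t \<partial>lborel)))"
      by (cases "0 \<le> t") auto
    finally show "hausdorff_content \<beta> {x \<in> A. (\<Sum>i. a i x) > ennreal t} * indicator {0..} t
       \<le> (\<Sum>i. ?K * (?s i * (\<integral>\<^sup>+x. indicator (S i t) x * indicator {0..} t \<partial>lborel)))" .
  qed
  also have "\<dots> = (\<Sum>i. \<integral>\<^sup>+t. ?K * (?s i * (\<integral>\<^sup>+x. indicator (S i t) x * indicator {0..} t \<partial>lborel)) \<partial>lborel)"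
    by (intro nn_integral_suminf) (simp add: S_def indicator_def, measurable)
  also have "\<dots> \<le> (\<Sum>i. ?K * (?s i * (\<integral>\<^sup>+x. a i x \<partial>lborel)))"
  proof (intro suminf_le)
    fix i
    have m: "(\<lambda>(t, x). indicator (S i t) x * indicator {0..} t :: ennreal)
        \<in> borel_measurable (borel \<Otimes>\<^sub>M borel)"
      unfolding S_def indicator_def case_prod_beta mem_Collect_eq by measurable
    have "(\<integral>\<^sup>+t. ?K * (?s i * (\<integral>\<^sup>+x. indicator (S i t) x * indicator {0..} t \<partial>lborel)) \<partial>lborel)
      = ?K * (?s i * (\<integral>\<^sup>+t. \<integral>\<^sup>+x. indicator (S i t) x * indicator {0..} t \<partial>lborel \<partial>lborel))"
      by (subst nn_integral_cmult, (simp add: S_def indicator_def, measurable)[1],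
          subst nn_integral_cmult, (simp add: S_def indicator_def, measurable)[1], rule refl)
    also have "(\<integral>\<^sup>+t. \<integral>\<^sup>+x. indicator (S i t) x * indicator {0..} t \<partial>lborel \<partial>lborel)
      = (\<integral>\<^sup>+x. \<integral>\<^sup>+t. indicator (S i t) x * indicator {0..} t \<partial>lborel \<partial>lborel)"
      using m by (rule nn_integral_swap_lborel)
    \<comment> \<open>For fixed x the heights t with x in \<open>S i t\<close> form the interval
      from \<open>s i x\<close> to \<open>s i x + a i x\<close>, so integrating over t charges the
      weight \<open>a i x\<close> exactly once.\<close>
    also have "\<dots> \<le> (\<integral>\<^sup>+x. a i x \<partial>lborel)"
    proof (intro nn_integral_mono)
      fix x
      show "(\<integral>\<^sup>+t. indicator (S i t) x * indicator {0..} t \<partial>lborel) \<le> a i x"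
        using nn_integral_between_le[of "s i x" "a i x"]
        by (simp add: S_def indicator_def)
    qed
    finally show "(\<integral>\<^sup>+t. ?K * (?s i * (\<integral>\<^sup>+x. indicator (S i t) x * indicator {0..} t \<partial>lborel)) \<partial>lborel)
      \<le> ?K * (?s i * (\<integral>\<^sup>+x. a i x \<partial>lborel))"
      by (simp add: mult_left_mono)
  qed auto
  also have "\<dots> = ?K * (\<Sum>i. ?s i * (\<integral>\<^sup>+x. a i x \<partial>lborel))" by simp
  finally show ?thesis .
qed

end

subsection \<open>Poincare inequalities\<close>

lemma nn_integral_affine:
  fixes f :: "'a::euclidean_space \<Rightarrow> ennreal"
  assumes [measurable]: "f \<in> borel_measurable borel" and c: "c \<noteq> 0"
  shows "(\<integral>\<^sup>+x. f x \<partial>lborel) = ennreal (\<bar>c\<bar> ^ DIM('a)) * (\<integral>\<^sup>+x. f (t + c *\<^sub>R x) \<partial>lborel)"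
  by (subst lborel_affine[OF c, of t])
     (simp add: nn_integral_density nn_integral_distr nn_integral_cmult)

text \<open>By convexity the contraction towards x maps \<open>T\<close> into itself, and its
  Jacobian \<open>s ^ n\<close>, with n the dimension, is at least \<open>1 / 2 ^ n\<close> for
  \<open>s \<ge> 1/2\<close>. Arbitrarily small s would give an unbounded factor.\<close>

lemma nn_integral_contract_le:
  fixes T :: "'a::euclidean_space set"
  assumes T: "convex T" and [measurable]: "T \<in> sets borel" "h \<in> borel_measurable borel"
    and s: "1/2 \<le> s" "s \<le> 1" and x: "x \<in> T"
  shows "(\<integral>\<^sup>+y\<in>T. h (x + s *\<^sub>R (y - x)) \<partial>lborel) \<le> 2 ^ DIM('a) * (\<integral>\<^sup>+y\<in>T. h y \<partial>lborel)"
proof -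
  let ?f = "\<lambda>z. h z * indicator T z"
  have mem: "x + s *\<^sub>R (y - x) \<in> T" if "y \<in> T" for y
  proof -
    have "x + s *\<^sub>R (y - x) = (1 - s) *\<^sub>R x + s *\<^sub>R y" by (simp add: algebra_simps)
    then show ?thesis using convexD[OF T x that, of "1 - s" s] s by simp
  qed
  have "(\<integral>\<^sup>+y\<in>T. h (x + s *\<^sub>R (y - x)) \<partial>lborel) \<le> (\<integral>\<^sup>+y. ?f ((x - s *\<^sub>R x) + s *\<^sub>R y) \<partial>lborel)"
    using mem by (intro nn_integral_mono) (auto simp: indicator_def algebra_simps)
  also have "\<dots> \<le> ennreal (2 ^ DIM('a)) * (ennreal (\<bar>s\<bar> ^ DIM('a)) * (\<integral>\<^sup>+y. ?f ((x - s *\<^sub>R x) + s *\<^sub>R y) \<partial>lborel))"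
  proof -
    have "1 \<le> (2 * s) ^ DIM('a)" using s by (intro one_le_power) simp
    then have "ennreal 1 \<le> ennreal (2 ^ DIM('a) * \<bar>s\<bar> ^ DIM('a))"
      using s by (intro ennreal_leI) (simp add: power_mult_distrib)
    then have "1 \<le> ennreal (2 ^ DIM('a)) * ennreal (\<bar>s\<bar> ^ DIM('a))"
      by (simp add: ennreal_mult)
    from mult_right_mono[OF this] show ?thesis by (fastforce simp: mult.assoc)
  qed
  also have "ennreal (\<bar>s\<bar> ^ DIM('a)) * (\<integral>\<^sup>+y. ?f ((x - s *\<^sub>R x) + s *\<^sub>R y) \<partial>lborel) = (\<integral>\<^sup>+y. ?f y \<partial>lborel)"
    using s by (intro nn_integral_affine[symmetric]) auto
  finally show ?thesis by (simp flip: ennreal_power)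
qed

text \<open>The difference is bounded by an integral over the segment from x to y, and the roles of
  the end points are symmetric. On the half of the segment near y the inner integration runs over y,
  on the half near x it runs over x; in both cases the contraction factor is at least 1/2, so no
  singular kernel arises. The density \<open>h\<close> is kept abstract so that it can be the
  gradient or the gradient restricted to a band of values.\<close>

lemma poincare_double_integral:
  fixes T :: "'a::euclidean_space set" and F :: "'a \<Rightarrow> real"
  assumes T: "convex T" and [measurable]: "T \<in> sets borel" "h \<in> borel_measurable borel"
      "F \<in> borel_measurable borel"
    and F: "\<And>x y. x \<in> T \<Longrightarrow> y \<in> T \<Longrightarrow>
      ennreal \<bar>F x - F y\<bar> \<le> d * (\<integral>\<^sup>+s\<in>{0..1}. h (x + s *\<^sub>R (y - x)) \<partial>lborel)"
  shows "(\<integral>\<^sup>+x\<in>T. (\<integral>\<^sup>+y\<in>T. ennreal \<bar>F x - F y\<bar> \<partial>lborel) \<partial>lborel)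
    \<le> d * (2 ^ DIM('a) * (emeasure lborel T * (\<integral>\<^sup>+y\<in>T. h y \<partial>lborel)))"
proof -
  let ?I = "\<integral>\<^sup>+y\<in>T. h y \<partial>lborel"
  define k where "k x y s = h (x + s *\<^sub>R (y - x)) * indicator T x * indicator T y * indicator {0..1} s"
    for x y and s :: real
  have [measurable (raw)]: "(\<lambda>w. k (a w) (b w) (c w)) \<in> borel_measurable M"
    if [measurable]: "a \<in> borel_measurable M" "b \<in> borel_measurable M" "c \<in> borel_measurable M"
    for a b c and M :: "'z measure"
    unfolding k_def by measurable
  have Jy: "(\<integral>\<^sup>+y. k x y s \<partial>lborel) \<le> 2 ^ DIM('a) * ?I * indicator T x * indicator {0..1} s"
    if "1/2 \<le> s" for x s
  proof (cases "x \<in> T \<and> s \<le> 1")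
    case True
    then have "(\<integral>\<^sup>+y. k x y s \<partial>lborel) = (\<integral>\<^sup>+y\<in>T. h (x + s *\<^sub>R (y - x)) \<partial>lborel)"
      using that by (intro nn_integral_cong) (auto simp: k_def)
    then show ?thesis using nn_integral_contract_le[OF T, of h s x] that True by simp
  qed (auto simp: k_def)
  have Jx: "(\<integral>\<^sup>+x. k x y s \<partial>lborel) \<le> 2 ^ DIM('a) * ?I * indicator T y * indicator {0..1} s"
    if "s < 1/2" for y s
  proof (cases "y \<in> T \<and> 0 \<le> s")
    case True
    then have "(\<integral>\<^sup>+x. k x y s \<partial>lborel) = (\<integral>\<^sup>+x\<in>T. h (y + (1 - s) *\<^sub>R (x - y)) \<partial>lborel)"
      using that by (intro nn_integral_cong) (auto simp: k_def algebra_simps)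
    then show ?thesis using nn_integral_contract_le[OF T, of h "1 - s" y] that True by simp
  qed (auto simp: k_def)
  have J: "(\<integral>\<^sup>+x. \<integral>\<^sup>+y. k x y s \<partial>lborel \<partial>lborel)
      \<le> 2 ^ DIM('a) * (emeasure lborel T * ?I) * indicator {0..1} s" for s
  proof -
    have *: "(\<integral>\<^sup>+x. 2 ^ DIM('a) * ?I * indicator T x * indicator {0..1} s \<partial>lborel)
      = 2 ^ DIM('a) * (emeasure lborel T * ?I) * indicator {0..1} s"
      by (simp add: nn_integral_multc nn_integral_cmult_indicator mult_ac)
    show ?thesis
    proof (cases "1/2 \<le> s")
      case True
      then show ?thesis unfolding *[symmetric] by (intro nn_integral_mono Jy)
    next
      case False
      have "(\<integral>\<^sup>+x. \<integral>\<^sup>+y. k x y s \<partial>lborel \<partial>lborel) = (\<integral>\<^sup>+y. \<integral>\<^sup>+x. k x y s \<partial>lborel \<partial>lborel)"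
        by (rule nn_integral_swap_lborel) measurable
      also have "\<dots> \<le> 2 ^ DIM('a) * (emeasure lborel T * ?I) * indicator {0..1} s"
        unfolding *[symmetric] using False by (intro nn_integral_mono Jx) simp
      finally show ?thesis .
    qed
  qed
  have "(\<integral>\<^sup>+x\<in>T. (\<integral>\<^sup>+y\<in>T. ennreal \<bar>F x - F y\<bar> \<partial>lborel) \<partial>lborel)
    = (\<integral>\<^sup>+x. (\<integral>\<^sup>+y. ennreal \<bar>F x - F y\<bar> * indicator T y * indicator T x \<partial>lborel) \<partial>lborel)"
    by (simp add: nn_integral_multc)
  also have "\<dots> \<le> (\<integral>\<^sup>+x. \<integral>\<^sup>+y. d * (\<integral>\<^sup>+s. k x y s \<partial>lborel) \<partial>lborel \<partial>lborel)"
  proof (intro nn_integral_mono)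
    fix x y
    show "ennreal \<bar>F x - F y\<bar> * indicator T y * indicator T x \<le> d * (\<integral>\<^sup>+s. k x y s \<partial>lborel)"
      using F[of x y] by (auto simp: indicator_def k_def)
  qed
  also have "\<dots> = d * (\<integral>\<^sup>+x. \<integral>\<^sup>+y. \<integral>\<^sup>+s. k x y s \<partial>lborel \<partial>lborel \<partial>lborel)"
    by (simp add: nn_integral_cmult)
  also have "(\<integral>\<^sup>+x. \<integral>\<^sup>+y. \<integral>\<^sup>+s. k x y s \<partial>lborel \<partial>lborel \<partial>lborel)
    = (\<integral>\<^sup>+x. \<integral>\<^sup>+s. \<integral>\<^sup>+y. k x y s \<partial>lborel \<partial>lborel \<partial>lborel)"
    by (intro nn_integral_cong nn_integral_swap_lborel) measurable
  also have "\<dots> = (\<integral>\<^sup>+s. \<integral>\<^sup>+x. \<integral>\<^sup>+y. k x y s \<partial>lborel \<partial>lborel \<partial>lborel)"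
    by (intro nn_integral_swap_lborel) measurable
  also have "\<dots> \<le> (\<integral>\<^sup>+s. 2 ^ DIM('a) * (emeasure lborel T * ?I) * indicator {0..1::real} s \<partial>lborel)"
    by (intro nn_integral_mono J)
  also have "\<dots> = 2 ^ DIM('a) * (emeasure lborel T * ?I)"
    by (simp add: nn_integral_cmult_indicator)
  finally show ?thesis by (simp add: mult_left_mono)
qed

text \<open>Take the last point s with value at most \<alpha> and then the first point t after s
  with value at least \<beta>; nothing in between can leave the open band.\<close>

lemma crossing_interval:
  fixes g :: "real \<Rightarrow> real"
  assumes g: "continuous_on {a..b} g" and ab: "a \<le> b" and "g a \<le> \<alpha>" "\<alpha> < \<beta>" "\<beta> \<le> g b"
  obtains s t where "a \<le> s" "s \<le> t" "t \<le> b" "g s \<le> \<alpha>" "\<beta> \<le> g t"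
    "\<And>r. s < r \<Longrightarrow> r < t \<Longrightarrow> \<alpha> < g r \<and> g r < \<beta>"
proof -
  let ?S = "{a..b} \<inter> g -` {..\<alpha>}"
  have "closed ?S" using continuous_closed_preimage[OF g] by simp
  then have "compact ?S" by (simp add: compact_eq_bounded_closed bounded_Int)
  moreover have "?S \<noteq> {}" using assms by auto
  ultimately obtain s where s: "s \<in> ?S" "\<And>r. r \<in> ?S \<Longrightarrow> r \<le> s" using compact_attains_sup[of ?S] by blast
  let ?T = "{s..b} \<inter> g -` {\<beta>..}"
  have "continuous_on {s..b} g" using g by (rule continuous_on_subset) (use s in auto)
  then have "closed ?T" using continuous_closed_preimage by blast
  then have "compact ?T" by (simp add: compact_eq_bounded_closed bounded_Int)
  moreover have "?T \<noteq> {}" using assms s by auto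
  ultimately obtain t where t: "t \<in> ?T" "\<And>r. r \<in> ?T \<Longrightarrow> t \<le> r" using compact_attains_inf[of ?T] by blast
  show ?thesis
  proof (rule that[of s t])
    fix r assume r: "s < r" "r < t"
    have "r \<notin> ?S" using s(2)[of r] r by fastforce
    moreover have "r \<notin> ?T" using t(2)[of r] r by fastforce
    ultimately show "\<alpha> < g r \<and> g r < \<beta>" using r s t by auto
  qed (use s t in auto)
qed

definition clip :: "real \<Rightarrow> real \<Rightarrow> real \<Rightarrow> real" where
  "clip t1 t2 x = max t1 (min x t2)"

text \<open>A truncation is not differentiable at the ends of its band, so no chain rule is used.
  Instead the change of the truncated function is realised on a subinterval in whose interior g
  stays in the band, and the hypothesis is applied to that subinterval only.\<close>

lemma clip_variation_le:
  fixes g :: "real \<Rightarrow> real" and h :: "real \<Rightarrow> ennreal"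
  assumes g: "continuous_on {0..1} g" and [measurable]: "h \<in> borel_measurable borel"
    and gh: "\<And>a b. 0 \<le> a \<Longrightarrow> a \<le> b \<Longrightarrow> b \<le> 1 \<Longrightarrow> ennreal \<bar>g b - g a\<bar> \<le> (\<integral>\<^sup>+s\<in>{a..b}. h s \<partial>lborel)"
    and t: "t1 \<le> t2"
  shows "ennreal \<bar>clip t1 t2 (g 1) - clip t1 t2 (g 0)\<bar>
    \<le> (\<integral>\<^sup>+s\<in>{0..1}. h s * indicator {t1<..t2} (g s) \<partial>lborel)"
proof -
  have "\<exists>s r. 0 \<le> s \<and> s \<le> r \<and> r \<le> 1 \<and> \<bar>clip t1 t2 (g 1) - clip t1 t2 (g 0)\<bar> \<le> \<bar>g r - g s\<bar> \<and>
      (\<forall>q. s < q \<longrightarrow> q < r \<longrightarrow> t1 < g q \<and> g q \<le> t2)"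
  proof -
    consider "clip t1 t2 (g 1) = clip t1 t2 (g 0)" | "clip t1 t2 (g 0) < clip t1 t2 (g 1)"
      | "clip t1 t2 (g 1) < clip t1 t2 (g 0)" by linarith
    then show ?thesis
    proof cases
      case 1
      then show ?thesis by (intro exI[of _ 0]) auto
    next
      case 2
      have "g 0 \<le> clip t1 t2 (g 0)" "clip t1 t2 (g 1) \<le> g 1" using 2 t by (auto simp: clip_def max_def min_def split: if_splits)
      from crossing_interval[OF g _ this(1) 2 this(2)] obtain s r where
        sr: "0 \<le> s" "s \<le> r" "r \<le> 1" "g s \<le> clip t1 t2 (g 0)" "clip t1 t2 (g 1) \<le> g r"
        "\<And>q. s < q \<Longrightarrow> q < r \<Longrightarrow> clip t1 t2 (g 0) < g q \<and> g q < clip t1 t2 (g 1)" by auto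
      have "t1 < g q \<and> g q \<le> t2" if "s < q" "q < r" for q
        using sr(6)[OF that] t by (auto simp: clip_def max_def min_def split: if_splits)
      then show ?thesis using sr 2 by (intro exI[of _ s] exI[of _ r]) auto
    next
      \<comment> \<open>The decreasing case is the increasing one for the reflected function
        \<open>- g\<close>.\<close>
      case 3
      have "- g 0 \<le> - clip t1 t2 (g 0)" "- clip t1 t2 (g 1) \<le> - g 1" using 3 t by (auto simp: clip_def max_def min_def split: if_splits)
      moreover have "continuous_on {0..1} (\<lambda>x. - g x)" using g by (intro continuous_intros)
      ultimately obtain s r where
        sr: "0 \<le> s" "s \<le> r" "r \<le> 1" "- g s \<le> - clip t1 t2 (g 0)" "- clip t1 t2 (g 1) \<le> - g r"
        "\<And>q. s < q \<Longrightarrow> q < r \<Longrightarrow> - clip t1 t2 (g 0) < - g q \<and> - g q < - clip t1 t2 (g 1)"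
        using crossing_interval[of 0 1 "\<lambda>x. - g x" "- clip t1 t2 (g 0)" "- clip t1 t2 (g 1)"] 3 by auto
      have "t1 < g q \<and> g q \<le> t2" if "s < q" "q < r" for q
        using sr(6)[OF that] t by (auto simp: clip_def max_def min_def split: if_splits)
      then show ?thesis using sr 3 by (intro exI[of _ s] exI[of _ r]) auto
    qed
  qed
  then obtain s r where sr: "0 \<le> s" "s \<le> r" "r \<le> 1"
    "\<bar>clip t1 t2 (g 1) - clip t1 t2 (g 0)\<bar> \<le> \<bar>g r - g s\<bar>"
    "\<And>q. s < q \<Longrightarrow> q < r \<Longrightarrow> t1 < g q \<and> g q \<le> t2" by blast
  have "ennreal \<bar>clip t1 t2 (g 1) - clip t1 t2 (g 0)\<bar> \<le> ennreal \<bar>g r - g s\<bar>"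
    using sr by (intro ennreal_leI)
  also have "\<dots> \<le> (\<integral>\<^sup>+q\<in>{s..r}. h q \<partial>lborel)" using sr by (intro gh)
  also have "\<dots> \<le> (\<integral>\<^sup>+q\<in>{0..1}. h q * indicator {t1<..t2} (g q) \<partial>lborel)"
  proof (rule nn_integral_mono_AE)
    \<comment> \<open>At the two end points g may lie outside the band; they form a null
      set.\<close>
    have "AE q in lborel. q \<noteq> s" "AE q in lborel. q \<noteq> r" by (rule AE_lborel_singleton)+
    then show "AE q in lborel. h q * indicator {s..r} q \<le> h q * indicator {t1<..t2} (g q) * indicator {0..1} q"
    proof eventually_elim
      case (elim q)
      then show ?case using sr(5)[of q] sr(1-3) by (auto simp: indicator_def)
    qed
  qed
  finally show ?thesis .
qed

section \<open>Smooth functions and their variation along segments\<close>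

definition smooth :: "(real^'n::finite \<Rightarrow> real) \<Rightarrow> bool" where
  "smooth w \<longleftrightarrow> (\<forall>js x. iterated_partial js w differentiable (at x))"

text \<open>The l^1 norm is a plain sum over the components, so weights for the components add up to
  weights for it, and it pairs with the coordinatewise size of a cell.\<close>

definition grad_l1 :: "(real^'n::finite \<Rightarrow> real) \<Rightarrow> real^'n \<Rightarrow> real" where
  "grad_l1 w x = (\<Sum>c\<in>UNIV. \<bar>partial_deriv c w x\<bar>)"

lemma iterated_partial_Nil [simp]: "iterated_partial [] w = w"
  by (simp add: iterated_partial_def)

lemma iterated_partial_Cons [simp]: "iterated_partial (c # js) w = partial_deriv c (iterated_partial js w)"
  by (simp add: iterated_partial_def)

lemma iterated_partial_append: "iterated_partial (js @ ks) w = iterated_partial js (iterated_partial ks w)"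
  by (simp add: iterated_partial_def)

lemma smooth_differentiable: "smooth w \<Longrightarrow> w differentiable (at x)"
  unfolding smooth_def by (metis iterated_partial_Nil)

lemma smooth_iterated_partial: "smooth w \<Longrightarrow> smooth (iterated_partial ks w)"
  unfolding smooth_def by (metis iterated_partial_append)

lemma smooth_partial_deriv: "smooth w \<Longrightarrow> smooth (partial_deriv c w)"
  using smooth_iterated_partial[of w "[c]"] by simp

lemma smooth_continuous_on: "smooth w \<Longrightarrow> continuous_on S w"
  by (intro continuous_at_imp_continuous_on ballI differentiable_imp_continuous_within smooth_differentiable)

lemma smooth_borel_measurable [measurable (raw)]: "smooth w \<Longrightarrow> w \<in> borel_measurable borel"
  by (intro borel_measurable_continuous_onI smooth_continuous_on)

lemma grad_l1_nonneg [simp]: "0 \<le> grad_l1 w x" by (simp add: grad_l1_def sum_nonneg)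

lemma continuous_on_grad_l1: "smooth w \<Longrightarrow> continuous_on S (grad_l1 w)"
  unfolding grad_l1_def
  by (intro continuous_intros smooth_continuous_on smooth_partial_deriv)

lemma has_derivative_partial:
  assumes "w differentiable (at x)"
  shows "(w has_derivative (\<lambda>v. \<Sum>c\<in>UNIV. v $ c * partial_deriv c w x)) (at x)"
proof -
  have d: "(w has_derivative frechet_derivative w (at x)) (at x)"
    using assms by (simp add: frechet_derivative_works)
  then interpret bounded_linear "frechet_derivative w (at x)" by (rule has_derivative_bounded_linear)
  have "frechet_derivative w (at x) v = (\<Sum>c\<in>UNIV. v $ c * partial_deriv c w x)" for v
  proof -
    have "frechet_derivative w (at x) v = frechet_derivative w (at x) (\<Sum>c\<in>UNIV. v $ c *\<^sub>R axis c 1)"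
      by (simp add: basis_expansion flip: scalar_mult_eq_scaleR)
    also have "\<dots> = (\<Sum>c\<in>UNIV. v $ c * partial_deriv c w x)"
      by (simp add: sum scaleR partial_deriv_def)
    finally show ?thesis .
  qed
  then have "frechet_derivative w (at x) = (\<lambda>v. \<Sum>c\<in>UNIV. v $ c * partial_deriv c w x)" by blast
  then show ?thesis using d by simp
qed

lemma smooth_segment_diff_le:
  assumes w: "smooth w" and ab: "a \<le> b" and d: "\<And>c. \<bar>y $ c - x $ c\<bar> \<le> d"
  shows "ennreal \<bar>w (x + b *\<^sub>R (y - x)) - w (x + a *\<^sub>R (y - x))\<bar>
    \<le> ennreal d * (\<integral>\<^sup>+s\<in>{a..b}. ennreal (grad_l1 w (x + s *\<^sub>R (y - x))) \<partial>lborel)"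
proof -
  have d0: "0 \<le> d" using d[of undefined] by linarith
  let ?\<gamma> = "\<lambda>s::real. x + s *\<^sub>R (y - x)"
  let ?D = "\<lambda>s. \<Sum>c\<in>UNIV. (y - x) $ c * partial_deriv c w (?\<gamma> s)"
  have der: "((\<lambda>s. w (?\<gamma> s)) has_vector_derivative ?D s) (at s within {a..b})" for s
  proof -
    have "((\<lambda>s. ?\<gamma> s) has_derivative (\<lambda>h. h *\<^sub>R (y - x))) (at s within {a..b})"
      by (auto intro!: derivative_eq_intros)
    from has_derivative_compose[OF this has_derivative_partial[OF smooth_differentiable[OF w]]]
    show ?thesis unfolding has_vector_derivative_def
      by (simp add: sum_distrib_left mult_ac)
  qed
  have I: "(?D has_integral (w (?\<gamma> b) - w (?\<gamma> a))) {a..b}"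
    using ab der by (intro fundamental_theorem_of_calculus)
  have cont: "continuous_on {a..b} (\<lambda>s. grad_l1 w (?\<gamma> s))"
  proof (rule continuous_on_compose2[OF continuous_on_grad_l1[OF w, of UNIV]])
    show "continuous_on {a..b} ?\<gamma>" by (intro continuous_intros)
  qed simp
  then have J: "((\<lambda>s. grad_l1 w (?\<gamma> s)) has_integral integral {a..b} (\<lambda>s. grad_l1 w (?\<gamma> s))) {a..b}"
    by (intro integrable_integral integrable_continuous_interval)
  have "norm (w (?\<gamma> b) - w (?\<gamma> a)) \<le> integral {a..b} (\<lambda>s. d * grad_l1 w (?\<gamma> s))"
    unfolding integral_unique[OF I, symmetric]
  proof (intro integral_norm_bound_integral)
    show "?D integrable_on {a..b}" using I by blast
    show "(\<lambda>s. d * grad_l1 w (?\<gamma> s)) integrable_on {a..b}"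
      using cont by (intro integrable_continuous_interval continuous_intros)
    show "norm (?D s) \<le> d * grad_l1 w (?\<gamma> s)" for s
      unfolding grad_l1_def sum_distrib_left real_norm_def
      using d by (intro order_trans[OF sum_abs] sum_mono) (simp add: abs_mult mult_right_mono)
  qed
  then have "ennreal \<bar>w (?\<gamma> b) - w (?\<gamma> a)\<bar> \<le> ennreal (d * integral {a..b} (\<lambda>s. grad_l1 w (?\<gamma> s)))"
    by (intro ennreal_leI) simp
  also have "\<dots> = ennreal d * ennreal (integral {a..b} (\<lambda>s. grad_l1 w (?\<gamma> s)))"
    using d0 by (intro ennreal_mult) (auto intro!: integral_nonneg has_integral_integrable[OF J])
  also have "ennreal (integral {a..b} (\<lambda>s. grad_l1 w (?\<gamma> s)))
    = (\<integral>\<^sup>+s. ennreal (indicator {a..b} s * grad_l1 w (?\<gamma> s)) \<partial>lborel)"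
  proof (rule nn_integral_has_integral_lborel[symmetric])
    have "grad_l1 w \<in> borel_measurable borel"
      by (intro borel_measurable_continuous_onI continuous_on_grad_l1 w)
    then show "(\<lambda>s. indicator {a..b} s * grad_l1 w (?\<gamma> s)) \<in> borel_measurable borel" by measurable
    have "((\<lambda>s. if s \<in> {a..b} then grad_l1 w (?\<gamma> s) else 0)
        has_integral integral {a..b} (\<lambda>s. grad_l1 w (?\<gamma> s))) UNIV"
      unfolding has_integral_restrict_UNIV by (rule J)
    then show "((\<lambda>s. indicator {a..b} s * grad_l1 w (?\<gamma> s))
        has_integral integral {a..b} (\<lambda>s. grad_l1 w (?\<gamma> s))) UNIV"
      by (rule has_integral_eq[rotated]) simp
  qed simp
  also have "\<dots> = (\<integral>\<^sup>+s\<in>{a..b}. ennreal (grad_l1 w (?\<gamma> s)) \<partial>lborel)"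
    by (intro nn_integral_cong) (auto simp: indicator_def)
  finally show ?thesis .
qed

subsection \<open>Domination by adapted weights\<close>

text \<open>q is the infimum of the nonnegative levels whose strict superlevel set has measure at
  most c. Where the distribution function jumps, no level need have measure exactly c; continuity of
  the measure from below gives the bound for the strict superlevel set, and continuity from above
  the one for the closed superlevel set.\<close>

lemma exists_quantile:
  fixes T :: "'a::euclidean_space set" and f :: "'a \<Rightarrow> real"
  assumes [measurable]: "T \<in> sets borel" "f \<in> borel_measurable borel"
    and fin: "emeasure lborel T < top" and c: "c \<le> emeasure lborel T"
    and f0: "\<And>x. x \<in> T \<Longrightarrow> 0 \<le> f x" and fK: "\<And>x. x \<in> T \<Longrightarrow> f x \<le> K"
  shows "\<exists>q\<ge>0. emeasure lborel {x \<in> T. q < f x} \<le> c \<and> c \<le> emeasure lborel {x \<in> T. q \<le> f x}"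
proof -
  let ?g = "\<lambda>t. emeasure lborel {x \<in> T. t < f x}"
  define S where "S = {t. 0 \<le> t \<and> ?g t \<le> c}"
  have m [measurable]: "{x \<in> T. t < f x} \<in> sets borel" for t by measurable
  have anti: "?g t \<le> ?g s" if "s \<le> t" for s t
    using that by (intro emeasure_mono) auto
  have *: "{x \<in> T. max K 0 < f x} = {}" using fK by force
  have ne: "max K 0 \<in> S" unfolding S_def mem_Collect_eq * by simp
  have bdd: "bdd_below S" by (auto simp: S_def bdd_below_def)
  define q where "q = Inf S"
  have q0: "0 \<le> q" unfolding q_def 
    by (rule cInf_greatest) (use ne in blast, simp add: S_def)
  have above: "?g t \<le> c" if "q < t" for t
  proof -
    have "S \<noteq> {}" using ne by blast
    then have "\<exists>s\<in>S. s < t" using \<open>q < t\<close> bdd by (simp add: q_def cInf_less_iff)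
    then obtain s where "s \<in> S" "s < t" by blast
    then show ?thesis using anti[of s t] by (auto simp: S_def)
  qed
  have below: "c \<le> ?g t" if "t < q" for t
  proof (cases "0 \<le> t")
    case True
    then have "t \<notin> S" using that cInf_lower[OF _ bdd, of t] by (auto simp: q_def)
    then show ?thesis using True by (simp add: S_def not_le less_imp_le)
  next
    case False
    then have "{x \<in> T. t < f x} = T" using f0 by force
    then show ?thesis using c by simp
  qed
  have "{x \<in> T. q < f x} = (\<Union>k. {x \<in> T. q + 1 / real (Suc k) < f x})"
  proof safe
    fix x assume "q < f x"
    then obtain k where "inverse (real (Suc k)) < f x - q" using reals_Archimedean[of "f x - q"] by auto
    moreover assume "x \<in> T"
    ultimately show "x \<in> (\<Union>k. {x \<in> T. q + 1 / real (Suc k) < f x})"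
      by (auto intro!: exI[of _ k] simp: inverse_eq_divide)
  next
    fix x k assume "q + 1 / real (Suc k) < f x"
    then show "q < f x" using of_nat_0_less_iff[of "Suc k"] by (smt (verit) divide_pos_pos zero_less_Suc)
  qed
  also have "emeasure lborel \<dots> = (SUP k. ?g (q + 1 / real (Suc k)))"
  proof (rule SUP_emeasure_incseq[symmetric])
    show "incseq (\<lambda>k. {x \<in> T. q + 1 / real (Suc k) < f x})"
    proof (rule incseq_SucI, safe)
      fix k x assume "q + 1 / real (Suc k) < f x"
      moreover have "1 / real (Suc (Suc k)) \<le> 1 / real (Suc k)" by (intro divide_left_mono) auto
      ultimately show "q + 1 / real (Suc (Suc k)) < f x" by linarith
    qed
  qed auto
  also have "\<dots> \<le> c" by (intro SUP_least above) simp
  finally have 1: "?g q \<le> c" .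
  have "(\<Inter>k. {x \<in> T. q - 1 / real (Suc k) < f x}) = {x \<in> T. q \<le> f x}"
  proof safe
    fix x assume x: "x \<in> (\<Inter>k. {x \<in> T. q - 1 / real (Suc k) < f x})"
    show "q \<le> f x"
    proof (rule ccontr)
      assume "\<not> q \<le> f x"
      then obtain k where "inverse (real (Suc k)) < q - f x" using reals_Archimedean[of "q - f x"] by auto
      moreover have "q - 1 / real (Suc k) < f x" using x by blast
      ultimately show False by (simp add: inverse_eq_divide)
    qed
  next
    fix x k assume "q \<le> f x"
    moreover have "0 < 1 / real (Suc k)" by simp
    ultimately show "q - 1 / real (Suc k) < f x" by linarith
  qed auto
  moreover have "(INF k. ?g (q - 1 / real (Suc k))) = emeasure lborel (\<Inter>k. {x \<in> T. q - 1 / real (Suc k) < f x})"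
  proof (rule INF_emeasure_decseq)
    show "decseq (\<lambda>k. {x \<in> T. q - 1 / real (Suc k) < f x})"
    proof (rule decseq_SucI, safe)
      fix k x assume "q - 1 / real (Suc (Suc k)) < f x"
      moreover have "1 / real (Suc (Suc k)) \<le> 1 / real (Suc k)" by (intro divide_left_mono) auto
      ultimately show "q - 1 / real (Suc k) < f x" by linarith
    qed
    show "emeasure lborel {x \<in> T. q - 1 / real (Suc k) < f x} \<noteq> \<infinity>" for k
      using emeasure_mono[of "{x \<in> T. q - 1 / real (Suc k) < f x}" T lborel] fin
      by (auto simp: top_unique)
  qed auto
  moreover have "c \<le> (INF k. ?g (q - 1 / real (Suc k)))" by (intro INF_greatest below) simp
  ultimately have "c \<le> emeasure lborel {x \<in> T. q \<le> f x}" by simp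
  with 1 q0 show ?thesis by blast
qed

text \<open>The last entry of a list is the direction that is differentiated first, so splitting it
  off expresses the derivatives of order \<open>m + 1\<close> of w as derivatives of order m of its
  partial derivatives.\<close>

lemma sum_lists_Suc_snoc:
  fixes F :: "'n::finite list \<Rightarrow> 'b::comm_monoid_add"
  shows "(\<Sum>js | length js = Suc m. F js) = (\<Sum>c\<in>UNIV. \<Sum>js | length js = m. F (js @ [c]))"
proof -
  have "(\<Sum>c\<in>UNIV. \<Sum>js | length js = m. F (js @ [c]))
    = (\<Sum>(c, js)\<in>UNIV \<times> {js. length js = m}. F (js @ [c]))"
    using finite_lists_length_eq[of "UNIV :: 'n set" m] by (subst sum.cartesian_product) simp
  also have "\<dots> = (\<Sum>js | length js = Suc m. F js)"
    by (rule sum.reindex_bij_witness[of _ "\<lambda>js. (last js, butlast js)" "\<lambda>(c, js). js @ [c]"])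
      (auto split: prod.splits simp flip: length_0_conv)
  finally show ?thesis by simp
qed

context grid
begin

text \<open>With \<open>k\<close> in place of \<open>j\<close>, the cost is the sum over all cells of the weight of the cell times
  its side length to the power \<open>n - k\<close>, that is, it has the scaling of the content of dimension
  \<open>n - k\<close>. The term of level \<open>i\<close> is written as an integral to avoid sums over cells.\<close>

definition cost :: "nat \<Rightarrow> (nat \<Rightarrow> real^'n \<Rightarrow> ennreal) \<Rightarrow> ennreal" where
  "cost j a = (\<Sum>i. ennreal ((1 / side i) ^ j) * (\<integral>\<^sup>+x\<in>top_cell. a i x \<partial>lborel))"

definition dominated :: "nat \<Rightarrow> (real^'n \<Rightarrow> real) \<Rightarrow> ennreal \<Rightarrow> bool" where
  "dominated j w A \<longleftrightarrow>
    (\<exists>a. adapted a \<and> (\<forall>x\<in>top_cell. ennreal \<bar>w x\<bar> \<le> (\<Sum>i. a i x)) \<and> cost j a \<le> A)"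

lemma dominated_mono: "dominated j w A \<Longrightarrow> A \<le> B \<Longrightarrow> dominated j w B"
  unfolding dominated_def by (meson order_trans)

lemma exists_small_cell:
  assumes "0 < \<delta>"
  shows "\<exists>i. cell i x \<subseteq> ball x \<delta>"
proof -
  have "(\<lambda>i. real CARD('n) * L * (1/2) ^ i) \<longlonglongrightarrow> real CARD('n) * L * 0"
    by (intro tendsto_mult tendsto_const LIMSEQ_realpow_zero) auto
  then have "\<forall>\<^sub>F i in sequentially. real CARD('n) * L * (1/2) ^ i < \<delta>"
    using assms by (intro order_tendstoD(2)) auto
  then obtain i where "real CARD('n) * L * (1/2) ^ i < \<delta>"
    by (auto simp: eventually_sequentially)
  then have "real CARD('n) * side i \<le> \<delta>" by (simp add: side_def power_one_over field_simps)
  then show ?thesis using order_trans[OF cell_subset_ball subset_ball] by blast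
qed

lemma exists_cell_lower_bound:
  fixes w :: "real^'n \<Rightarrow> real"
  assumes w: "smooth w" and "0 < e"
  obtains i where "\<And>y. y \<in> cell i x \<Longrightarrow> \<bar>w x\<bar> - e \<le> \<bar>w y\<bar>"
proof -
  have "isCont w x" using smooth_continuous_on[OF w, of UNIV] by (simp add: continuous_on_eq_continuous_at)
  then obtain \<delta> where \<delta>: "0 < \<delta>" "\<And>y. dist y x < \<delta> \<Longrightarrow> dist (w y) (w x) < e"
    using \<open>0 < e\<close> unfolding continuous_at_eps_delta by blast
  obtain i where "cell i x \<subseteq> ball x \<delta>" using exists_small_cell[OF \<delta>(1)] by blast
  then have "\<bar>w x\<bar> - e \<le> \<bar>w y\<bar>" if "y \<in> cell i x" for y
    using \<delta>(2)[of y] that by (auto simp: dist_commute dist_real_def subset_iff)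
  then show ?thesis using that by blast
qed

lemma cell_avg_const_eq: "cell_avg i (\<lambda>_. c) x = c"
  by (rule cell_avg_const) simp

text \<open>By continuity the averages over small cells of x are at least
  \<open>\<bar>w x\<bar> - e\<close>.\<close>

lemma abs_le_of_cell_avg_le:
  assumes w: "smooth w" and S: "\<And>i. cell_avg i (\<lambda>y. ennreal \<bar>w y\<bar>) x \<le> S"
  shows "ennreal \<bar>w x\<bar> \<le> S"
proof (rule ennreal_le_epsilon)
  fix e :: real assume e: "0 < e"
  obtain i where i: "\<And>y. y \<in> cell i x \<Longrightarrow> \<bar>w x\<bar> - e \<le> \<bar>w y\<bar>"
    using exists_cell_lower_bound[OF w e] by blast
  have "ennreal (\<bar>w x\<bar> - e) = cell_avg i (\<lambda>y. ennreal (\<bar>w x\<bar> - e)) x"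
    by (simp add: cell_avg_const_eq)
  also have "\<dots> \<le> cell_avg i (\<lambda>y. ennreal \<bar>w y\<bar>) x"
    by (intro cell_avg_mono ennreal_leI i)
  also have "\<dots> \<le> S" by (rule S)
  finally have "ennreal (\<bar>w x\<bar> - e) + ennreal e \<le> S + ennreal e" by (rule add_right_mono)
  moreover have "ennreal \<bar>w x\<bar> \<le> ennreal (\<bar>w x\<bar> - e) + ennreal e"
    using e by (cases "e \<le> \<bar>w x\<bar>") (auto simp flip: ennreal_plus intro!: order_trans[OF ennreal_leI[of "\<bar>w x\<bar>" e]])
  ultimately show "ennreal \<bar>w x\<bar> \<le> S + ennreal e" by (rule order_trans[rotated])
qed

text \<open>The terms at least double from one level to the next, so their sum is at most the next
  term. For \<open>j = 0\<close> the sum would be m, which is the obstruction to starting at order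
  0.\<close>

lemma sum_inverse_side_le:
  assumes "1 \<le> j"
  shows "(\<Sum>i<m. (1 / side i) ^ j) \<le> (1 / side m) ^ j"
proof (induction m)
  case (Suc m)
  have "2 * (1 / side m) ^ j \<le> 2 ^ j * (1 / side m) ^ j"
    using assms power_increasing[of 1 j "2::real"] by (intro mult_right_mono) auto
  also have "\<dots> = (1 / side (Suc m)) ^ j" by (simp add: side_Suc power_mult_distrib power_divide)
  finally show ?case using Suc by simp
qed simp

lemma suminf_inverse_side_le:
  assumes "1 \<le> j"
  shows "(\<Sum>i. if i < m then ennreal ((1 / side i) ^ j) else 0) \<le> ennreal ((1 / side m) ^ j)"
proof -
  have "(\<Sum>i. if i < m then ennreal ((1 / side i) ^ j) else 0)
    = (\<Sum>i<m. if i < m then ennreal ((1 / side i) ^ j) else 0)"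
    by (intro suminf_finite) auto
  also have "\<dots> = ennreal (\<Sum>i<m. (1 / side i) ^ j)" by (subst sum_ennreal[symmetric]) auto
  also have "\<dots> \<le> ennreal ((1 / side m) ^ j)" by (intro ennreal_leI sum_inverse_side_le assms)
  finally show ?thesis .
qed

lemma suminf_side_le: "(\<Sum>i. if m \<le> i then ennreal (side i) else 0) \<le> ennreal (2 * side m)"
  unfolding suminf_eq_SUP
proof (rule SUP_least)
  fix N
  \<comment> \<open>Subtracting the remainder \<open>2 * side N\<close> closes the induction; the
    bound is an equality once \<open>m \<le> N\<close>.\<close>
  have "(\<Sum>i<N. if m \<le> i then side i else 0) \<le> 2 * side m - (if m \<le> N then 2 * side N else 0)"
    by (induction N) (auto simp: side_Suc le_Suc_eq)
  also have "\<dots> \<le> 2 * side m" by simp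
  finally have "ennreal (\<Sum>i<N. if m \<le> i then side i else 0) \<le> ennreal (2 * side m)" by (rule ennreal_leI)
  moreover have "(\<Sum>i<N. if m \<le> i then ennreal (side i) else 0) = (\<Sum>i<N. ennreal (if m \<le> i then side i else 0))"
    by (intro sum.cong) auto
  moreover have "\<dots> = ennreal (\<Sum>i<N. if m \<le> i then side i else 0)"
    by (intro sum_ennreal) auto
  ultimately show "(\<Sum>i<N. if m \<le> i then ennreal (side i) else 0) \<le> ennreal (2 * side m)" by simp
qed

lemma cell_poincare:
  assumes w: "smooth w"
  shows "(\<integral>\<^sup>+y\<in>cell i x. (\<integral>\<^sup>+z\<in>cell i x. ennreal \<bar>w y - w z\<bar> \<partial>lborel) \<partial>lborel)
    \<le> ennreal (side i) * (2 ^ CARD('n) * (emeasure lborel (cell i x) * (\<integral>\<^sup>+y\<in>cell i x. ennreal (grad_l1 w y) \<partial>lborel)))"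
proof -
  have [measurable]: "grad_l1 w \<in> borel_measurable borel" "w \<in> borel_measurable borel"
    by (intro borel_measurable_continuous_onI continuous_on_grad_l1 smooth_continuous_on w)+
  have "ennreal \<bar>w y - w z\<bar> \<le> ennreal (side i) * (\<integral>\<^sup>+s\<in>{0..1}. ennreal (grad_l1 w (y + s *\<^sub>R (z - y))) \<partial>lborel)"
    if "y \<in> cell i x" "z \<in> cell i x" for y z
  proof -
    have "z \<in> cell i y" using that by (simp add: cell_def)
    from smooth_segment_diff_le[OF w, of 0 1, OF _ less_imp_le[OF mem_cell_dist[OF this]]]
    show ?thesis by (simp add: abs_minus_commute)
  qed
  from poincare_double_integral[OF convex_cell _ _ _ this]
  show ?thesis by simp
qed

text \<open>Truncation localises the gradient: the variation of the truncated function along a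
  segment comes from the points with values in the band. The band is half-open so that consecutive
  bands are disjoint.\<close>

lemma cell_clip_poincare:
  assumes w: "smooth w" and t: "t1 \<le> t2"
  shows "(\<integral>\<^sup>+y\<in>cell i x. (\<integral>\<^sup>+z\<in>cell i x. ennreal \<bar>clip t1 t2 \<bar>w y\<bar> - clip t1 t2 \<bar>w z\<bar>\<bar> \<partial>lborel) \<partial>lborel)
    \<le> ennreal (side i) * (2 ^ CARD('n) * (emeasure lborel (cell i x) *
        (\<integral>\<^sup>+y\<in>cell i x. ennreal (grad_l1 w y) * indicator {t1<..t2} \<bar>w y\<bar> \<partial>lborel)))"
proof -
  have [measurable]: "grad_l1 w \<in> borel_measurable borel" "w \<in> borel_measurable borel"
    by (intro borel_measurable_continuous_onI continuous_on_grad_l1 smooth_continuous_on w)+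
  let ?h = "\<lambda>y. ennreal (grad_l1 w y) * indicator {t1<..t2} \<bar>w y\<bar>"
  have "ennreal \<bar>clip t1 t2 \<bar>w y\<bar> - clip t1 t2 \<bar>w z\<bar>\<bar> \<le> ennreal (side i) * (\<integral>\<^sup>+s\<in>{0..1}. ?h (y + s *\<^sub>R (z - y)) \<partial>lborel)"
    if "y \<in> cell i x" "z \<in> cell i x" for y z
  proof -
    have z: "z \<in> cell i y" using that by (simp add: cell_def)
    let ?g = "\<lambda>s. \<bar>w (y + s *\<^sub>R (z - y))\<bar>"
    let ?G = "\<lambda>s. ennreal (side i) * ennreal (grad_l1 w (y + s *\<^sub>R (z - y)))"
    have cont: "continuous_on {0..1} ?g"
    proof (intro continuous_intros)
      show "continuous_on {0..1} (\<lambda>s. w (y + s *\<^sub>R (z - y)))"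
        by (rule continuous_on_compose2[OF smooth_continuous_on[OF w, of UNIV]])
          (auto intro!: continuous_intros)
    qed
    have diff: "ennreal \<bar>?g b - ?g a\<bar> \<le> (\<integral>\<^sup>+s\<in>{a..b}. ?G s \<partial>lborel)" if "a \<le> b" for a b
    proof -
      have "ennreal \<bar>?g b - ?g a\<bar> \<le> ennreal \<bar>w (y + b *\<^sub>R (z - y)) - w (y + a *\<^sub>R (z - y))\<bar>"
        by (intro ennreal_leI abs_triangle_ineq3)
      also have "\<dots> \<le> ennreal (side i) * (\<integral>\<^sup>+s\<in>{a..b}. ennreal (grad_l1 w (y + s *\<^sub>R (z - y))) \<partial>lborel)"
        by (rule smooth_segment_diff_le[OF w that less_imp_le[OF mem_cell_dist[OF z]]])
      also have "\<dots> = (\<integral>\<^sup>+s\<in>{a..b}. ?G s \<partial>lborel)"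
        by (simp add: nn_integral_cmult mult.assoc)
      finally show ?thesis .
    qed
    have "ennreal \<bar>clip t1 t2 (?g 1) - clip t1 t2 (?g 0)\<bar>
      \<le> (\<integral>\<^sup>+s\<in>{0..1}. ?G s * indicator {t1<..t2} (?g s) \<partial>lborel)"
      using diff by (intro clip_variation_le[OF cont _ _ t]) auto
    also have "\<dots> = ennreal (side i) * (\<integral>\<^sup>+s\<in>{0..1}. ?h (y + s *\<^sub>R (z - y)) \<partial>lborel)"
      by (simp add: nn_integral_cmult mult.assoc)
    finally show ?thesis by (simp add: abs_minus_commute)
  qed
  moreover have "(\<lambda>x. clip t1 t2 \<bar>w x\<bar>) \<in> borel_measurable borel" unfolding clip_def by measurable
  ultimately show ?thesis
    using poincare_double_integral[OF convex_cell[of i x], of ?h "\<lambda>x. clip t1 t2 \<bar>w x\<bar>" "ennreal (side i)"]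
    by simp
qed

lemma emeasure_cell_Suc: "emeasure lborel (cell i x) = 2 ^ CARD('n) * emeasure lborel (cell (Suc i) y)"
proof -
  have "ennreal (side i ^ CARD('n)) = ennreal (2 ^ CARD('n) * side (Suc i) ^ CARD('n))"
    by (simp add: side_Suc power_divide)
  also have "\<dots> = 2 ^ CARD('n) * ennreal (side (Suc i) ^ CARD('n))"
    by (simp add: ennreal_mult flip: ennreal_power)
  finally show ?thesis by (simp add: emeasure_cell)
qed

definition dens :: "nat \<Rightarrow> ennreal" where "dens i = ennreal ((1 / side i) ^ CARD('n))"

lemma dens_Suc: "dens (Suc i) = 2 ^ CARD('n) * dens i"
proof -
  have "dens (Suc i) = ennreal (2 ^ CARD('n) * (1 / side i) ^ CARD('n))"
    unfolding dens_def by (simp add: side_Suc power_divide)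
  then show ?thesis by (simp add: dens_def ennreal_mult flip: ennreal_power)
qed

lemma dens_emeasure: "dens i * emeasure lborel (cell i x) = 1"
  using side_power_mult_inverse[of i "CARD('n)"] by (simp add: dens_def emeasure_cell mult.commute)

lemma cell_avg_dens: "cell_avg i f x = dens i * (\<integral>\<^sup>+y\<in>cell i x. f y \<partial>lborel)"
  by (simp add: cell_avg_def dens_def)

text \<open>The inequality \<open>\<bar>w y\<bar> \<le> \<bar>w z\<bar> + \<bar>w y - w
  z\<bar>\<close> is averaged over y in the child cell and z in the parent, and the difference term
  is enlarged to the parent in both variables. With n the dimension, the constant
  \<open>4 ^ n\<close> is \<open>2 ^ n\<close> from the Poincare inequality times
  \<open>2 ^ n\<close> from the volume ratio.\<close>

lemma cell_avg_Suc_le: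
  assumes w: "smooth w"
  shows "cell_avg (Suc i) (\<lambda>y. ennreal \<bar>w y\<bar>) x \<le> cell_avg i (\<lambda>y. ennreal \<bar>w y\<bar>) x
    + 4 ^ CARD('n) * (ennreal (side i) * cell_avg i (\<lambda>y. ennreal (grad_l1 w y)) x)"
proof -
  have [measurable]: "w \<in> borel_measurable borel" using w by simp
  let ?T = "cell i x" and ?T' = "cell (Suc i) x"
  let ?m = "emeasure lborel ?T" and ?m' = "emeasure lborel ?T'"
  let ?A = "\<integral>\<^sup>+y\<in>?T'. ennreal \<bar>w y\<bar> \<partial>lborel" and ?B = "\<integral>\<^sup>+y\<in>?T. ennreal \<bar>w y\<bar> \<partial>lborel"
  let ?I = "\<integral>\<^sup>+y\<in>?T. ennreal (grad_l1 w y) \<partial>lborel"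
  let ?D = "\<integral>\<^sup>+y\<in>?T. (\<integral>\<^sup>+z\<in>?T. ennreal \<bar>w y - w z\<bar> \<partial>lborel) \<partial>lborel"
  have four: "2 ^ CARD('n) * (ennreal (side i) * (2 ^ CARD('n) * (1 * z)))
      = 4 ^ CARD('n) * (ennreal (side i) * z)" for z
  proof -
    have "(4::ennreal) ^ CARD('n) = 2 ^ CARD('n) * 2 ^ CARD('n)" by (simp flip: power_mult_distrib)
    then show ?thesis by (simp add: mult_ac)
  qed
  have sub: "?T' \<subseteq> ?T" by (rule cell_antimono) simp
  have "?A * ?m = (\<integral>\<^sup>+y. (\<integral>\<^sup>+z\<in>?T. ennreal \<bar>w y\<bar> * indicator ?T' y \<partial>lborel) \<partial>lborel)"
    by (simp add: nn_integral_cmult_indicator nn_integral_multc)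
  also have "\<dots> \<le> (\<integral>\<^sup>+y. (\<integral>\<^sup>+z. ennreal \<bar>w z\<bar> * indicator ?T z * indicator ?T' y
      + ennreal \<bar>w y - w z\<bar> * indicator ?T z * indicator ?T y \<partial>lborel) \<partial>lborel)"
  proof (intro nn_integral_mono)
    fix y z
    have "ennreal \<bar>w y\<bar> \<le> ennreal \<bar>w z\<bar> + ennreal \<bar>w y - w z\<bar>"
      by (simp flip: ennreal_plus)
    then show "ennreal \<bar>w y\<bar> * indicator ?T' y * indicator ?T z
      \<le> ennreal \<bar>w z\<bar> * indicator ?T z * indicator ?T' y
      + ennreal \<bar>w y - w z\<bar> * indicator ?T z * indicator ?T y"
      using sub by (auto simp: indicator_def)
  qed
  also have "\<dots> = ?B * ?m' + ?D"
    by (simp add: nn_integral_add nn_integral_multc nn_integral_cmult)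
  also have "\<dots> \<le> ?B * ?m' + ennreal (side i) * (2 ^ CARD('n) * (?m * ?I))"
    by (intro add_left_mono cell_poincare w)
  finally have le: "?A * ?m \<le> ?B * ?m' + ennreal (side i) * (2 ^ CARD('n) * (?m * ?I))" .
  have "dens (Suc i) * ?A = dens (Suc i) * ?A * (dens i * ?m)" by (simp add: dens_emeasure)
  also have "\<dots> = dens (Suc i) * dens i * (?A * ?m)" by (simp add: mult_ac)
  also have "\<dots> \<le> dens (Suc i) * dens i * (?B * ?m' + ennreal (side i) * (2 ^ CARD('n) * (?m * ?I)))"
    by (intro mult_left_mono le) simp
  also have "\<dots> = (dens (Suc i) * ?m') * (dens i * ?B)
      + 2 ^ CARD('n) * (ennreal (side i) * (2 ^ CARD('n) * ((dens i * ?m) * (dens i * ?I))))"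
    unfolding distrib_left dens_Suc by (simp add: mult_ac)
  also have "\<dots> = dens i * ?B + 4 ^ CARD('n) * (ennreal (side i) * (dens i * ?I))"
    unfolding dens_emeasure four by (simp add: mult_ac)
  finally show ?thesis by (simp only: cell_avg_dens)
qed

lemma cell_avg_telescope:
  assumes w: "smooth w"
  shows "ennreal \<bar>w x\<bar> \<le> cell_avg 0 (\<lambda>y. ennreal \<bar>w y\<bar>) x
    + 4 ^ CARD('n) * (\<Sum>i. ennreal (side i) * cell_avg i (\<lambda>y. ennreal (grad_l1 w y)) x)"
proof (rule abs_le_of_cell_avg_le[OF w])
  fix N
  let ?g = "\<lambda>i. ennreal (side i) * cell_avg i (\<lambda>y. ennreal (grad_l1 w y)) x"
  have "cell_avg N (\<lambda>y. ennreal \<bar>w y\<bar>) x \<le> cell_avg 0 (\<lambda>y. ennreal \<bar>w y\<bar>) x + 4 ^ CARD('n) * (\<Sum>i<N. ?g i)"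
  proof (induction N)
    case (Suc N)
    have "cell_avg (Suc N) (\<lambda>y. ennreal \<bar>w y\<bar>) x \<le> cell_avg N (\<lambda>y. ennreal \<bar>w y\<bar>) x + 4 ^ CARD('n) * ?g N"
      by (rule cell_avg_Suc_le[OF w])
    also have "\<dots> \<le> cell_avg 0 (\<lambda>y. ennreal \<bar>w y\<bar>) x + 4 ^ CARD('n) * (\<Sum>i<N. ?g i) + 4 ^ CARD('n) * ?g N"
      by (intro add_right_mono Suc)
    finally show ?case by (simp add: distrib_left add_ac)
  qed simp
  also have "\<dots> \<le> cell_avg 0 (\<lambda>y. ennreal \<bar>w y\<bar>) x + 4 ^ CARD('n) * (\<Sum>i. ?g i)"
    by (intro add_left_mono mult_left_mono sum_le_suminf) auto
  finally show "cell_avg N (\<lambda>y. ennreal \<bar>w y\<bar>) x \<le> cell_avg 0 (\<lambda>y. ennreal \<bar>w y\<bar>) x + 4 ^ CARD('n) * (\<Sum>i. ?g i)" .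
qed

lemma suminf_add_ennreal:
  fixes f :: "nat \<Rightarrow> ennreal"
  shows "(\<Sum>i. f i + g i) = (\<Sum>i. f i) + (\<Sum>i. g i)"
  by (rule suminf_add[symmetric]) auto

text \<open>Exchanging the sums reduces the claim to the geometric sum over the levels coarser than
  m. It bounds the cost of replacing, at each level i, all finer weights by their average, in the
  potential estimate and again for maximal averages.\<close>

lemma cost_tail_le:
  assumes "1 \<le> j" and A: "\<And>m. A m \<in> borel_measurable borel"
    and [measurable]: "S \<in> sets borel"
  shows "(\<Sum>i. ennreal ((1 / side i) ^ j) * (\<integral>\<^sup>+x\<in>S. (\<Sum>m. if i < m then A m x else 0) \<partial>lborel))
    \<le> (\<Sum>m. ennreal ((1 / side m) ^ j) * (\<integral>\<^sup>+x\<in>S. A m x \<partial>lborel))"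
proof -
  have [measurable]: "\<And>m. A m \<in> borel_measurable borel" by fact
  let ?s = "\<lambda>i. ennreal ((1 / side i) ^ j)"
  have eq: "(\<integral>\<^sup>+x\<in>S. (\<Sum>m. if i < m then A m x else 0) \<partial>lborel)
      = (\<Sum>m. if i < m then \<integral>\<^sup>+x\<in>S. A m x \<partial>lborel else 0)" for i
  proof -
    have "(\<integral>\<^sup>+x\<in>S. (\<Sum>m. if i < m then A m x else 0) \<partial>lborel)
      = (\<Sum>m. \<integral>\<^sup>+x\<in>S. (if i < m then A m x else 0) \<partial>lborel)"
      unfolding ennreal_suminf_multc[symmetric] by (intro nn_integral_suminf) measurable
    also have "\<dots> = (\<Sum>m. if i < m then \<integral>\<^sup>+x\<in>S. A m x \<partial>lborel else 0)"
      by (intro suminf_cong) simp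
    finally show ?thesis .
  qed
  have "(\<Sum>i. ?s i * (\<integral>\<^sup>+x\<in>S. (\<Sum>m. if i < m then A m x else 0) \<partial>lborel))
    = (\<Sum>i. \<Sum>m. (if i < m then ?s i else 0) * (\<integral>\<^sup>+x\<in>S. A m x \<partial>lborel))"
    unfolding eq ennreal_suminf_cmult[symmetric] by (intro suminf_cong) simp
  also have "\<dots> = (\<Sum>m. \<Sum>i. (if i < m then ?s i else 0) * (\<integral>\<^sup>+x\<in>S. A m x \<partial>lborel))"
    by (rule suminf_ennreal_swap)
  also have "\<dots> \<le> (\<Sum>m. ?s m * (\<integral>\<^sup>+x\<in>S. A m x \<partial>lborel))"
    unfolding ennreal_suminf_multc
    by (intro suminf_le mult_right_mono suminf_inverse_side_le assms) auto
  finally show ?thesis .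
qed

text \<open>The dyadic potential \<open>SUM i. side i * cell_avg i\<close> maps weights of finite cost of order \<open>j\<close> to
  weights of finite cost of order \<open>Suc j\<close>.\<close>

lemma dominated_Suc:
  assumes w: "smooth w" and j: "1 \<le> j" and dom: "dominated j (grad_l1 w) A"
  shows "dominated (Suc j) w
    (ennreal ((1 / L) ^ Suc j) * (\<integral>\<^sup>+x\<in>top_cell. ennreal \<bar>w x\<bar> \<partial>lborel) + 4 ^ CARD('n) * (3 * A))"
proof -
  have [measurable]: "w \<in> borel_measurable borel" using w by simp
  obtain a where a: "adapted a" and le: "\<And>x. x \<in> top_cell \<Longrightarrow> ennreal \<bar>grad_l1 w x\<bar> \<le> (\<Sum>i. a i x)"
    and cA: "cost j a \<le> A"
    using dom unfolding dominated_def by blast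
  have [measurable]: "\<And>i. a i \<in> borel_measurable borel" using a by (rule adapted_measurable)
  let ?E = "\<lambda>i. cell_avg i (\<lambda>y. \<Sum>m. if i < m then a m y else 0)"
  let ?W = "\<lambda>i. if i = 0 then cell_avg 0 (\<lambda>y. ennreal \<bar>w y\<bar>) else (\<lambda>_. 0)"
  let ?N = "4 ^ CARD('n) :: ennreal"
  \<comment> \<open>At level i the finer weights enter through their cell average, while the coarser
    ones are constant on the cell. In the potential a weight of level m is multiplied by the sum of
    \<open>side i\<close> over \<open>i \<ge> m\<close>, which is at most \<open>2 * side m\<close>;
    this is the summand \<open>2 * a i x\<close>. Level 0 also carries the mean of
    \<open>\<bar>w\<bar>\<close> that starts the telescope.\<close>
  define b where "b i x = ?W i x + ?N * (ennreal (side i) * (?E i x + 2 * a i x))" for i x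
  have ad: "adapted b"
  proof (rule adaptedI)
    fix i x y assume "idx i x = idx i y"
    then have 1: "a i x = a i y" and 2: "cell_avg i f x = cell_avg i f y" for f
      by (rule adaptedD[OF a]) (rule cell_avg_adapted, fact)
    show "b i x = b i y" unfolding b_def using 1 2 by (cases "i = 0") simp_all
  qed
  have bound: "ennreal \<bar>w x\<bar> \<le> (\<Sum>i. b i x)" if x: "x \<in> top_cell" for x
  proof -
    have E: "cell_avg i (\<lambda>y. ennreal (grad_l1 w y)) x \<le> ?E i x + (\<Sum>m. if m \<le> i then a m x else 0)" for i
    proof -
      have "cell_avg i (\<lambda>y. ennreal (grad_l1 w y)) x
        \<le> cell_avg i (\<lambda>y. (\<Sum>m. if i < m then a m y else 0) + (\<Sum>m. if m \<le> i then a m y else 0)) x"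
      proof (rule cell_avg_mono)
        fix y assume "y \<in> cell i x"
        then have "y \<in> top_cell" using cell_subset_top_cell[OF x] by blast
        from le[OF this] have "ennreal (grad_l1 w y) \<le> (\<Sum>m. a m y)" by simp
        also have "\<dots> = (\<Sum>m. (if i < m then a m y else 0) + (if m \<le> i then a m y else 0))"
          by (intro suminf_cong) auto
        finally show "ennreal (grad_l1 w y)
            \<le> (\<Sum>m. if i < m then a m y else 0) + (\<Sum>m. if m \<le> i then a m y else 0)"
          by (simp add: suminf_add_ennreal)
      qed
      also have "\<dots> = ?E i x + cell_avg i (\<lambda>y. \<Sum>m. if m \<le> i then a m y else 0) x"
        by (intro cell_avg_add) measurable
      also have "cell_avg i (\<lambda>y. \<Sum>m. if m \<le> i then a m y else 0) x = (\<Sum>m. if m \<le> i then a m x else 0)"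
      proof (rule cell_avg_const)
        fix y assume y: "y \<in> cell i x"
        show "(\<Sum>m. if m \<le> i then a m y else 0) = (\<Sum>m. if m \<le> i then a m x else 0)"
          using adaptedD[OF a idx_refine[OF _ mem_cellD[OF y]]] by (intro suminf_cong) auto
      qed
      finally show ?thesis .
    qed
    have side: "(\<Sum>i. ennreal (side i) * (\<Sum>m. if m \<le> i then a m x else 0))
      \<le> (\<Sum>i. ennreal (side i) * (2 * a i x))"
    proof -
      have "(\<Sum>i. ennreal (side i) * (\<Sum>m. if m \<le> i then a m x else 0))
        = (\<Sum>i. \<Sum>m. (if m \<le> i then ennreal (side i) else 0) * a m x)"
        unfolding ennreal_suminf_cmult[symmetric] by (intro suminf_cong) auto
      also have "\<dots> = (\<Sum>m. (\<Sum>i. if m \<le> i then ennreal (side i) else 0) * a m x)"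
        unfolding ennreal_suminf_multc[symmetric] by (rule suminf_ennreal_swap)
      also have "\<dots> \<le> (\<Sum>m. ennreal (2 * side m) * a m x)"
        by (intro suminf_le mult_right_mono suminf_side_le) auto
      also have "\<dots> = (\<Sum>i. ennreal (side i) * (2 * a i x))"
        by (intro suminf_cong) (simp add: ennreal_mult mult_ac)
      finally show ?thesis .
    qed
    have "ennreal \<bar>w x\<bar> \<le> cell_avg 0 (\<lambda>y. ennreal \<bar>w y\<bar>) x
      + ?N * (\<Sum>i. ennreal (side i) * cell_avg i (\<lambda>y. ennreal (grad_l1 w y)) x)"
      by (rule cell_avg_telescope[OF w])
    also have "(\<Sum>i. ennreal (side i) * cell_avg i (\<lambda>y. ennreal (grad_l1 w y)) x)
      \<le> (\<Sum>i. ennreal (side i) * (?E i x + (\<Sum>m. if m \<le> i then a m x else 0)))"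
      by (intro suminf_le mult_left_mono E) auto
    also have "\<dots> = (\<Sum>i. ennreal (side i) * ?E i x) + (\<Sum>i. ennreal (side i) * (\<Sum>m. if m \<le> i then a m x else 0))"
      unfolding distrib_left by (rule suminf_add_ennreal)
    also have "\<dots> \<le> (\<Sum>i. ennreal (side i) * ?E i x) + (\<Sum>i. ennreal (side i) * (2 * a i x))"
      by (intro add_left_mono side)
    also have "\<dots> = (\<Sum>i. ennreal (side i) * (?E i x + 2 * a i x))"
      unfolding distrib_left by (rule suminf_add_ennreal[symmetric])
    also have "cell_avg 0 (\<lambda>y. ennreal \<bar>w y\<bar>) x = (\<Sum>i. ?W i x)"
      by (subst suminf_finite[of "{0}"]) auto
    also have "(\<Sum>i. ?W i x) + ?N * (\<Sum>i. ennreal (side i) * (?E i x + 2 * a i x)) = (\<Sum>i. b i x)"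
      unfolding b_def ennreal_suminf_cmult[symmetric] by (rule suminf_add_ennreal[symmetric])
    finally show ?thesis by (simp add: add_left_mono mult_left_mono)
  qed
  have cb: "cost (Suc j) b \<le>
    ennreal ((1 / L) ^ Suc j) * (\<integral>\<^sup>+x\<in>top_cell. ennreal \<bar>w x\<bar> \<partial>lborel) + ?N * (3 * A)"
  proof -
    let ?s = "\<lambda>i j. ennreal ((1 / side i) ^ j)"
    let ?I = "\<lambda>i. \<integral>\<^sup>+x\<in>top_cell. (\<Sum>m. if i < m then a m x else 0) \<partial>lborel"
    have int: "(\<integral>\<^sup>+x\<in>top_cell. b i x \<partial>lborel) = (\<integral>\<^sup>+x\<in>top_cell. ?W i x \<partial>lborel)
        + ?N * (ennreal (side i) * (?I i + 2 * (\<integral>\<^sup>+x\<in>top_cell. a i x \<partial>lborel)))" for i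
    proof -
      have "(\<integral>\<^sup>+x\<in>top_cell. b i x \<partial>lborel) = (\<integral>\<^sup>+x. ?W i x * indicator top_cell x
          + ?N * (ennreal (side i) * (?E i x * indicator top_cell x + 2 * (a i x * indicator top_cell x))) \<partial>lborel)"
        unfolding b_def by (intro nn_integral_cong) (simp add: algebra_simps)
      also have "\<dots> = (\<integral>\<^sup>+x\<in>top_cell. ?W i x \<partial>lborel) + ?N * (ennreal (side i) *
          ((\<integral>\<^sup>+x\<in>top_cell. ?E i x \<partial>lborel) + 2 * (\<integral>\<^sup>+x\<in>top_cell. a i x \<partial>lborel)))"
        by (cases "i = 0") (simp_all add: nn_integral_add nn_integral_cmult)
      also have "(\<integral>\<^sup>+x\<in>top_cell. ?E i x \<partial>lborel) = ?I i"
        by (intro nn_integral_cell_avg saturated_top_cell) measurable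
      finally show ?thesis .
    qed
    have ss: "?s i (Suc j) * ennreal (side i) = ?s i j" for i
      by (simp flip: ennreal_mult)
    have arith: "s1 * (W + N * (d * (I + 2 * q))) = s1 * W + N * (s0 * I + 2 * (s0 * q))"
      if "s1 * d = s0" for s1 s0 W N d I q :: ennreal
    proof -
      have "s1 * (W + N * (d * (I + 2 * q))) = s1 * W + N * ((s1 * d) * (I + 2 * q))"
        by (simp only: distrib_left mult_ac)
      then show ?thesis unfolding that by (simp only: distrib_left mult_ac)
    qed
    have "cost (Suc j) b = (\<Sum>i. ?s i (Suc j) * (\<integral>\<^sup>+x\<in>top_cell. ?W i x \<partial>lborel)
        + ?N * (?s i j * ?I i + 2 * (?s i j * (\<integral>\<^sup>+x\<in>top_cell. a i x \<partial>lborel))))"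
      unfolding cost_def int
    proof (rule suminf_cong)
      fix i
      show "?s i (Suc j) * ((\<integral>\<^sup>+x\<in>top_cell. ?W i x \<partial>lborel)
          + ?N * (ennreal (side i) * (?I i + 2 * (\<integral>\<^sup>+x\<in>top_cell. a i x \<partial>lborel))))
        = ?s i (Suc j) * (\<integral>\<^sup>+x\<in>top_cell. ?W i x \<partial>lborel)
        + ?N * (?s i j * ?I i + 2 * (?s i j * (\<integral>\<^sup>+x\<in>top_cell. a i x \<partial>lborel)))"
        by (rule arith) (rule ss)
    qed
    also have "\<dots> = (\<Sum>i. ?s i (Suc j) * (\<integral>\<^sup>+x\<in>top_cell. ?W i x \<partial>lborel))
        + ?N * ((\<Sum>i. ?s i j * ?I i) + 2 * cost j a)"
      unfolding cost_def by (simp only: suminf_add_ennreal ennreal_suminf_cmult)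
    also have "(\<Sum>i. ?s i (Suc j) * (\<integral>\<^sup>+x\<in>top_cell. ?W i x \<partial>lborel))
        = ?s 0 (Suc j) * (\<integral>\<^sup>+x\<in>top_cell. ?W 0 x \<partial>lborel)"
      by (subst suminf_finite[of "{0}"]) auto
    also have "(\<integral>\<^sup>+x\<in>top_cell. ?W 0 x \<partial>lborel) = (\<integral>\<^sup>+x\<in>top_cell. ennreal \<bar>w x\<bar> \<partial>lborel)"
      unfolding if_P[OF refl] by (intro nn_integral_cell_avg saturated_top_cell) measurable
    also have "(\<Sum>i. ?s i j * ?I i) \<le> cost j a"
      unfolding cost_def by (intro cost_tail_le j) measurable
    also have "cost j a + 2 * cost j a = 3 * cost j a"
      using distrib_right[of 1 2 "cost j a"] by simp
    also have "\<dots> \<le> 3 * A" by (intro mult_left_mono cA) simp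
    finally show ?thesis by (simp add: side_0 add_left_mono mult_left_mono)
  qed
  show ?thesis unfolding dominated_def using ad bound cb by blast
qed

text \<open>A boxing inequality without the coarea formula. The weights are the increments of the running
  maximum \<open>M\<close> of quantiles \<open>q\<close> of \<open>\<bar>w\<bar>\<close> along the chain of cells. The level \<open>1 / 2 ^ (n + 1)\<close> of the
  quantiles is chosen so that on half of every cell \<open>\<bar>w\<bar>\<close> is at most the quantile of the parent cell;
  hence the truncation of \<open>\<bar>w\<bar>\<close> between consecutive values of \<open>M\<close> is constant on two fixed portions
  of the cell, and its Poincare inequality bounds the increment. The truncation intervals along a
  chain are disjoint, so the gradient is counted only once.\<close>

lemma dominated_1:
  assumes w: "smooth w"
  shows "dominated 1 w (ennreal (1 / L) * (2 ^ Suc CARD('n) * (\<integral>\<^sup>+x\<in>top_cell. ennreal \<bar>w x\<bar> \<partial>lborel))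
      + 4 ^ Suc CARD('n) * (\<integral>\<^sup>+x\<in>top_cell. ennreal (grad_l1 w x) \<partial>lborel))"
proof -
  have [measurable]: "w \<in> borel_measurable borel" "grad_l1 w \<in> borel_measurable borel"
    by (intro borel_measurable_continuous_onI continuous_on_grad_l1 smooth_continuous_on w)+
  let ?n = "CARD('n)"
  define hf :: ennreal where "hf = ennreal (1 / 2)"
  have "hf + hf = ennreal (1 / 2 + 1 / 2)" unfolding hf_def by (subst ennreal_plus) auto
  then have hf: "hf + hf = 1" "2 * hf = 1" by (simp_all flip: mult_2)
  define \<theta> :: ennreal where "\<theta> = ennreal (1 / 2 ^ Suc ?n)"
  have \<theta>2: "2 ^ Suc ?n * \<theta> = 1" "2 ^ ?n * \<theta> = hf"
  proof -
    have t: "(2::ennreal) ^ m = ennreal (2 ^ m)" for m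
      by (subst ennreal_numeral[symmetric], subst ennreal_power) auto
    show "2 ^ Suc ?n * \<theta> = 1" "2 ^ ?n * \<theta> = hf"
      unfolding \<theta>_def hf_def t by (subst ennreal_mult[symmetric]; simp)+
  qed
  have "1 / 2 ^ Suc ?n \<le> (1::real)"
    using one_le_power[of "2::real" "Suc ?n"] by (simp add: divide_le_eq del: power_Suc)
  then have "\<theta> \<le> 1" unfolding \<theta>_def by (metis ennreal_leI ennreal_1)
  from mult_right_mono[OF this] have \<theta>1: "\<theta> * z \<le> z" for z by simp
  let ?P = "\<lambda>T q. 0 \<le> q \<and> emeasure lborel {y \<in> T. q < \<bar>w y\<bar>} \<le> \<theta> * emeasure lborel T \<and>
      \<theta> * emeasure lborel T \<le> emeasure lborel {y \<in> T. q \<le> \<bar>w y\<bar>}"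
  have "\<exists>q. ?P (cell i x) q" for i x
  proof -
    have "bounded (w ` closure (cell i x))"
      by (intro compact_imp_bounded compact_continuous_image smooth_continuous_on w)
        (simp add: bounded_cell compact_closure)
    then obtain K where "\<And>y. y \<in> closure (cell i x) \<Longrightarrow> \<bar>w y\<bar> \<le> K"
      unfolding bounded_iff by auto
    then have K: "\<And>y. y \<in> cell i x \<Longrightarrow> \<bar>w y\<bar> \<le> K" using closure_subset by blast
    show ?thesis
      using exists_quantile[of "cell i x" "\<lambda>y. \<bar>w y\<bar>" "\<theta> * emeasure lborel (cell i x)" K] K \<theta>1
      by (auto simp: emeasure_cell)
  qed
  then have ex: "?P (cell i x) (SOME q. ?P (cell i x) q)" for i x by (rule someI_ex)
  define q where "q i x = (SOME q. ?P (cell i x) q)" for i x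
  have q0: "0 \<le> q i x" and q1: "emeasure lborel {y \<in> cell i x. q i x < \<bar>w y\<bar>} \<le> \<theta> * emeasure lborel (cell i x)"
    and q2: "\<theta> * emeasure lborel (cell i x) \<le> emeasure lborel {y \<in> cell i x. q i x \<le> \<bar>w y\<bar>}" for i x
    using ex[of i x] unfolding q_def by blast+
  have qc: "q i x = q i y" if "idx i x = idx i y" for i x y
    unfolding q_def cell_cong[OF that] ..
  define M where "M i x = Max ((\<lambda>m. q m x) ` {..i})" for i x
  have M0: "M 0 x = q 0 x" for x by (simp add: M_def)
  have MS: "M (Suc i) x = max (M i x) (q (Suc i) x)" for i x
    unfolding M_def atMost_Suc image_insert by (subst Max_insert) (auto simp: max.commute)
  have qM: "q i x \<le> M i x" for i x unfolding M_def by (intro Max_ge) auto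
  have Mc: "M i x = M i y" if "idx i x = idx i y" for i x y
    unfolding M_def using qc[OF idx_refine[OF _ that]] by (auto intro!: arg_cong[where f=Max] image_cong)
  have Mm [measurable]: "M i \<in> borel_measurable borel" for i by (rule level_measurable[OF Mc])
  define a where "a i x = (case i of 0 \<Rightarrow> ennreal (q 0 x) | Suc m \<Rightarrow> ennreal (M (Suc m) x - M m x))" for i x
  have ad: "adapted a"
  proof (rule adaptedI)
    fix i x y assume e: "idx i x = idx i y"
    show "a i x = a i y"
    proof (cases i)
      case 0
      then show ?thesis using qc[OF e] by (simp add: a_def)
    next
      case (Suc m)
      then show ?thesis using Mc[OF e] Mc[OF idx_refine[OF _ e, of m]] by (simp add: a_def)
    qed
  qed
  have partial: "(\<Sum>m<Suc i. a m x) = ennreal (M i x)" for i x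
  proof (induction i)
    case (Suc i)
    have "(\<Sum>m<Suc (Suc i). a m x) = ennreal (M i x) + ennreal (M (Suc i) x - M i x)"
      using Suc by (simp add: a_def)
    also have "\<dots> = ennreal (M (Suc i) x)"
      using order_trans[OF q0 qM, of i x] by (subst ennreal_plus[symmetric]) (auto simp: MS)
    finally show ?case .
  qed (simp add: a_def M0)
  have bound: "ennreal \<bar>w x\<bar> \<le> (\<Sum>i. a i x)" for x
  proof (rule ennreal_le_epsilon)
    fix e :: real assume e: "0 < e"
    obtain i where i: "\<And>y. y \<in> cell i x \<Longrightarrow> \<bar>w x\<bar> - e \<le> \<bar>w y\<bar>"
      using exists_cell_lower_bound[OF w e] by blast
    \<comment> \<open>The set above the quantile fills only the fraction \<open>\<theta> < 1\<close>
      of the cell, so some point of the cell lies at or below the quantile; by the choice of i the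
      quantile is then at least \<open>\<bar>w x\<bar> - e\<close>.\<close>
    have "\<exists>y\<in>cell i x. \<bar>w y\<bar> \<le> q i x"
    proof (rule ccontr)
      assume "\<not> ?thesis"
      then have "{y \<in> cell i x. q i x < \<bar>w y\<bar>} = cell i x" by force
      with q1[of i x] have "ennreal (side i ^ ?n) \<le> \<theta> * ennreal (side i ^ ?n)" by (simp add: emeasure_cell)
      also have "\<dots> = ennreal (1 / 2 ^ Suc ?n * side i ^ ?n)" unfolding \<theta>_def by (subst ennreal_mult) auto
      finally have "side i ^ ?n \<le> 1 / 2 ^ Suc ?n * side i ^ ?n"
        by (subst (asm) ennreal_le_iff) auto
      moreover have "1 / 2 ^ Suc ?n * side i ^ ?n < 1 * side i ^ ?n"
        by (intro mult_strict_right_mono) (auto simp: divide_less_eq simp del: power_Suc)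
      ultimately show False by simp
    qed
    then have "\<bar>w x\<bar> \<le> M i x + e" using i qM[of i x] by force
    then have "ennreal \<bar>w x\<bar> \<le> ennreal (M i x + e)" by (rule ennreal_leI)
    also have "\<dots> = (\<Sum>m<Suc i. a m x) + ennreal e"
      unfolding partial using order_trans[OF q0 qM, of i x] e by (intro ennreal_plus) auto
    also have "\<dots> \<le> (\<Sum>m. a m x) + ennreal e" by (intro add_right_mono sum_le_suminf) auto
    finally show "ennreal \<bar>w x\<bar> \<le> (\<Sum>m. a m x) + ennreal e" .
  qed
  define h where "h i y = ennreal (grad_l1 w y) * indicator {M i y<..M (Suc i) y} \<bar>w y\<bar>" for i y
  have hm [measurable]: "h i \<in> borel_measurable borel" for i
  proof -
    have "h i = (\<lambda>y. ennreal (grad_l1 w y) * (if M i y < \<bar>w y\<bar> \<and> \<bar>w y\<bar> \<le> M (Suc i) y then 1 else 0))"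
      by (auto simp: h_def fun_eq_iff indicator_def)
    also have "\<dots> \<in> borel_measurable borel" by measurable
    finally show ?thesis .
  qed
  have key: "a (Suc i) x \<le> 4 ^ Suc ?n * (ennreal (side (Suc i)) * cell_avg (Suc i) (h i) x)" for i x
  proof (cases "M i x < M (Suc i) x")
    case False
    then show ?thesis by (simp add: a_def ennreal_neg)
  next
    case True
    let ?T = "cell (Suc i) x" and ?t1 = "M i x" and ?t2 = "M (Suc i) x"
    let ?m = "emeasure lborel ?T"
    let ?I = "\<integral>\<^sup>+y\<in>?T. h i y \<partial>lborel"
    \<comment> \<open>Where the running maximum increases, its new value is the quantile of the
      child cell itself, so \<open>q2\<close> bounds the measure of \<open>S1\<close> from
      below.\<close>
    have t2: "?t2 = q (Suc i) x" using True by (simp add: MS max_def split: if_splits)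
    define S0 where "S0 = {y \<in> ?T. \<bar>w y\<bar> \<le> ?t1}"
    define S1 where "S1 = {y \<in> ?T. ?t2 \<le> \<bar>w y\<bar>}"
    have [measurable]: "S0 \<in> sets borel" "S1 \<in> sets borel" unfolding S0_def S1_def by measurable
    have m1: "\<theta> * ?m \<le> emeasure lborel S1" using q2[of "Suc i" x] by (simp add: S1_def t2)
    have half: "hf * ?m + hf * ?m = ?m"
      by (simp add: hf flip: distrib_right)
    have fin: "hf * ?m < top" 
    proof -
      have "hf < top" unfolding hf_def by (rule ennreal_less_top)
      then show ?thesis by (simp add: emeasure_cell ennreal_mult_less_top)
    qed
    have "emeasure lborel {y \<in> ?T. ?t1 < \<bar>w y\<bar>} \<le> emeasure lborel {y \<in> cell i x. q i x < \<bar>w y\<bar>}"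
      using cell_antimono[of i "Suc i" x] qM[of i x] by (intro emeasure_mono) auto
    also have "\<dots> \<le> \<theta> * emeasure lborel (cell i x)" by (rule q1)
    also have "\<dots> = hf * ?m"
      unfolding emeasure_cell_Suc[of i x x] \<theta>2(2)[symmetric] by (simp add: mult_ac)
    finally have up: "emeasure lborel {y \<in> ?T. ?t1 < \<bar>w y\<bar>} \<le> hf * ?m" .
    have "?m = emeasure lborel S0 + emeasure lborel {y \<in> ?T. ?t1 < \<bar>w y\<bar>}"
      by (subst plus_emeasure) (auto simp: S0_def intro!: arg_cong[where f="emeasure lborel"])
    also have "\<dots> \<le> emeasure lborel S0 + hf * ?m" by (intro add_left_mono up)
    finally have "hf * ?m + hf * ?m \<le> emeasure lborel S0 + hf * ?m"
      unfolding half .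
    then have m0: "hf * ?m \<le> emeasure lborel S0"
      unfolding add.commute[of "emeasure lborel S0"] ennreal_add_left_cancel_le
      using fin by (auto simp del: ennreal_mult_less_top)
    let ?D = "\<integral>\<^sup>+y\<in>?T. (\<integral>\<^sup>+z\<in>?T. ennreal \<bar>clip ?t1 ?t2 \<bar>w y\<bar> - clip ?t1 ?t2 \<bar>w z\<bar>\<bar> \<partial>lborel) \<partial>lborel"
    \<comment> \<open>For y in \<open>S1\<close> and z in \<open>S0\<close> the truncation takes its
      two extreme values, which differ by exactly \<open>a (Suc i) x\<close>.\<close>
    have "a (Suc i) x * ((hf * ?m) * (\<theta> * ?m)) \<le> a (Suc i) x * (emeasure lborel S0 * emeasure lborel S1)"
      by (intro mult_left_mono mult_mono m0 m1) auto
    also have "\<dots> = (\<integral>\<^sup>+y. (\<integral>\<^sup>+z. a (Suc i) x * indicator S1 y * indicator S0 z \<partial>lborel) \<partial>lborel)"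
      by (simp add: nn_integral_cmult_indicator nn_integral_multc mult_ac)
    also have "\<dots> \<le> (\<integral>\<^sup>+y. (\<integral>\<^sup>+z. ennreal \<bar>clip ?t1 ?t2 \<bar>w y\<bar> - clip ?t1 ?t2 \<bar>w z\<bar>\<bar>
        * indicator ?T z * indicator ?T y \<partial>lborel) \<partial>lborel)"
    proof (intro nn_integral_mono)
      fix y z
      show "a (Suc i) x * indicator S1 y * indicator S0 z
        \<le> ennreal \<bar>clip ?t1 ?t2 \<bar>w y\<bar> - clip ?t1 ?t2 \<bar>w z\<bar>\<bar> * indicator ?T z * indicator ?T y"
        using True by (auto simp: indicator_def S0_def S1_def clip_def a_def)
    qed
    also have "\<dots> = ?D"
    proof -
      have "(\<lambda>z. ennreal \<bar>clip ?t1 ?t2 \<bar>w y\<bar> - clip ?t1 ?t2 \<bar>w z\<bar>\<bar>) \<in> borel_measurable borel" for y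
        unfolding clip_def by measurable
      then show ?thesis
        by (intro nn_integral_cong nn_integral_multc borel_measurable_times_ennreal
            borel_measurable_indicator) simp_all
    qed
    also have "\<dots> \<le> ennreal (side (Suc i)) * (2 ^ ?n * (?m *
        (\<integral>\<^sup>+y\<in>?T. ennreal (grad_l1 w y) * indicator {?t1<..?t2} \<bar>w y\<bar> \<partial>lborel)))"
      using True by (intro cell_clip_poincare w) simp
    also have "(\<integral>\<^sup>+y\<in>?T. ennreal (grad_l1 w y) * indicator {?t1<..?t2} \<bar>w y\<bar> \<partial>lborel) = ?I"
    proof (intro nn_integral_cong)
      fix y
      show "ennreal (grad_l1 w y) * indicator {?t1<..?t2} \<bar>w y\<bar> * indicator ?T y = h i y * indicator ?T y"
      proof (cases "y \<in> ?T")
        case True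
        then have "idx (Suc i) y = idx (Suc i) x" by (rule mem_cellD)
        from Mc[OF this] Mc[OF idx_refine[OF _ this, of i]] show ?thesis by (simp add: h_def)
      qed simp
    qed
    finally have "a (Suc i) x * ((hf * ?m) * (\<theta> * ?m)) \<le> ennreal (side (Suc i)) * (2 ^ ?n * (?m * ?I))" .
    \<comment> \<open>On the left this factor cancels \<open>hf\<close>, \<open>\<theta>\<close> and
      both cell volumes; on the right it leaves a cell average with the constant
      \<open>2 * 2 ^ (n + 1) * 2 ^ n = 4 ^ (n + 1)\<close>, where n is the dimension.\<close>
    then have "(2 * 2 ^ Suc ?n * dens (Suc i) * dens (Suc i)) * (a (Suc i) x * ((hf * ?m) * (\<theta> * ?m)))
      \<le> (2 * 2 ^ Suc ?n * dens (Suc i) * dens (Suc i)) * (ennreal (side (Suc i)) * (2 ^ ?n * (?m * ?I)))"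
      by (rule mult_left_mono) simp
    moreover have "(2 * 2 ^ Suc ?n * dens (Suc i) * dens (Suc i)) * (a (Suc i) x * ((hf * ?m) * (\<theta> * ?m)))
      = a (Suc i) x * ((2 * hf) * (2 ^ Suc ?n * \<theta>) * (dens (Suc i) * ?m) * (dens (Suc i) * ?m))"
      by (simp only: mult_ac)
    moreover have "(2 * 2 ^ Suc ?n * dens (Suc i) * dens (Suc i)) * (ennreal (side (Suc i)) * (2 ^ ?n * (?m * ?I)))
      = (2 * 2 ^ Suc ?n * 2 ^ ?n) * (ennreal (side (Suc i)) * ((dens (Suc i) * ?m) * (dens (Suc i) * ?I)))"
      by (simp only: mult_ac)
    moreover have "(2 * 2 ^ Suc ?n * 2 ^ ?n :: ennreal) = 4 ^ Suc ?n"
      by (simp add: mult_ac power_mult_distrib[symmetric])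
    ultimately show ?thesis unfolding \<theta>2 dens_emeasure hf by (simp add: cell_avg_dens)
  qed
  \<comment> \<open>Markov's inequality: at least the fraction \<open>\<theta>\<close> of the cell
    satisfies \<open>q 0 x \<le> \<bar>w y\<bar>\<close>, so the quantile is at most
    \<open>1 / \<theta>\<close> times the mean of \<open>\<bar>w\<bar>\<close>.\<close>
  have first: "(\<integral>\<^sup>+x\<in>top_cell. a 0 x \<partial>lborel) \<le> 2 ^ Suc ?n * (\<integral>\<^sup>+x\<in>top_cell. ennreal \<bar>w x\<bar> \<partial>lborel)"
  proof -
    have "a 0 x \<le> 2 ^ Suc ?n * cell_avg 0 (\<lambda>y. ennreal \<bar>w y\<bar>) x" for x
    proof -
      let ?T = "cell 0 x"
      let ?m = "emeasure lborel ?T"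
      have "a 0 x * (\<theta> * ?m) \<le> a 0 x * emeasure lborel {y \<in> ?T. q 0 x \<le> \<bar>w y\<bar>}"
        by (intro mult_left_mono q2) simp
      also have "\<dots> = (\<integral>\<^sup>+y. a 0 x * indicator {y \<in> ?T. q 0 x \<le> \<bar>w y\<bar>} y \<partial>lborel)"
        by (subst nn_integral_cmult_indicator) auto
      also have "\<dots> \<le> (\<integral>\<^sup>+y\<in>?T. ennreal \<bar>w y\<bar> \<partial>lborel)"
        by (intro nn_integral_mono) (auto simp: indicator_def a_def intro!: ennreal_leI)
      finally have "(2 ^ Suc ?n * dens 0) * (a 0 x * (\<theta> * ?m)) \<le> (2 ^ Suc ?n * dens 0) * (\<integral>\<^sup>+y\<in>?T. ennreal \<bar>w y\<bar> \<partial>lborel)"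
        by (rule mult_left_mono) simp
      moreover have "(2 ^ Suc ?n * dens 0) * (a 0 x * (\<theta> * ?m)) = a 0 x * ((2 ^ Suc ?n * \<theta>) * (dens 0 * ?m))"
        by (simp only: mult_ac)
      ultimately show ?thesis unfolding \<theta>2 dens_emeasure by (simp add: cell_avg_dens mult.assoc)
    qed
    then have "(\<integral>\<^sup>+x\<in>top_cell. a 0 x \<partial>lborel)
      \<le> (\<integral>\<^sup>+x\<in>top_cell. 2 ^ Suc ?n * cell_avg 0 (\<lambda>y. ennreal \<bar>w y\<bar>) x \<partial>lborel)"
      by (intro nn_integral_mono mult_right_mono) auto
    also have "\<dots> = 2 ^ Suc ?n * (\<integral>\<^sup>+x\<in>top_cell. cell_avg 0 (\<lambda>y. ennreal \<bar>w y\<bar>) x \<partial>lborel)"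
      unfolding mult.assoc[of "2 ^ Suc ?n"] by (intro nn_integral_cmult) measurable
    also have "(\<integral>\<^sup>+x\<in>top_cell. cell_avg 0 (\<lambda>y. ennreal \<bar>w y\<bar>) x \<partial>lborel) = (\<integral>\<^sup>+x\<in>top_cell. ennreal \<bar>w x\<bar> \<partial>lborel)"
      by (intro nn_integral_cell_avg saturated_top_cell) measurable
    finally show ?thesis .
  qed
  have later: "ennreal (1 / side (Suc i)) * (\<integral>\<^sup>+x\<in>top_cell. a (Suc i) x \<partial>lborel)
      \<le> 4 ^ Suc ?n * (\<integral>\<^sup>+x\<in>top_cell. h i x \<partial>lborel)" for i
  proof -
    have "(\<integral>\<^sup>+x\<in>top_cell. a (Suc i) x \<partial>lborel)
      \<le> (\<integral>\<^sup>+x. 4 ^ Suc ?n * (ennreal (side (Suc i)) * (cell_avg (Suc i) (h i) x * indicator top_cell x)) \<partial>lborel)"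
      using key by (intro nn_integral_mono) (auto simp: indicator_def)
    also have "\<dots> = 4 ^ Suc ?n * (ennreal (side (Suc i)) * (\<integral>\<^sup>+x\<in>top_cell. cell_avg (Suc i) (h i) x \<partial>lborel))"
      by (subst nn_integral_cmult; (subst nn_integral_cmult)?; simp)
    also have "(\<integral>\<^sup>+x\<in>top_cell. cell_avg (Suc i) (h i) x \<partial>lborel) = (\<integral>\<^sup>+x\<in>top_cell. h i x \<partial>lborel)"
      by (intro nn_integral_cell_avg saturated_top_cell hm)
    finally have "ennreal (1 / side (Suc i)) * (\<integral>\<^sup>+x\<in>top_cell. a (Suc i) x \<partial>lborel)
      \<le> ennreal (1 / side (Suc i)) * (4 ^ Suc ?n * (ennreal (side (Suc i)) * (\<integral>\<^sup>+x\<in>top_cell. h i x \<partial>lborel)))"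
      by (rule mult_left_mono) simp
    also have "\<dots> = 4 ^ Suc ?n * ((ennreal (1 / side (Suc i)) * ennreal (side (Suc i))) * (\<integral>\<^sup>+x\<in>top_cell. h i x \<partial>lborel))"
      by (simp only: mult_ac)
    also have "ennreal (1 / side (Suc i)) * ennreal (side (Suc i)) = 1"
      by (simp flip: ennreal_mult)
    finally show ?thesis by simp
  qed
  have hsum: "(\<Sum>i. h i y) \<le> ennreal (grad_l1 w y)" for y
  proof -
    have "(\<Sum>i<N. h i y) = ennreal (grad_l1 w y) * indicator {M 0 y<..M N y} \<bar>w y\<bar>" for N
    proof (induction N)
      case (Suc N)
      have "M 0 y \<le> M N y" "M N y \<le> M (Suc N) y"
        by (rule lift_Suc_mono_le[of "\<lambda>i. M i y"]) (auto simp: MS)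
      then show ?case using Suc by (auto simp: h_def indicator_def)
    qed simp
    then have "(\<Sum>i<N. h i y) \<le> ennreal (grad_l1 w y)" for N by (simp add: indicator_def)
    then show ?thesis unfolding suminf_eq_SUP by (intro SUP_least)
  qed
  have "cost 1 a = (\<Sum>i. ennreal (1 / side (Suc i)) * (\<integral>\<^sup>+x\<in>top_cell. a (Suc i) x \<partial>lborel))
      + ennreal (1 / side 0) * (\<integral>\<^sup>+x\<in>top_cell. a 0 x \<partial>lborel)"
    unfolding cost_def by (subst suminf_offset[where i=1]) auto
  also have "\<dots> \<le> (\<Sum>i. 4 ^ Suc ?n * (\<integral>\<^sup>+x\<in>top_cell. h i x \<partial>lborel))
      + ennreal (1 / side 0) * (2 ^ Suc ?n * (\<integral>\<^sup>+x\<in>top_cell. ennreal \<bar>w x\<bar> \<partial>lborel))"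
    by (intro add_mono suminf_le later mult_left_mono first) auto
  also have "(\<Sum>i. 4 ^ Suc ?n * (\<integral>\<^sup>+x\<in>top_cell. h i x \<partial>lborel))
      = 4 ^ Suc ?n * (\<integral>\<^sup>+x. (\<Sum>i. h i x * indicator top_cell x) \<partial>lborel)"
    unfolding ennreal_suminf_cmult by (subst nn_integral_suminf) auto
  also have "(\<integral>\<^sup>+x. (\<Sum>i. h i x * indicator top_cell x) \<partial>lborel) \<le> (\<integral>\<^sup>+x\<in>top_cell. ennreal (grad_l1 w x) \<partial>lborel)"
    unfolding ennreal_suminf_multc by (intro nn_integral_mono mult_right_mono hsum) simp
  finally have "cost 1 a \<le> ennreal (1 / L) * (2 ^ Suc ?n * (\<integral>\<^sup>+x\<in>top_cell. ennreal \<bar>w x\<bar> \<partial>lborel))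
      + 4 ^ Suc ?n * (\<integral>\<^sup>+x\<in>top_cell. ennreal (grad_l1 w x) \<partial>lborel)"
    by (simp add: side_0 add.commute add_left_mono mult_left_mono)
  then show ?thesis unfolding dominated_def using ad bound by blast
qed

end

subsection \<open>Oscillation of smooth functions\<close>

lemma partial_deriv_diff:
  assumes "f differentiable (at x)" "g differentiable (at x)"
  shows "partial_deriv c (\<lambda>x. f x - g x) x = partial_deriv c f x - partial_deriv c g x"
proof -
  have "((\<lambda>x. f x - g x) has_derivative
      (\<lambda>v. frechet_derivative f (at x) v - frechet_derivative g (at x) v)) (at x)"
    using assms by (intro has_derivative_diff) (simp_all add: frechet_derivative_works)
  from frechet_derivative_at[OF this] show ?thesis by (simp add: partial_deriv_def fun_eq_iff)
qed

lemma iterated_partial_diff: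
  assumes f: "smooth f" and g: "smooth g"
  shows "iterated_partial js (\<lambda>x. f x - g x) = (\<lambda>x. iterated_partial js f x - iterated_partial js g x)"
proof (induction js)
  case (Cons c js)
  show ?case unfolding iterated_partial_Cons Cons.IH
    by (intro ext partial_deriv_diff smooth_differentiable smooth_iterated_partial f g)
qed simp

lemma smooth_diff:
  assumes f: "smooth f" and g: "smooth g"
  shows "smooth (\<lambda>x. f x - g x)"
  using f g unfolding smooth_def iterated_partial_diff[OF f g] by (auto intro!: differentiable_diff)

lemma iterated_partial_const:
  "iterated_partial js (\<lambda>x. a) = (\<lambda>x. if js = [] then a else 0)"
proof (induction js)
  case (Cons c js)
  show ?case unfolding iterated_partial_Cons Cons.IH
    by (simp add: partial_deriv_def frechet_derivative_const)
qed simp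

lemma smooth_const: "smooth (\<lambda>x. a)"
  unfolding smooth_def iterated_partial_const by (auto simp: if_distrib)

lemma finite_lists_length [simp]: "finite {js::'n::finite list. length js = m}"
  using finite_lists_length_eq[of "UNIV::'n set" m] by simp

lemma lists_length_0: "{js. length js = 0} = {[]}" by auto

context grid
begin

text \<open>Weights for the summands are added; since \<open>cost\<close> is additive, no constant
  is lost, unlike for the Choquet integrals themselves.\<close>

lemma dominated_sum:
  assumes I: "finite I" and dom: "\<And>c. c \<in> I \<Longrightarrow> dominated j (w c) (A c)"
  shows "dominated j (\<lambda>x. \<Sum>c\<in>I. \<bar>w c x\<bar>) (\<Sum>c\<in>I. A c)"
proof -
  have "\<forall>c\<in>I. \<exists>a. adapted a \<and> (\<forall>x\<in>top_cell. ennreal \<bar>w c x\<bar> \<le> (\<Sum>i. a i x)) \<and> cost j a \<le> A c"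
    using dom unfolding dominated_def by blast
  from bchoice[OF this] obtain a where a: "\<And>c. c \<in> I \<Longrightarrow> adapted (a c)"
    "\<And>c x. c \<in> I \<Longrightarrow> x \<in> top_cell \<Longrightarrow> ennreal \<bar>w c x\<bar> \<le> (\<Sum>i. a c i x)"
    "\<And>c. c \<in> I \<Longrightarrow> cost j (a c) \<le> A c" by blast
  have am: "c \<in> I \<Longrightarrow> a c i \<in> borel_measurable borel" for c i using a(1) by (rule adapted_measurable)
  have "adapted (\<lambda>i x. \<Sum>c\<in>I. a c i x)"
  proof (rule adaptedI)
    fix i x y assume "idx i x = idx i y"
    then show "(\<Sum>c\<in>I. a c i x) = (\<Sum>c\<in>I. a c i y)" by (intro sum.cong refl adaptedD[OF a(1)])
  qed
  moreover have "ennreal \<bar>\<Sum>c\<in>I. \<bar>w c x\<bar>\<bar> \<le> (\<Sum>i. \<Sum>c\<in>I. a c i x)" if "x \<in> top_cell" for x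
  proof -
    have "ennreal \<bar>\<Sum>c\<in>I. \<bar>w c x\<bar>\<bar> = (\<Sum>c\<in>I. ennreal \<bar>w c x\<bar>)" by (simp add: sum_nonneg sum_ennreal)
    also have "\<dots> \<le> (\<Sum>c\<in>I. \<Sum>i. a c i x)" by (intro sum_mono a(2) that)
    also have "\<dots> = (\<Sum>i. \<Sum>c\<in>I. a c i x)" by (rule suminf_sum[symmetric]) simp
    finally show ?thesis .
  qed
  moreover have "cost j (\<lambda>i x. \<Sum>c\<in>I. a c i x) = (\<Sum>c\<in>I. cost j (a c))"
  proof -
    have "(\<integral>\<^sup>+x\<in>top_cell. (\<Sum>c\<in>I. a c i x) \<partial>lborel) = (\<Sum>c\<in>I. \<integral>\<^sup>+x\<in>top_cell. a c i x \<partial>lborel)" for i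
      unfolding sum_distrib_right by (intro nn_integral_sum) (use am in measurable)
    then have "cost j (\<lambda>i x. \<Sum>c\<in>I. a c i x)
        = (\<Sum>i. \<Sum>c\<in>I. ennreal ((1 / side i) ^ j) * (\<integral>\<^sup>+x\<in>top_cell. a c i x \<partial>lborel))"
      by (simp add: cost_def sum_distrib_left)
    also have "\<dots> = (\<Sum>c\<in>I. cost j (a c))" unfolding cost_def by (rule suminf_sum) simp
    finally show ?thesis .
  qed
  moreover have "(\<Sum>c\<in>I. cost j (a c)) \<le> (\<Sum>c\<in>I. A c)" by (intro sum_mono a(3))
  ultimately show ?thesis unfolding dominated_def
    by (intro exI[of _ "\<lambda>i x. \<Sum>c\<in>I. a c i x"]) auto
qed

text \<open>A Sobolev norm on the top cell whose powers of \<open>1 / L\<close> give each order the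
  scaling of the highest one. All lists of directions are kept, so a mixed derivative occurs once
  for each order of differentiation.\<close>

definition sob :: "nat \<Rightarrow> (real^'n \<Rightarrow> real) \<Rightarrow> ennreal" where
  "sob j w = (\<Sum>m\<le>j. ennreal ((1 / L) ^ (j - m)) *
      (\<Sum>js | length js = m. \<integral>\<^sup>+x\<in>top_cell. ennreal \<bar>iterated_partial js w x\<bar> \<partial>lborel))"

lemma sob_Suc: "sob (Suc j) w = ennreal ((1 / L) ^ Suc j) * (\<integral>\<^sup>+x\<in>top_cell. ennreal \<bar>w x\<bar> \<partial>lborel)
    + (\<Sum>c\<in>UNIV. sob j (partial_deriv c w))"
proof -
  let ?J = "\<lambda>js w. \<integral>\<^sup>+x\<in>top_cell. ennreal \<bar>iterated_partial js w x\<bar> \<partial>lborel"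
  have "sob (Suc j) w = ennreal ((1 / L) ^ Suc j) * ?J [] w
      + (\<Sum>m\<le>j. ennreal ((1 / L) ^ (j - m)) * (\<Sum>js | length js = Suc m. ?J js w))"
    unfolding sob_def by (simp add: sum.atMost_Suc_shift lists_length_0 del: sum.atMost_Suc length_0_conv)
  also have "(\<Sum>m\<le>j. ennreal ((1 / L) ^ (j - m)) * (\<Sum>js | length js = Suc m. ?J js w))
      = (\<Sum>m\<le>j. \<Sum>c\<in>UNIV. ennreal ((1 / L) ^ (j - m)) * (\<Sum>js | length js = m. ?J js (partial_deriv c w)))"
    unfolding sum_lists_Suc_snoc sum_distrib_left[symmetric] by (simp add: iterated_partial_append)
  also have "\<dots> = (\<Sum>c\<in>UNIV. sob j (partial_deriv c w))"
    unfolding sob_def by (rule sum.swap)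
  finally show ?thesis by simp
qed

lemma sob_0: "sob 0 w = (\<integral>\<^sup>+x\<in>top_cell. ennreal \<bar>w x\<bar> \<partial>lborel)"
  by (simp add: sob_def lists_length_0 del: length_0_conv)

text \<open>One factor \<open>4 ^ (n + 1)\<close> per order, with n the dimension, absorbs all
  constants: \<open>2 ^ (n + 1)\<close> and \<open>4 ^ (n + 1)\<close> from boxing, 1 and
  \<open>3 * 4 ^ n\<close> from the potential estimate.\<close>

lemma dominated_smooth: "smooth w \<Longrightarrow> dominated (Suc j) w ((4 ^ Suc CARD('n)) ^ Suc j * sob (Suc j) w)"
proof (induction j arbitrary: w)
  case 0
  let ?n = "CARD('n)"
  have [measurable]: "\<And>c. partial_deriv c w \<in> borel_measurable borel"
    by (intro smooth_borel_measurable smooth_partial_deriv 0)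
  have "(2::ennreal) ^ Suc ?n \<le> 4 ^ Suc ?n" by (intro power_mono) auto
  moreover have "(\<integral>\<^sup>+x\<in>top_cell. ennreal (grad_l1 w x) \<partial>lborel) = (\<Sum>c\<in>UNIV. sob 0 (partial_deriv c w))"
    unfolding sob_0 grad_l1_def
    by (subst nn_integral_sum[symmetric]) (auto simp: sum_ennreal sum_distrib_right[symmetric])
  ultimately have "ennreal (1 / L) * (2 ^ Suc ?n * (\<integral>\<^sup>+x\<in>top_cell. ennreal \<bar>w x\<bar> \<partial>lborel))
      + 4 ^ Suc ?n * (\<integral>\<^sup>+x\<in>top_cell. ennreal (grad_l1 w x) \<partial>lborel)
      \<le> ennreal (1 / L) * (4 ^ Suc ?n * (\<integral>\<^sup>+x\<in>top_cell. ennreal \<bar>w x\<bar> \<partial>lborel))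
      + 4 ^ Suc ?n * (\<Sum>c\<in>UNIV. sob 0 (partial_deriv c w))"
    by (intro add_mono mult_left_mono mult_right_mono) auto
  also have "\<dots> = (4 ^ Suc ?n) ^ Suc 0 * sob (Suc 0) w"
    unfolding sob_Suc distrib_left by (simp add: mult_ac)
  finally show ?case using dominated_mono[OF dominated_1[OF 0]] by simp
next
  case (Suc j)
  let ?n = "CARD('n)" and ?C = "(4 ^ Suc CARD('n)) ^ Suc j :: ennreal"
  let ?A = "?C * (\<Sum>c\<in>UNIV. sob (Suc j) (partial_deriv c w))"
  have "dominated (Suc j) (\<lambda>x. \<Sum>c\<in>UNIV. \<bar>partial_deriv c w x\<bar>)
      (\<Sum>c\<in>UNIV. ?C * sob (Suc j) (partial_deriv c w))"
    by (intro dominated_sum Suc.IH smooth_partial_deriv Suc.prems) simp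
  then have "dominated (Suc j) (grad_l1 w) ?A"
    by (simp add: grad_l1_def[abs_def] sum_distrib_left del: power_Suc)
  from dominated_Suc[OF Suc.prems _ this] have
    "dominated (Suc (Suc j)) w (ennreal ((1 / L) ^ Suc (Suc j)) * (\<integral>\<^sup>+x\<in>top_cell. ennreal \<bar>w x\<bar> \<partial>lborel)
      + 4 ^ ?n * (3 * ?A))" by simp
  then show ?case
  proof (rule dominated_mono)
    let ?X = "ennreal ((1 / L) ^ Suc (Suc j)) * (\<integral>\<^sup>+x\<in>top_cell. ennreal \<bar>w x\<bar> \<partial>lborel)"
    let ?Y = "\<Sum>c\<in>UNIV. sob (Suc j) (partial_deriv c w)"
    have "(1::ennreal) \<le> (4 ^ Suc ?n) ^ Suc (Suc j)" by (intro one_le_power) auto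
    then have 1: "?X \<le> (4 ^ Suc ?n) ^ Suc (Suc j) * ?X" using mult_right_mono by fastforce
    have "4 ^ ?n * (3 * (?C * ?Y)) \<le> 4 ^ ?n * (4 * (?C * ?Y))"
      by (intro mult_left_mono mult_right_mono) auto
    also have "\<dots> = (4 ^ Suc ?n) ^ Suc (Suc j) * ?Y" by (simp add: mult_ac)
    finally show "?X + 4 ^ ?n * (3 * ?A) \<le> (4 ^ Suc ?n) ^ Suc (Suc j) * sob (Suc (Suc j)) w"
      unfolding sob_Suc[of "Suc j"] distrib_left by (rule add_mono[OF 1])
  qed
qed

lemma cost_indicator:
  "(\<Sum>i. ennreal ((1 / side i) ^ k) * (\<integral>\<^sup>+x. a i x * indicator top_cell x \<partial>lborel)) = cost k a"
  by (simp add: cost_def)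

text \<open>The Choquet estimate integrates the weights over all of space while \<open>cost\<close>
  sees only the top cell. Cutting the weights off reconciles the two; they stay adapted because the
  top cell is a union of cells of every level.\<close>

lemma adapted_indicator: "adapted a \<Longrightarrow> adapted (\<lambda>i x. a i x * indicator top_cell x)"
proof (rule adaptedI)
  fix i x y assume "adapted a" and e: "idx i x = idx i y"
  then show "a i x * indicator top_cell x = a i y * indicator top_cell y"
    using adaptedD[OF \<open>adapted a\<close> e] saturatedD[OF saturated_top_cell e] by (simp add: indicator_def)
qed

lemma choquet_dominated_le:
  assumes dom: "dominated k w A" and k: "k < CARD('n)" and S: "S \<subseteq> top_cell"
  shows "choquet_integral (real CARD('n) - real k) S (\<lambda>x. ennreal \<bar>w x\<bar>)
    \<le> ennreal (content_const (real CARD('n) - real k)) * A"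
proof -
  obtain a where a: "adapted a" "\<And>x. x \<in> top_cell \<Longrightarrow> ennreal \<bar>w x\<bar> \<le> (\<Sum>i. a i x)" "cost k a \<le> A"
    using dom unfolding dominated_def by blast
  have "choquet_integral (real CARD('n) - real k) S (\<lambda>x. ennreal \<bar>w x\<bar>)
    \<le> choquet_integral (real CARD('n) - real k) S (\<lambda>x. \<Sum>i. a i x * indicator top_cell x)"
    using a(2) S by (intro choquet_integral_mono) auto
  also have "\<dots> \<le> ennreal (content_const (real CARD('n) - real k)) * cost k a"
    unfolding cost_indicator[symmetric]
    by (intro choquet_adapted_le adapted_indicator a k refl)
  also have "\<dots> \<le> ennreal (content_const (real CARD('n) - real k)) * A"
    by (intro mult_left_mono a) simp
  finally show ?thesis .
qed

lemma corner_in_top_cell: "p \<in> top_cell" by (simp add: top_cell_def idx_def vec_eq_iff)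

text \<open>The centre is a value \<open>w z\<close>: the double Poincare integral, averaged over z,
  shows that not all z can exceed twice the mean bound. Choosing among the values of w keeps all
  integrals nonnegative, which a signed mean value would not.\<close>

lemma exists_center:
  assumes w: "smooth w"
  shows "\<exists>c. (\<integral>\<^sup>+x\<in>top_cell. ennreal \<bar>w x - c\<bar> \<partial>lborel)
    \<le> 2 * (ennreal L * (2 ^ CARD('n) * (\<integral>\<^sup>+x\<in>top_cell. ennreal (grad_l1 w x) \<partial>lborel)))"
proof (rule ccontr)
  have [measurable]: "w \<in> borel_measurable borel" using w by simp
  let ?B = "ennreal L * (2 ^ CARD('n) * (\<integral>\<^sup>+x\<in>top_cell. ennreal (grad_l1 w x) \<partial>lborel))"
  define J where "J z = (\<integral>\<^sup>+x\<in>top_cell. ennreal \<bar>w x - w z\<bar> \<partial>lborel)" for z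
  have J': "J z = (\<integral>\<^sup>+x\<in>top_cell. ennreal \<bar>w z - w x\<bar> \<partial>lborel)" for z
    unfolding J_def by (subst abs_minus_commute) (rule refl)
  have [measurable]: "J \<in> borel_measurable borel" unfolding J_def by measurable
  assume "\<nexists>c. (\<integral>\<^sup>+x\<in>top_cell. ennreal \<bar>w x - c\<bar> \<partial>lborel) \<le> 2 * ?B"
  then have J: "2 * ?B < J z" for z unfolding J_def not_ex not_le by blast
  have "?B \<le> 2 * ?B" by (simp add: mult_2)
  also have "\<dots> < top" by (rule less_le_trans[OF J[of undefined]]) simp
  finally have fin: "?B < top" .
  let ?m = "emeasure lborel top_cell"
  have m: "?m = ennreal (L ^ CARD('n))"
    using emeasure_cell[of 0 p] by (simp add: top_cell_eq[OF corner_in_top_cell] side_0)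
  have m0: "0 < ?m" "?m < top" using L_pos by (simp_all add: m)
  have "2 * ?B * ?m = (\<integral>\<^sup>+z. 2 * ?B * indicator top_cell z \<partial>lborel)"
    by (subst nn_integral_cmult_indicator) auto
  also have "\<dots> \<le> (\<integral>\<^sup>+z\<in>top_cell. J z \<partial>lborel)"
    using J by (intro nn_integral_mono mult_right_mono) (auto intro: less_imp_le)
  finally have lower: "2 * ?B * ?m \<le> (\<integral>\<^sup>+z\<in>top_cell. J z \<partial>lborel)" .
  have upper: "(\<integral>\<^sup>+z\<in>top_cell. J z \<partial>lborel) \<le> ?B * ?m"
    using cell_poincare[OF w, of 0 p] unfolding top_cell_eq[OF corner_in_top_cell] side_0 J'
    by (simp add: mult_ac)
  \<comment> \<open>With \<open>2 * ?B\<close> as a strict lower bound for J the two estimates force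
    \<open>?B * ?m = 0\<close>; then J vanishes almost everywhere on the top cell although it is
    positive everywhere.\<close>
  have "?B * ?m + ?B * ?m \<le> ?B * ?m + 0"
    using order_trans[OF lower upper] by (simp add: mult_2 distrib_right)
  then have "?B * ?m = 0"
    using fin m0 by (subst (asm) ennreal_add_left_cancel_le) (auto simp: ennreal_mult_eq_top_iff)
  with upper have "(\<integral>\<^sup>+z. J z * indicator top_cell z \<partial>lborel) = 0" by simp
  then have "emeasure lborel {z \<in> space lborel. J z * indicator top_cell z \<noteq> 0} = 0"
    by (subst (asm) nn_integral_0_iff) auto
  also have "{z \<in> space lborel. J z * indicator top_cell z \<noteq> 0} = top_cell"
    using le_less_trans[OF zero_le J] by (auto simp: indicator_def less_le)
  finally show False using m0 by simp
qed

text \<open>Subtracting the centre leaves the derivatives of positive order unchanged and turns the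
  order-zero term into a multiple of the first-order one. The factor \<open>2 ^ (n + 1)\<close>,
  with n the dimension, is that of \<open>exists_center\<close>, and 1 accounts for the positive
  orders. One constant c serves all subsets of the top cell.\<close>

lemma choquet_oscillation_le:
  assumes w: "smooth w" and k: "1 \<le> k" "k < CARD('n)"
  shows "\<exists>c. \<forall>S\<subseteq>top_cell. choquet_integral (real CARD('n) - real k) S (\<lambda>x. ennreal \<bar>w x - c\<bar>)
    \<le> ennreal (content_const (real CARD('n) - real k)) * ((4 ^ Suc CARD('n)) ^ k * (2 ^ Suc CARD('n) + 1)
      * (\<Sum>m=1..k. ennreal ((1 / L) ^ (k - m)) *
      (\<Sum>js | length js = m. \<integral>\<^sup>+x\<in>top_cell. ennreal \<bar>iterated_partial js w x\<bar> \<partial>lborel)))"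
proof -
  let ?n = "CARD('n)"
  let ?J = "\<lambda>w m. \<Sum>js | length js = m. \<integral>\<^sup>+x\<in>top_cell. ennreal \<bar>iterated_partial js w x\<bar> \<partial>lborel"
  let ?R = "\<Sum>m=1..k. ennreal ((1 / L) ^ (k - m)) * ?J w m"
  have [measurable]: "\<And>c. partial_deriv c w \<in> borel_measurable borel"
    by (intro smooth_borel_measurable smooth_partial_deriv w)
  obtain c where c: "(\<integral>\<^sup>+x\<in>top_cell. ennreal \<bar>w x - c\<bar> \<partial>lborel)
    \<le> 2 * (ennreal L * (2 ^ ?n * (\<integral>\<^sup>+x\<in>top_cell. ennreal (grad_l1 w x) \<partial>lborel)))"
    using exists_center[OF w] by blast
  let ?w = "\<lambda>x. w x - c"
  have sm: "smooth ?w" by (intro smooth_diff w smooth_const)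
  have G: "(\<integral>\<^sup>+x\<in>top_cell. ennreal (grad_l1 w x) \<partial>lborel) = ?J w 1"
  proof -
    have "?J w 1 = (\<Sum>c\<in>UNIV. \<integral>\<^sup>+x\<in>top_cell. ennreal \<bar>partial_deriv c w x\<bar> \<partial>lborel)"
      unfolding One_nat_def sum_lists_Suc_snoc lists_length_0 by simp
    then show ?thesis unfolding grad_l1_def
      by (simp only:) (subst nn_integral_sum[symmetric], auto simp: sum_ennreal sum_distrib_right[symmetric])
  qed
  have J: "?J ?w m = ?J w m" if "1 \<le> m" for m
    using that by (intro sum.cong refl nn_integral_cong) (auto simp: iterated_partial_diff[OF w smooth_const] iterated_partial_const)
  have "{..k} = insert 0 {1..k}" by auto
  then have "sob k ?w = ennreal ((1 / L) ^ k) * ?J ?w 0 + (\<Sum>m=1..k. ennreal ((1 / L) ^ (k - m)) * ?J ?w m)"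
    unfolding sob_def by (simp del: length_0_conv)
  also have "(\<Sum>m=1..k. ennreal ((1 / L) ^ (k - m)) * ?J ?w m) = ?R"
    by (intro sum.cong) (simp_all add: J)
  also have "?J ?w 0 = (\<integral>\<^sup>+x\<in>top_cell. ennreal \<bar>w x - c\<bar> \<partial>lborel)" by (simp add: lists_length_0 del: length_0_conv)
  also have "ennreal ((1 / L) ^ k) * \<dots> \<le> ennreal ((1 / L) ^ k) * (2 * (ennreal L * (2 ^ ?n * ?J w 1)))"
    using c unfolding G by (rule mult_left_mono) simp
  also have "\<dots> = 2 ^ Suc ?n * ((ennreal ((1 / L) ^ k) * ennreal L) * ?J w 1)"
    by (simp only: power_Suc mult_ac)
  also have "ennreal ((1 / L) ^ k) * ennreal L = ennreal ((1 / L) ^ (k - 1))"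
    using L_pos k by (cases k) (simp_all flip: ennreal_mult)
  also have "ennreal ((1 / L) ^ (k - 1)) * ?J w 1 \<le> ?R"
    using k by (intro member_le_sum[of 1 "{1..k}" "\<lambda>m. ennreal ((1 / L) ^ (k - m)) * ?J w m"]) auto
  finally have "sob k ?w \<le> (2 ^ Suc ?n + 1) * ?R"
    by (simp add: distrib_right add_right_mono mult_left_mono)
  moreover have "dominated k ?w ((4 ^ Suc ?n) ^ k * sob k ?w)"
    using dominated_smooth[OF sm, of "k - 1"] k by simp
  ultimately have "dominated k ?w ((4 ^ Suc ?n) ^ k * ((2 ^ Suc ?n + 1) * ?R))"
    by (elim dominated_mono) (intro mult_left_mono, auto)
  from choquet_dominated_le[OF this k(2)] show ?thesis
    by (intro exI[of _ c]) (simp only: mult.assoc, blast)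
qed

subsection \<open>Maximal averages of adapted weights\<close>

definition shifts :: "(int^'n) set" where "shifts = {v. \<forall>c. v $ c \<in> {-1, 0, 1}}"

text \<open>Neighbouring cells are reached by translating the point, so integrals of neighbour sums
  reduce to translation invariance.\<close>

definition nbr :: "nat \<Rightarrow> int^'n \<Rightarrow> real^'n \<Rightarrow> real^'n" where
  "nbr i v x = x + side i *\<^sub>R (\<chi> c. of_int (v $ c))"

definition nbr_sum :: "nat \<Rightarrow> (real^'n \<Rightarrow> ennreal) \<Rightarrow> real^'n \<Rightarrow> ennreal" where
  "nbr_sum i f x = (\<Sum>v\<in>shifts. f (nbr i v x))"

lemma finite_shifts: "finite shifts"
proof -
  have "shifts \<subseteq> (\<lambda>f. \<chi> c. f c) ` (Pi\<^sub>E UNIV (\<lambda>_. {-1, 0, 1}))"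
  proof
    fix v assume "v \<in> shifts"
    then show "v \<in> (\<lambda>f. \<chi> c. f c) ` (Pi\<^sub>E UNIV (\<lambda>_. {-1, 0, 1}))"
      by (intro image_eqI[of _ _ "\<lambda>c. v $ c"]) (auto simp: shifts_def vec_eq_iff)
  qed
  then show ?thesis by (rule finite_subset) (intro finite_imageI finite_PiE, auto)
qed

lemma idx_nbr: "idx i (nbr i v x) = idx i x + v"
  unfolding nbr_def by (rule idx_shift)

lemma zero_in_shifts: "0 \<in> shifts" by (simp add: shifts_def)

lemma nbr_zero: "nbr i 0 x = x" by (simp add: nbr_def vec_eq_iff)

lemma nbr_sum_ge: "f x \<le> nbr_sum i f x"
  unfolding nbr_sum_def
  using member_le_sum[OF zero_in_shifts, of "\<lambda>v. f (nbr i v x)"] finite_shifts by (simp add: nbr_zero)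

lemma nbr_sum_add: "nbr_sum i (\<lambda>y. f y + g y) x = nbr_sum i f x + nbr_sum i g x"
  by (simp add: nbr_sum_def sum.distrib)

lemma nbr_sum_cmult: "nbr_sum i (\<lambda>y. c * f y) x = c * nbr_sum i f x"
  by (simp add: nbr_sum_def sum_distrib_left)

lemma nn_integral_nbr_sum:
  assumes [measurable]: "f \<in> borel_measurable borel"
  shows "(\<integral>\<^sup>+x. nbr_sum i f x \<partial>lborel) = of_nat (card shifts) * (\<integral>\<^sup>+x. f x \<partial>lborel)"
proof -
  have "(\<integral>\<^sup>+x. f (nbr i v x) \<partial>lborel) = (\<integral>\<^sup>+x. f x \<partial>lborel)" for v
    using nn_integral_affine[of f 1 "side i *\<^sub>R (\<chi> c. of_int (v $ c))"]
    by (simp add: nbr_def add.commute)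
  moreover have "(\<integral>\<^sup>+x. nbr_sum i f x \<partial>lborel) = (\<Sum>v\<in>shifts. \<integral>\<^sup>+x. f (nbr i v x) \<partial>lborel)"
    unfolding nbr_sum_def by (intro nn_integral_sum) (simp add: nbr_def)
  ultimately show ?thesis by simp
qed

lemma idx_diff_shifts:
  assumes "y \<in> ball x r" "r \<le> side m"
  shows "idx m y - idx m x \<in> shifts"
proof -
  have "(idx m y - idx m x) $ c \<in> {-1, 0, 1}" for c
  proof -
    have "\<bar>y $ c - x $ c\<bar> \<le> norm (y - x)" using component_le_norm_cart[of "y - x" c] by simp
    also have "\<dots> < side m" using assms by (simp add: dist_norm norm_minus_commute)
    finally have "\<bar>(y $ c - p $ c) / side m - (x $ c - p $ c) / side m\<bar> < 1"
      by (simp add: diff_divide_distrib[symmetric] abs_divide)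
    then have "\<bar>\<lfloor>(y $ c - p $ c) / side m\<rfloor> - \<lfloor>(x $ c - p $ c) / side m\<rfloor>\<bar> \<le> 1" by linarith
    then show ?thesis by (auto simp: idx_nth)
  qed
  then show ?thesis by (simp add: shifts_def)
qed

lemma exists_nbr_cell:
  assumes "y \<in> ball x r" "r \<le> side m"
  obtains v where "v \<in> shifts" "idx m (nbr m v x) = idx m y"
  using that[OF idx_diff_shifts[OF assms]] by (simp add: idx_nbr)

text \<open>Ratio of the volume of a cell of side length \<open>2 * r\<close> to that of a ball of
  radius r.\<close>

definition ball_const :: real where "ball_const = 2 ^ CARD('n) / unit_ball_vol (real CARD('n))"

text \<open>For a radius r take the level i with \<open>side i / 2 < r \<le> side i\<close>. At each
  level up to i a ball of radius r meets only the cell of its centre and the neighbours of that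
  cell, so the weights there are bounded by neighbour sums. The finer weights are integrated over
  the neighbouring cells of level i, whose volume is comparable with that of the ball; their
  averages form weights of level i. One family b serves all radii because it contains these averages
  for every i.\<close>

lemma maximal_bound:
  assumes a: "adapted a" and k: "1 \<le> k"
  obtains b where "adapted b" "\<And>x. (\<Sum>i. a i x) \<le> (\<Sum>i. b i x)"
    "\<And>x r. 0 < r \<Longrightarrow> r \<le> L \<Longrightarrow> (\<integral>\<^sup>+y\<in>ball x r. (\<Sum>i. a i y) \<partial>lborel) \<le> emeasure lborel (ball x r) * (\<Sum>i. b i x)"
    "(\<Sum>i. ennreal ((1 / side i) ^ k) * (\<integral>\<^sup>+x. b i x \<partial>lborel))
      \<le> of_nat (card shifts) * (1 + ennreal ball_const) * (\<Sum>i. ennreal ((1 / side i) ^ k) * (\<integral>\<^sup>+x. a i x \<partial>lborel))"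
proof -
  let ?n = "CARD('n)"
  have am [measurable]: "\<And>i. a i \<in> borel_measurable borel" using a by (rule adapted_measurable)
  define F where "F i y = (\<Sum>m. if i < m then a m y else 0)" for i y
  have [measurable]: "F i \<in> borel_measurable borel" for i unfolding F_def by measurable
  define b where "b i = nbr_sum i (\<lambda>y. a i y + ennreal ball_const * cell_avg i (F i) y)" for i
  have ad: "adapted b"
  proof (rule adaptedI)
    fix i x y assume "idx i x = idx i y"
    then have "idx i (nbr i v x) = idx i (nbr i v y)" for v by (simp add: idx_nbr)
    from adaptedD[OF a this] cell_avg_adapted[OF this] show "b i x = b i y"
      unfolding b_def nbr_sum_def by (intro sum.cong) auto
  qed
  have ge: "(\<Sum>i. a i x) \<le> (\<Sum>i. b i x)" for x
  proof (intro suminf_le)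
    fix i
    have "a i x \<le> nbr_sum i (a i) x" by (rule nbr_sum_ge)
    also have "\<dots> \<le> b i x" unfolding b_def nbr_sum_add by simp
    finally show "a i x \<le> b i x" .
  qed auto
  have avg: "(\<integral>\<^sup>+y\<in>ball x r. (\<Sum>i. a i y) \<partial>lborel) \<le> emeasure lborel (ball x r) * (\<Sum>i. b i x)"
    if r: "0 < r" "r \<le> L" for x r
  proof -
    have "(\<lambda>i. L * (1/2) ^ i) \<longlonglongrightarrow> L * 0"
      by (intro tendsto_mult tendsto_const LIMSEQ_realpow_zero) auto
    then have "\<forall>\<^sub>F i in sequentially. L * (1/2) ^ i < r"
      using r by (intro order_tendstoD(2)) auto
    then obtain N where "side N < r"
      by (auto simp: eventually_sequentially side_def power_one_over)
    moreover have "\<not> side 0 < r" using r by (simp add: side_0)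
    ultimately obtain i where i: "\<not> side i < r" "side (Suc i) < r"
      using ex_least_nat_less[of "\<lambda>i. side i < r" N] by blast
    then have ri: "r \<le> side i" "side i \<le> 2 * r" by (auto simp: side_Suc)
    have small: "a m y \<le> nbr_sum m (a m) x" if m: "m \<le> i" and y: "y \<in> ball x r" for m y
    proof -
      have "r \<le> side m" using ri side_antimono[OF m] by linarith
      then obtain v where v: "v \<in> shifts" "idx m (nbr m v x) = idx m y" using exists_nbr_cell[OF y] by blast
      have "a m y = a m (nbr m v x)" using adaptedD[OF a v(2)] by simp
      also have "\<dots> \<le> nbr_sum m (a m) x"
        unfolding nbr_sum_def using v finite_shifts by (intro member_le_sum) auto
      finally show ?thesis .
    qed
    have split: "(\<Sum>m. a m y) = (\<Sum>m. if m \<le> i then a m y else 0) + F i y" for y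
      unfolding F_def suminf_add_ennreal[symmetric] by (intro suminf_cong) auto
    define S where "S = (\<Sum>m. if m \<le> i then nbr_sum m (a m) x else 0)"
    have "(\<integral>\<^sup>+y\<in>ball x r. (\<Sum>i. a i y) \<partial>lborel) \<le> (\<integral>\<^sup>+y. S * indicator (ball x r) y
        + (\<Sum>v\<in>shifts. F i y * indicator (cell i (nbr i v x)) y) \<partial>lborel)"
    proof (intro nn_integral_mono)
      fix y
      show "(\<Sum>i. a i y) * indicator (ball x r) y \<le> S * indicator (ball x r) y
        + (\<Sum>v\<in>shifts. F i y * indicator (cell i (nbr i v x)) y)"
      proof (cases "y \<in> ball x r")
        case True
        then obtain v where v: "v \<in> shifts" "idx i (nbr i v x) = idx i y"
          using exists_nbr_cell[OF _ ri(1)] by blast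
        have "F i y = F i y * indicator (cell i (nbr i v x)) y" using v by (simp add: cell_def)
        also have "\<dots> \<le> (\<Sum>v\<in>shifts. F i y * indicator (cell i (nbr i v x)) y)"
          using v finite_shifts by (intro member_le_sum) auto
        finally have 1: "F i y \<le> (\<Sum>v\<in>shifts. F i y * indicator (cell i (nbr i v x)) y)" .
        have "(\<Sum>m. if m \<le> i then a m y else 0) \<le> S"
          unfolding S_def using small True by (intro suminf_le) auto
        then show ?thesis using True 1 unfolding split by (simp add: add_mono)
      qed simp
    qed
    also have "\<dots> = S * emeasure lborel (ball x r) + (\<Sum>v\<in>shifts. \<integral>\<^sup>+y\<in>cell i (nbr i v x). F i y \<partial>lborel)"
    proof -
      have m: "(\<lambda>y. F i y * indicator (cell i (nbr i v x)) y) \<in> borel_measurable lborel" for v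
        by (intro borel_measurable_times_ennreal borel_measurable_indicator) simp_all
      have m0: "(\<lambda>y. S * indicator (ball x r) y) \<in> borel_measurable lborel"
        by (intro borel_measurable_times_ennreal borel_measurable_indicator) simp_all
      have "(\<integral>\<^sup>+y. S * indicator (ball x r) y + (\<Sum>v\<in>shifts. F i y * indicator (cell i (nbr i v x)) y) \<partial>lborel)
        = (\<integral>\<^sup>+y. S * indicator (ball x r) y \<partial>lborel)
          + (\<integral>\<^sup>+y. (\<Sum>v\<in>shifts. F i y * indicator (cell i (nbr i v x)) y) \<partial>lborel)"
        by (rule nn_integral_add[OF m0]) (intro borel_measurable_sum m)
      also have "(\<integral>\<^sup>+y. S * indicator (ball x r) y \<partial>lborel) = S * emeasure lborel (ball x r)"
        by (rule nn_integral_cmult_indicator) simp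
      also have "(\<integral>\<^sup>+y. (\<Sum>v\<in>shifts. F i y * indicator (cell i (nbr i v x)) y) \<partial>lborel)
          = (\<Sum>v\<in>shifts. \<integral>\<^sup>+y\<in>cell i (nbr i v x). F i y \<partial>lborel)"
        by (rule nn_integral_sum) (rule m)
      finally show ?thesis .
    qed
    also have "(\<Sum>v\<in>shifts. \<integral>\<^sup>+y\<in>cell i (nbr i v x). F i y \<partial>lborel)
        = ennreal (side i ^ ?n) * nbr_sum i (cell_avg i (F i)) x"
      unfolding nbr_sum_def cell_avg_def sum_distrib_left mult.assoc[symmetric] side_power_mult_inverse by simp
    also have "\<dots> \<le> (emeasure lborel (ball x r) * ennreal ball_const) * nbr_sum i (cell_avg i (F i)) x"
    proof (rule mult_right_mono)
      have "side i ^ ?n \<le> (2 * r) ^ ?n" using ri by (intro power_mono) auto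
      also have "\<dots> = unit_ball_vol (real ?n) * r ^ ?n * ball_const"
      proof -
        have "unit_ball_vol (real ?n) \<noteq> 0"
          using unit_ball_vol_pos[of "real ?n"] by (metis less_irrefl of_nat_0_le_iff)
        then show ?thesis by (simp add: ball_const_def power_mult_distrib)
      qed
      finally have "ennreal (side i ^ ?n) \<le> ennreal (unit_ball_vol (real ?n) * r ^ ?n * ball_const)" by (rule ennreal_leI)
      also have "\<dots> = emeasure lborel (ball x r) * ennreal ball_const"
      proof -
        have e: "emeasure lborel (ball x r) = ennreal (unit_ball_vol (real ?n) * r ^ ?n)"
          using emeasure_ball[of r x] r by simp
        have "0 \<le> ball_const" "0 \<le> unit_ball_vol (real ?n) * r ^ ?n"
          using r by (auto simp: ball_const_def)
        then show ?thesis unfolding e by (simp only: ennreal_mult)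
      qed
      finally show "ennreal (side i ^ ?n) \<le> emeasure lborel (ball x r) * ennreal ball_const" .
    qed simp
    finally have "(\<integral>\<^sup>+y\<in>ball x r. (\<Sum>i. a i y) \<partial>lborel)
      \<le> S * emeasure lborel (ball x r) + (emeasure lborel (ball x r) * ennreal ball_const) * nbr_sum i (cell_avg i (F i)) x"
      by (simp add: add_left_mono)
    also have "\<dots> = emeasure lborel (ball x r) * (S + ennreal ball_const * nbr_sum i (cell_avg i (F i)) x)"
      by (simp add: distrib_left mult_ac)
    also have "\<dots> \<le> emeasure lborel (ball x r) * (\<Sum>i. b i x)"
    proof (rule mult_left_mono)
      \<comment> \<open>Only the tail average of the level i that belongs to r is used; those of the
        other levels are dropped from \<open>b\<close>.\<close>
      let ?T = "\<lambda>m. if m = i then ennreal ball_const * nbr_sum i (cell_avg i (F i)) x else 0"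
      have "S + ennreal ball_const * nbr_sum i (cell_avg i (F i)) x = S + (\<Sum>m. ?T m)"
        by (subst suminf_finite[of "{i}" ?T]) auto
      also have "\<dots> = (\<Sum>m. (if m \<le> i then nbr_sum m (a m) x else 0) + ?T m)"
        unfolding S_def by (rule suminf_add_ennreal[symmetric])
      also have "\<dots> \<le> (\<Sum>m. b m x)"
        unfolding b_def nbr_sum_add nbr_sum_cmult by (intro suminf_le) auto
      finally show "S + ennreal ball_const * nbr_sum i (cell_avg i (F i)) x \<le> (\<Sum>m. b m x)" .
    qed simp
    finally show ?thesis .
  qed
  have cost: "(\<Sum>i. ennreal ((1 / side i) ^ k) * (\<integral>\<^sup>+x. b i x \<partial>lborel))
      \<le> of_nat (card shifts) * (1 + ennreal ball_const) * (\<Sum>i. ennreal ((1 / side i) ^ k) * (\<integral>\<^sup>+x. a i x \<partial>lborel))"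
  proof -
    let ?s = "\<lambda>i. ennreal ((1 / side i) ^ k)" and ?N = "of_nat (card shifts) :: ennreal" and ?K = "ennreal ball_const"
    have "(\<integral>\<^sup>+x. b i x \<partial>lborel) = ?N * ((\<integral>\<^sup>+x. a i x \<partial>lborel) + ?K * (\<integral>\<^sup>+x. F i x \<partial>lborel))" for i
    proof -
      have "(\<integral>\<^sup>+x. cell_avg i (F i) x \<partial>lborel) = (\<integral>\<^sup>+x. F i x \<partial>lborel)"
        using nn_integral_cell_avg[OF _ saturated_UNIV, of "F i" i] by simp
      then show ?thesis unfolding b_def
        by (subst nn_integral_nbr_sum) (simp_all add: nn_integral_add nn_integral_cmult)
    qed
    then have "(\<Sum>i. ?s i * (\<integral>\<^sup>+x. b i x \<partial>lborel))
        = (\<Sum>i. ?N * (?s i * (\<integral>\<^sup>+x. a i x \<partial>lborel)) + ?N * (?K * (?s i * (\<integral>\<^sup>+x. F i x \<partial>lborel))))"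
      by (intro suminf_cong) (simp only: distrib_left mult_ac)
    also have "\<dots> = ?N * (\<Sum>i. ?s i * (\<integral>\<^sup>+x. a i x \<partial>lborel)) + ?N * (?K * (\<Sum>i. ?s i * (\<integral>\<^sup>+x. F i x \<partial>lborel)))"
      by (simp only: suminf_add_ennreal ennreal_suminf_cmult)
    also have "\<dots> \<le> ?N * (\<Sum>i. ?s i * (\<integral>\<^sup>+x. a i x \<partial>lborel)) + ?N * (?K * (\<Sum>i. ?s i * (\<integral>\<^sup>+x. a i x \<partial>lborel)))"
    proof (intro add_left_mono mult_left_mono)
      show "(\<Sum>i. ?s i * (\<integral>\<^sup>+x. F i x \<partial>lborel)) \<le> (\<Sum>i. ?s i * (\<integral>\<^sup>+x. a i x \<partial>lborel))"
        using cost_tail_le[OF k am, of UNIV] by (simp add: F_def)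
    qed simp_all
    also have "\<dots> = ?N * (1 + ?K) * (\<Sum>i. ?s i * (\<integral>\<^sup>+x. a i x \<partial>lborel))"
      by (simp add: distrib_right distrib_left mult.assoc)
    finally show ?thesis .
  qed
  show ?thesis by (rule that[OF ad ge avg cost])
qed

end

subsection \<open>Test functions and weak derivatives\<close>

lemma test_functions_smooth: "\<phi> \<in> test_functions \<Omega> \<Longrightarrow> smooth \<phi>"
  by (simp add: test_functions_def smooth_def)

lemma partial_deriv_eq:
  assumes "(f has_derivative (\<lambda>v. \<Sum>c\<in>UNIV. v $ c * D c)) (at x)"
  shows "partial_deriv c f x = D c"
  unfolding partial_deriv_def frechet_derivative_at[OF assms, symmetric]
  by (simp add: axis_def if_distrib[of "\<lambda>a. a * _"] cong: if_cong)

lemma partial_deriv_mult: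
  assumes "f differentiable (at x)" "g differentiable (at x)"
  shows "partial_deriv c (\<lambda>x. f x * g x) x = f x * partial_deriv c g x + partial_deriv c f x * g x"
proof (rule partial_deriv_eq)
  have "((\<lambda>x. f x * g x) has_derivative (\<lambda>v. f x * (\<Sum>c\<in>UNIV. v $ c * partial_deriv c g x)
      + (\<Sum>c\<in>UNIV. v $ c * partial_deriv c f x) * g x)) (at x)"
    using assms by (intro has_derivative_mult has_derivative_partial)
  also have "(\<lambda>v. f x * (\<Sum>c\<in>UNIV. v $ c * partial_deriv c g x) + (\<Sum>c\<in>UNIV. v $ c * partial_deriv c f x) * g x)
    = (\<lambda>v. \<Sum>c\<in>UNIV. v $ c * (f x * partial_deriv c g x + partial_deriv c f x * g x))"
    by (simp add: fun_eq_iff sum_distrib_left sum_distrib_right sum.distrib[symmetric] algebra_simps)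
  finally show "((\<lambda>x. f x * g x) has_derivative
      (\<lambda>v. \<Sum>c\<in>UNIV. v $ c * (f x * partial_deriv c g x + partial_deriv c f x * g x))) (at x)" .
qed

lemma iterated_partial_vanish:
  assumes "closed K" "\<And>x. x \<notin> K \<Longrightarrow> f x = 0"
  shows "x \<notin> K \<Longrightarrow> iterated_partial js f x = 0"
proof (induction js arbitrary: x)
  case (Cons c js)
  have "((\<lambda>x. 0) has_derivative (\<lambda>v. \<Sum>c\<in>UNIV. v $ c * 0)) (at x)" by simp
  then have "(iterated_partial js f has_derivative (\<lambda>v. \<Sum>c\<in>UNIV. v $ c * 0)) (at x)"
    by (rule has_derivative_transform_within_open[of _ _ _ _ "- K"]) (use assms Cons in \<open>auto simp: open_Compl\<close>)
  from partial_deriv_eq[OF this] show ?case by simp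
qed (use assms in simp)

lemma test_function_support:
  assumes "\<phi> \<in> test_functions \<Omega>"
  obtains K where "compact K" "K \<subseteq> \<Omega>" "\<And>js x. x \<notin> K \<Longrightarrow> iterated_partial js \<phi> x = 0"
proof (rule that[of "closure {x. \<phi> x \<noteq> 0}"])
  fix js x assume "x \<notin> closure {x. \<phi> x \<noteq> 0}"
  then show "iterated_partial js \<phi> x = 0"
    using closure_subset[of "{x. \<phi> x \<noteq> 0}"] by (intro iterated_partial_vanish[of "closure {x. \<phi> x \<noteq> 0}"]) auto
qed (use assms in \<open>auto simp: test_functions_def\<close>)

lemma test_functionsI:
  assumes "smooth \<phi>" "compact K" "K \<subseteq> \<Omega>" "\<And>x. x \<notin> K \<Longrightarrow> \<phi> x = 0"
  shows "\<phi> \<in> test_functions \<Omega>"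
proof -
  have sub: "closure {x. \<phi> x \<noteq> 0} \<subseteq> K"
    using assms by (intro closure_minimal compact_imp_closed) auto
  moreover have "compact (closure {x. \<phi> x \<noteq> 0})"
    using bounded_subset[OF compact_imp_bounded[OF assms(2)] sub] by (simp add: compact_eq_bounded_closed)
  ultimately show ?thesis using assms by (auto simp: test_functions_def smooth_def)
qed

lemma test_functions_iterated_partial:
  assumes "\<phi> \<in> test_functions \<Omega>"
  shows "iterated_partial js \<phi> \<in> test_functions \<Omega>"
proof -
  obtain K where K: "compact K" "K \<subseteq> \<Omega>" "\<And>js x. x \<notin> K \<Longrightarrow> iterated_partial js \<phi> x = 0"
    using test_function_support[OF assms] by blast
  then show ?thesis
    by (intro test_functionsI[of _ K] smooth_iterated_partial test_functions_smooth[OF assms])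
qed

lemma test_functions_diff:
  assumes "\<phi> \<in> test_functions \<Omega>" "\<psi> \<in> test_functions \<Omega>"
  shows "(\<lambda>x. \<phi> x - \<psi> x) \<in> test_functions \<Omega>"
proof -
  obtain K where K: "compact K" "K \<subseteq> \<Omega>" "\<And>js x. x \<notin> K \<Longrightarrow> iterated_partial js \<phi> x = 0"
    using test_function_support[OF assms(1)] by blast
  obtain K' where K': "compact K'" "K' \<subseteq> \<Omega>" "\<And>js x. x \<notin> K' \<Longrightarrow> iterated_partial js \<psi> x = 0"
    using test_function_support[OF assms(2)] by blast
  show ?thesis
    using K(3)[of _ "[]"] K'(3)[of _ "[]"] K(1,2) K'(1,2)
    by (intro test_functionsI[of _ "K \<union> K'"] smooth_diff test_functions_smooth[OF assms(1)]
        test_functions_smooth[OF assms(2)] compact_Un) auto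
qed

section \<open>Integration by parts\<close>

lemma integrable_compact_support:
  fixes f :: "'a::euclidean_space \<Rightarrow> real"
  assumes "continuous_on UNIV f" "compact K" "\<And>x. x \<notin> K \<Longrightarrow> f x = 0"
  shows "integrable lborel f"
proof -
  have "integrable lborel (\<lambda>x. indicator K x *\<^sub>R f x)"
    using assms by (intro borel_integrable_compact continuous_on_subset[OF assms(1)]) auto
  also have "(\<lambda>x. indicator K x *\<^sub>R f x) = f" using assms(3) by (auto simp: indicator_def fun_eq_iff)
  finally show ?thesis .
qed

lemma bounded_compact_support:
  fixes f :: "'a::euclidean_space \<Rightarrow> real"
  assumes "continuous_on UNIV f" "compact K" "\<And>x. x \<notin> K \<Longrightarrow> f x = 0"
  obtains B where "0 \<le> B" "\<And>x. \<bar>f x\<bar> \<le> B"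
proof -
  have "bounded (f ` K)"
    using assms by (intro compact_imp_bounded compact_continuous_image continuous_on_subset[OF assms(1)]) auto
  then obtain B where B: "\<And>x. x \<in> K \<Longrightarrow> \<bar>f x\<bar> \<le> B" unfolding bounded_iff by auto
  have "\<bar>f x\<bar> \<le> max B 0" for x using B[of x] assms(3)[of x] by (cases "x \<in> K") auto
  then show ?thesis using that[of "max B 0"] by simp
qed

text \<open>Translation invariance makes the integrals of all difference quotients vanish.\<close>

lemma integral_partial_deriv_eq_0:
  fixes f :: "real^'n::finite \<Rightarrow> real"
  assumes f: "\<And>x. f differentiable (at x)" and c: "continuous_on UNIV (partial_deriv c f)"
    and K: "compact K" "\<And>x. x \<notin> K \<Longrightarrow> f x = 0"
  shows "(LINT x|lborel. partial_deriv c f x) = 0"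
proof -
  let ?e = "axis c (1::real) :: real^'n"
  have cf: "continuous_on UNIV f"
    using f by (intro continuous_at_imp_continuous_on ballI differentiable_imp_continuous_within)
  have vanish: "partial_deriv c f x = 0" if "x \<notin> K" for x
    using iterated_partial_vanish[OF compact_imp_closed[OF K(1)] K(2) that, where js="[c]"] by simp
  obtain B where B: "0 \<le> B" "\<And>x. \<bar>partial_deriv c f x\<bar> \<le> B"
    using bounded_compact_support[OF c K(1) vanish] by blast
  obtain R where R: "\<And>x. x \<in> K \<Longrightarrow> norm x \<le> R" using compact_imp_bounded[OF K(1)] unfolding bounded_iff by auto
  have line: "((\<lambda>t. f (x + t *\<^sub>R ?e)) has_real_derivative partial_deriv c f (x + t *\<^sub>R ?e)) (at t)" for x t
  proof -
    have "((\<lambda>t. x + t *\<^sub>R ?e) has_derivative (\<lambda>h. h *\<^sub>R ?e)) (at t)" by (auto intro!: derivative_eq_intros)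
    from has_derivative_compose[OF this has_derivative_partial[OF f]]
    have "((\<lambda>t. f (x + t *\<^sub>R ?e)) has_derivative (\<lambda>h. \<Sum>d\<in>UNIV. (h *\<^sub>R ?e) $ d * partial_deriv d f (x + t *\<^sub>R ?e))) (at t)" .
    also have "(\<lambda>h. \<Sum>d\<in>UNIV. (h *\<^sub>R ?e) $ d * partial_deriv d f (x + t *\<^sub>R ?e)) = (\<lambda>h. h * partial_deriv c f (x + t *\<^sub>R ?e))"
      by (simp add: axis_def if_distrib[of "\<lambda>a. a * _"] if_distrib[of "\<lambda>a. _ * a"] fun_eq_iff cong: if_cong)
    finally show ?thesis by (simp add: has_field_derivative_def mult_commute_abs)
  qed
  define s where "s m = 1 / real (Suc m)" for m
  have s: "0 < s m" "s m \<le> 1" for m by (simp_all add: s_def)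
  define q where "q m x = (f (x + s m *\<^sub>R ?e) - f x) / s m" for m x
  \<comment> \<open>The mean value theorem bounds the difference quotients by the bound of the
    derivative; since \<open>s m \<le> 1\<close>, they vanish outside the ball of radius
    \<open>R + 1\<close>, which provides the integrable majorant.\<close>
  have qm: "\<bar>q m x\<bar> \<le> B * indicator (cball 0 (R + 1)) x" for m x
  proof (cases "x \<in> cball 0 (R + 1)")
    case True
    obtain z where "f (x + s m *\<^sub>R ?e) - f (x + 0 *\<^sub>R ?e) = (s m - 0) * partial_deriv c f (x + z *\<^sub>R ?e)"
      using MVT2[OF s(1)[of m], of "\<lambda>t. f (x + t *\<^sub>R ?e)" "\<lambda>t. partial_deriv c f (x + t *\<^sub>R ?e)"] line by blast
    then have "q m x = partial_deriv c f (x + z *\<^sub>R ?e)" using s(1)[of m] by (simp add: q_def)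
    then show ?thesis using B True by simp
  next
    case False
    then have n: "norm x > R + 1" by simp
    then have "x \<notin> K" using R by force
    moreover have "x + s m *\<^sub>R ?e \<notin> K"
    proof
      assume "x + s m *\<^sub>R ?e \<in> K"
      then have "norm (x + s m *\<^sub>R ?e) \<le> R" by (rule R)
      moreover have "norm x \<le> norm (x + s m *\<^sub>R ?e) + norm (s m *\<^sub>R ?e)"
        using norm_triangle_ineq4[of "x + s m *\<^sub>R ?e" "s m *\<^sub>R ?e"] by simp
      moreover have "norm (s m *\<^sub>R ?e) \<le> 1" using s[of m] by simp
      ultimately show False using n by linarith
    qed
    ultimately show ?thesis using K(2) False by (simp add: q_def)
  qed
  have lim: "(\<lambda>m. q m x) \<longlonglongrightarrow> partial_deriv c f x" for x
  proof -
    have "((\<lambda>h. (f (x + (0 + h) *\<^sub>R ?e) - f (x + 0 *\<^sub>R ?e)) / h) \<longlongrightarrow> partial_deriv c f (x + 0 *\<^sub>R ?e)) (at 0)"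
      using line[of x 0] unfolding DERIV_def .
    moreover have "filterlim s (at 0) sequentially"
    proof -
      have "s \<longlonglongrightarrow> 0" unfolding s_def using LIMSEQ_inverse_real_of_nat by (simp add: inverse_eq_divide)
      then show ?thesis using s by (simp add: filterlim_at less_imp_neq[symmetric])
    qed
    ultimately have "(\<lambda>m. (f (x + (0 + s m) *\<^sub>R ?e) - f (x + 0 *\<^sub>R ?e)) / s m) \<longlonglongrightarrow> partial_deriv c f (x + 0 *\<^sub>R ?e)"
      by (rule filterlim_compose)
    then show ?thesis by (simp add: q_def[abs_def])
  qed
  have int: "integrable lborel f" by (rule integrable_compact_support[OF cf K])
  have [measurable]: "f \<in> borel_measurable borel" "partial_deriv c f \<in> borel_measurable borel"
    using cf c by (auto intro: borel_measurable_continuous_onI)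
  have zero: "(LINT x|lborel. q m x) = 0" for m
  proof -
    have "(LINT x|lborel. f x) = (LINT x|distr lborel borel ((+) (s m *\<^sub>R ?e)). f x)"
      by (simp only: lborel_distr_plus)
    also have "\<dots> = (LINT x|lborel. f (s m *\<^sub>R ?e + x))" by (rule integral_distr) auto
    finally have eq: "(LINT x|lborel. f (x + s m *\<^sub>R ?e)) = (LINT x|lborel. f x)" by (simp add: add.commute)
    have "integrable (distr lborel borel ((+) (s m *\<^sub>R ?e))) f" using int by (simp only: lborel_distr_plus)
    then have "integrable lborel (\<lambda>x. f (s m *\<^sub>R ?e + x))" by (subst (asm) integrable_distr_eq) auto
    then have "integrable lborel (\<lambda>x. f (x + s m *\<^sub>R ?e))" by (simp add: add.commute)
    then show ?thesis unfolding q_def using int eq by simp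
  qed
  have "(\<lambda>m. LINT x|lborel. q m x) \<longlonglongrightarrow> (LINT x|lborel. partial_deriv c f x)"
  proof (rule integral_dominated_convergence)
    show "integrable lborel (\<lambda>x::real^'n. B * indicator (cball 0 (R + 1)) x)"
      by (intro integrable_mult_right integrable_real_indicator)
        (simp_all add: emeasure_bounded_finite[OF bounded_cball, simplified])
    show "q m \<in> borel_measurable lborel" for m unfolding q_def by measurable
  qed (use lim qm in auto)
  then show ?thesis using zero LIMSEQ_unique by (simp add: LIMSEQ_const_iff)
qed

text \<open>The product \<open>f x * g x\<close> inherits compact support from g, so the integral of
  its partial derivative is 0.\<close>

lemma integral_by_parts:
  fixes f g :: "real^'n::finite \<Rightarrow> real"
  assumes f: "smooth f" and g: "smooth g" and K: "compact K" "\<And>x. x \<notin> K \<Longrightarrow> g x = 0"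
  shows "(LINT x|lborel. f x * partial_deriv c g x) = - (LINT x|lborel. partial_deriv c f x * g x)"
proof -
  have d: "f differentiable (at x)" "g differentiable (at x)" for x using f g by (auto intro: smooth_differentiable)
  have pd: "partial_deriv c (\<lambda>x. f x * g x) = (\<lambda>x. f x * partial_deriv c g x + partial_deriv c f x * g x)"
    using d by (intro ext partial_deriv_mult)
  have v: "partial_deriv c g x = 0" if "x \<notin> K" for x
    using iterated_partial_vanish[OF compact_imp_closed[OF K(1)] K(2) that, where js="[c]"] by simp
  have cont: "continuous_on UNIV (\<lambda>x. f x * partial_deriv c g x)" "continuous_on UNIV (\<lambda>x. partial_deriv c f x * g x)"
    by (intro continuous_intros smooth_continuous_on smooth_partial_deriv f g)+
  have i: "integrable lborel (\<lambda>x. f x * partial_deriv c g x)" "integrable lborel (\<lambda>x. partial_deriv c f x * g x)"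
    using v K(2) by (auto intro!: integrable_compact_support[OF _ K(1)] cont)
  have "(LINT x|lborel. partial_deriv c (\<lambda>x. f x * g x) x) = 0"
  proof (rule integral_partial_deriv_eq_0[OF _ _ K(1)])
    show "(\<lambda>x. f x * g x) differentiable at x" for x using d by (intro differentiable_mult)
    show "continuous_on UNIV (partial_deriv c (\<lambda>x. f x * g x))"
      unfolding pd using cont by (intro continuous_on_add)
  qed (use K in auto)
  then show ?thesis unfolding pd using i by simp
qed

text \<open>Integrating by parts reverses the list of directions; with the reversed list the symmetry of
  mixed partial derivatives is not needed.\<close>

lemma integral_iterated_by_parts:
  fixes f g :: "real^'n::finite \<Rightarrow> real"
  assumes "smooth f" and g: "g \<in> test_functions \<Omega>"
  shows "(LINT x|lborel. f x * iterated_partial js g x)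
    = (-1) ^ length js * (LINT x|lborel. iterated_partial (rev js) f x * g x)"
  using assms(1)
proof (induction js arbitrary: f)
  case (Cons c js)
  obtain K where K: "compact K" "K \<subseteq> \<Omega>" "\<And>js x. x \<notin> K \<Longrightarrow> iterated_partial js g x = 0"
    using test_function_support[OF g] by blast
  have "(LINT x|lborel. f x * iterated_partial (c # js) g x) = - (LINT x|lborel. partial_deriv c f x * iterated_partial js g x)"
    using integral_by_parts[OF Cons.prems smooth_iterated_partial[OF test_functions_smooth[OF g]] K(1) K(3)] by simp
  also have "\<dots> = (-1) ^ length (c # js) * (LINT x|lborel. iterated_partial (rev js) (partial_deriv c f) x * g x)"
    using Cons.IH[OF smooth_partial_deriv[OF Cons.prems]] by simp
  finally show ?case by (simp add: iterated_partial_append)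
qed simp

lemma set_lebesgue_integral_eq_lborel:
  fixes f :: "'a::euclidean_space \<Rightarrow> real"
  assumes "f \<in> borel_measurable borel" "\<And>x. x \<notin> \<Omega> \<Longrightarrow> f x = 0"
  shows "(LINT x:\<Omega>|lebesgue. f x) = (LINT x|lborel. f x)"
proof -
  have "(LINT x:\<Omega>|lebesgue. f x) = (LINT x|lebesgue. f x)"
    unfolding set_lebesgue_integral_def
    by (intro Bochner_Integration.integral_cong) (use assms in \<open>auto simp: indicator_def\<close>)
  then show ?thesis using assms(1) by (simp add: integral_completion)
qed

lemma continuous_locally_integrable:
  fixes f :: "'a::euclidean_space \<Rightarrow> real"
  assumes "continuous_on UNIV f"
  shows "f locally_integrable_on \<Omega>"
  unfolding locally_integrable_on_def
proof safe
  fix K assume K: "compact K" "K \<subseteq> \<Omega>"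
  have "integrable lborel (\<lambda>x. indicator K x *\<^sub>R f x)"
    using K by (intro borel_integrable_compact continuous_on_subset[OF assms]) auto
  moreover have "(\<lambda>x. indicator K x *\<^sub>R f x) \<in> borel_measurable lborel"
    using calculation by (rule borel_measurable_integrable)
  ultimately show "f absolutely_integrable_on K"
    unfolding set_integrable_def by (simp add: integrable_completion)
qed

lemma has_weak_deriv_test_function:
  assumes "\<phi> \<in> test_functions \<Omega>"
  shows "has_weak_deriv \<Omega> js \<phi> (iterated_partial (rev js) \<phi>)"
proof -
  have sm: "smooth \<phi>" by (rule test_functions_smooth[OF assms])
  have "(LINT x:\<Omega>|lebesgue. \<phi> x * iterated_partial js \<psi> x)
    = (-1) ^ length js * (LINT x:\<Omega>|lebesgue. iterated_partial (rev js) \<phi> x * \<psi> x)"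
    if \<psi>: "\<psi> \<in> test_functions \<Omega>" for \<psi>
  proof -
    have s: "smooth \<psi>" by (rule test_functions_smooth[OF \<psi>])
    obtain K where K: "compact K" "K \<subseteq> \<Omega>" "\<And>js x. x \<notin> K \<Longrightarrow> iterated_partial js \<psi> x = 0"
      using test_function_support[OF \<psi>] by blast
    have z: "iterated_partial js \<psi> x = 0" "\<psi> x = 0" if "x \<notin> \<Omega>" for x
      using K(2) K(3)[of x] K(3)[of x "[]"] that by auto
    have [measurable]: "\<phi> \<in> borel_measurable borel" "\<psi> \<in> borel_measurable borel"
      "iterated_partial js \<psi> \<in> borel_measurable borel" "iterated_partial (rev js) \<phi> \<in> borel_measurable borel"
      using sm s by (auto intro!: smooth_borel_measurable smooth_iterated_partial)
    have "(LINT x:\<Omega>|lebesgue. \<phi> x * iterated_partial js \<psi> x) = (LINT x|lborel. \<phi> x * iterated_partial js \<psi> x)"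
      using z by (intro set_lebesgue_integral_eq_lborel) auto
    moreover have "(LINT x:\<Omega>|lebesgue. iterated_partial (rev js) \<phi> x * \<psi> x) = (LINT x|lborel. iterated_partial (rev js) \<phi> x * \<psi> x)"
      using z by (intro set_lebesgue_integral_eq_lborel) auto
    ultimately show ?thesis using integral_iterated_by_parts[OF sm \<psi>, of js] by simp
  qed
  then show ?thesis unfolding has_weak_deriv_def
    by (auto intro!: continuous_locally_integrable smooth_continuous_on smooth_iterated_partial sm)
qed

text \<open>The integrals in the definition of a weak derivative can be subtracted only when both
  products are integrable; the compact support of \<psi> provides this from local
  integrability.\<close>

lemma set_integrable_mult_test:
  assumes u: "u locally_integrable_on \<Omega>" and \<psi>: "\<psi> \<in> test_functions \<Omega>"
  shows "set_integrable lebesgue \<Omega> (\<lambda>x. u x * \<psi> x)"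
proof -
  obtain K where K: "compact K" "K \<subseteq> \<Omega>" "\<And>js x. x \<notin> K \<Longrightarrow> iterated_partial js \<psi> x = 0"
    using test_function_support[OF \<psi>] by blast
  have z: "\<psi> x = 0" if "x \<notin> K" for x using K(3)[OF that, of "[]"] by simp
  have s: "smooth \<psi>" by (rule test_functions_smooth[OF \<psi>])
  obtain B where B: "0 \<le> B" "\<And>x. \<bar>\<psi> x\<bar> \<le> B"
    using bounded_compact_support[OF smooth_continuous_on[OF s] K(1) z] by blast
  have uK: "integrable lebesgue (\<lambda>x. indicator K x *\<^sub>R u x)"
    using u K unfolding locally_integrable_on_def set_integrable_def by blast
  have "\<psi> \<in> borel_measurable lborel" using smooth_borel_measurable[OF s] by simp
  then have m: "\<psi> \<in> borel_measurable lebesgue" by (rule measurable_completion)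
  have "integrable lebesgue (\<lambda>x. (indicator K x *\<^sub>R u x) * \<psi> x)"
  proof (rule Bochner_Integration.integrable_bound)
    show "integrable lebesgue (\<lambda>x. B * (indicator K x *\<^sub>R u x))" using uK by simp
    show "(\<lambda>x. (indicator K x *\<^sub>R u x) * \<psi> x) \<in> borel_measurable lebesgue"
      using borel_measurable_integrable[OF uK] m by (rule borel_measurable_times)
    show "AE x in lebesgue. norm ((indicator K x *\<^sub>R u x) * \<psi> x) \<le> norm (B * (indicator K x *\<^sub>R u x))"
    proof (rule AE_I2)
      fix x
      have "\<bar>\<psi> x\<bar> * \<bar>indicator K x *\<^sub>R u x\<bar> \<le> B * \<bar>indicator K x *\<^sub>R u x\<bar>"
        by (rule mult_right_mono[OF B(2)]) simp
      then show "norm ((indicator K x *\<^sub>R u x) * \<psi> x) \<le> norm (B * (indicator K x *\<^sub>R u x))"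
        unfolding real_norm_def abs_mult[of _ "\<psi> x"] abs_mult[of B] abs_of_nonneg[OF B(1)]
        by (simp only: mult.commute)
    qed
  qed
  also have "(\<lambda>x. (indicator K x *\<^sub>R u x) * \<psi> x) = (\<lambda>x. indicator \<Omega> x *\<^sub>R (u x * \<psi> x))"
    using z K(2) by (auto simp: fun_eq_iff indicator_def)
  finally show ?thesis unfolding set_integrable_def .
qed

lemma locally_integrable_diff:
  "u locally_integrable_on \<Omega> \<Longrightarrow> v locally_integrable_on \<Omega> \<Longrightarrow> (\<lambda>x. u x - v x) locally_integrable_on \<Omega>"
  unfolding locally_integrable_on_def by (auto intro: set_integral_diff)

lemma has_weak_deriv_diff:
  assumes "has_weak_deriv \<Omega> js u v" "has_weak_deriv \<Omega> js u' v'"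
  shows "has_weak_deriv \<Omega> js (\<lambda>x. u x - u' x) (\<lambda>x. v x - v' x)"
proof -
  have li: "u locally_integrable_on \<Omega>" "v locally_integrable_on \<Omega>" "u' locally_integrable_on \<Omega>" "v' locally_integrable_on \<Omega>"
    using assms by (auto simp: has_weak_deriv_def)
  have "(LINT x:\<Omega>|lebesgue. (u x - u' x) * iterated_partial js \<phi> x) =
        (-1) ^ length js * (LINT x:\<Omega>|lebesgue. (v x - v' x) * \<phi> x)" if \<phi>: "\<phi> \<in> test_functions \<Omega>" for \<phi>
  proof -
    have e: "(LINT x:\<Omega>|lebesgue. u x * iterated_partial js \<phi> x) = (-1) ^ length js * (LINT x:\<Omega>|lebesgue. v x * \<phi> x)"
      "(LINT x:\<Omega>|lebesgue. u' x * iterated_partial js \<phi> x) = (-1) ^ length js * (LINT x:\<Omega>|lebesgue. v' x * \<phi> x)"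
      using assms \<phi> unfolding has_weak_deriv_def by blast+
    note i = set_integrable_mult_test[OF li(1) test_functions_iterated_partial[OF \<phi>, of js]]
      set_integrable_mult_test[OF li(3) test_functions_iterated_partial[OF \<phi>, of js]]
      set_integrable_mult_test[OF li(2) \<phi>] set_integrable_mult_test[OF li(4) \<phi>]
    show ?thesis unfolding left_diff_distrib set_integral_diff(2)[OF i(1,2)] set_integral_diff(2)[OF i(3,4)] e
      by (simp add: right_diff_distrib)
  qed
  then show ?thesis unfolding has_weak_deriv_def using locally_integrable_diff li by blast
qed

section \<open>Smooth bump functions\<close>

definition flat :: "real poly \<Rightarrow> real \<Rightarrow> real" where
  "flat p t = (if 0 < t then poly p (1 / t) * exp (- 1 / t) else 0)"

lemma poly_div_exp_tendsto_0: "((\<lambda>x. poly p x / exp x) \<longlongrightarrow> (0::real)) at_top"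
proof -
  have "((\<lambda>x. \<Sum>i\<le>degree p. coeff p i * (x ^ i / exp x)) \<longlongrightarrow> (\<Sum>i\<le>degree p. coeff p i * 0)) at_top"
    by (intro tendsto_sum tendsto_mult tendsto_const tendsto_power_div_exp_0)
  moreover have "(\<Sum>i\<le>degree p. coeff p i * (x ^ i / exp x)) = poly p x / exp x" for x
    by (simp add: poly_altdef sum_divide_distrib)
  ultimately show ?thesis by simp
qed

lemma flat_right_limit:
  fixes p :: "real poly"
  shows "((\<lambda>t. poly p (1 / t) * exp (- 1 / t)) \<longlongrightarrow> 0) (at_right 0)"
proof -
  have "((\<lambda>t. poly p (inverse t) / exp (inverse t)) \<longlongrightarrow> 0) (at_right (0::real))"
    using filterlim_compose[OF poly_div_exp_tendsto_0[of p] filterlim_inverse_at_top_right] .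
  moreover have "poly p (inverse t) / exp (inverse t) = poly p (1 / t) * exp (- 1 / t)" for t
    by (simp add: exp_minus inverse_eq_divide)
  ultimately show ?thesis by (simp only:)
qed

text \<open>With p' the derivative of p, differentiating \<open>p(1/t) * exp (- 1/t)\<close> gives
  \<open>(1/t)^2 * (p - p')(1/t) * exp (- 1/t)\<close>, which is of the same form; the polynomial
  parameter closes the family under differentiation. For \<open>t > 0\<close>,
  \<open>flat 1 t\<close> is the classical function \<open>exp (- 1/t)\<close>.\<close>

lemma flat_has_derivative:
  "(flat p has_real_derivative flat ([:0, 0, 1:] * (p - pderiv p)) t) (at t)"
proof -
  consider "t < 0" | "t = 0" | "0 < t" by linarith
  then show ?thesis
  proof cases
    case 1
    have "((\<lambda>_. 0) has_real_derivative 0) (at t)" by simp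
    then have "(flat p has_real_derivative 0) (at t)"
      by (rule has_field_derivative_transform_within_open[of _ _ _ "{..<0}"]) (use 1 in \<open>auto simp: flat_def\<close>)
    then show ?thesis using 1 by (simp add: flat_def)
  next
    case 3
    have "((\<lambda>t. poly p (1 / t) * exp (- 1 / t)) has_real_derivative
        poly (pderiv p) (1 / t) * (- 1 / t\<^sup>2) * exp (- 1 / t) + poly p (1 / t) * (exp (- 1 / t) * (1 / t\<^sup>2))) (at t)"
      using 3 by (auto intro!: derivative_eq_intros simp: power2_eq_square)
    also have "poly (pderiv p) (1 / t) * (- 1 / t\<^sup>2) * exp (- 1 / t) + poly p (1 / t) * (exp (- 1 / t) * (1 / t\<^sup>2))
      = flat ([:0, 0, 1:] * (p - pderiv p)) t"
      using 3 by (simp add: flat_def power2_eq_square algebra_simps)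
    finally show ?thesis
      by (rule has_field_derivative_transform_within_open[of _ _ _ "{0<..}"]) (use 3 in \<open>auto simp: flat_def\<close>)
  next
    case 2
    have "((\<lambda>h. flat p h / h) \<longlongrightarrow> 0) (at 0)"
    proof (rule filterlim_split_at)
      show "((\<lambda>h. flat p h / h) \<longlongrightarrow> 0) (at_left 0)"
        by (rule tendsto_eventually) (auto simp: eventually_at_filter flat_def)
      \<comment> \<open>From the right, the difference quotient at 0 is itself a flat function, for
        the polynomial \<open>x * p(x)\<close>, and so tends to 0.\<close>
      have "((\<lambda>t. poly ([:0, 1:] * p) (1 / t) * exp (- 1 / t)) \<longlongrightarrow> 0) (at_right 0)"
        by (rule flat_right_limit)
      then show "((\<lambda>h. flat p h / h) \<longlongrightarrow> 0) (at_right 0)"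
        by (rule Lim_transform_eventually) (auto simp: eventually_at_filter flat_def)
    qed
    then show ?thesis using 2 by (simp add: DERIV_def flat_def)
  qed
qed

text \<open>Closed under partial derivatives; this is how the bumps below are seen to be smooth.\<close>

inductive elementary :: "(real^'n::finite \<Rightarrow> real) \<Rightarrow> bool" where
  base: "elementary (\<lambda>x. flat p (\<alpha> * x $ c + \<beta>))"
| const: "elementary (\<lambda>x. a)"
| add: "elementary f \<Longrightarrow> elementary g \<Longrightarrow> elementary (\<lambda>x. f x + g x)"
| mult: "elementary f \<Longrightarrow> elementary g \<Longrightarrow> elementary (\<lambda>x. f x * g x)"

lemma elementary_derivative:
  fixes f :: "real^'n::finite \<Rightarrow> real"
  assumes "elementary f"
  shows "\<exists>D. (\<forall>x. (f has_derivative (\<lambda>v. \<Sum>c\<in>UNIV. v $ c * D c x)) (at x)) \<and> (\<forall>c. elementary (D c))"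
  using assms
proof induction
  case (base p \<alpha> c \<beta>)
  let ?q = "[:0, 0, 1:] * (p - pderiv p)"
  define D where "D d x = (if d = c then \<alpha> * flat ?q (\<alpha> * x $ c + \<beta>) else 0)" for d and x :: "real^'n"
  have "((\<lambda>x. flat p (\<alpha> * x $ c + \<beta>)) has_derivative (\<lambda>v. \<Sum>d\<in>UNIV. v $ d * D d x)) (at x)" for x
  proof -
    have lin: "((\<lambda>x::real^'n. \<alpha> * x $ c + \<beta>) has_derivative (\<lambda>v. \<alpha> * v $ c)) (at x)"
      by (auto intro!: derivative_eq_intros bounded_linear_imp_has_derivative bounded_linear_vec_nth)
    have "((\<lambda>x. flat p (\<alpha> * x $ c + \<beta>)) has_derivative (\<lambda>v. flat ?q (\<alpha> * x $ c + \<beta>) * (\<alpha> * v $ c))) (at x)"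
      by (rule has_derivative_compose[OF lin flat_has_derivative[unfolded has_field_derivative_def]])
    also have "(\<lambda>v. flat ?q (\<alpha> * x $ c + \<beta>) * (\<alpha> * v $ c)) = (\<lambda>v. \<Sum>d\<in>UNIV. v $ d * D d x)"
      by (simp add: D_def if_distrib[of "\<lambda>a. _ * a"] mult_ac cong: if_cong)
    finally show ?thesis .
  qed
  moreover have "elementary (D d)" for d
    unfolding D_def by (cases "d = c") (simp_all add: elementary.intros del: mult_pCons_left)
  ultimately show ?case by blast
next
  case (const a)
  have "((\<lambda>x::real^'n. a) has_derivative (\<lambda>v. \<Sum>c\<in>UNIV. v $ c * 0)) (at x)" for x by simp
  then show ?case using elementary.const[of 0] by (intro exI[of _ "\<lambda>c x. 0"]) simp
next
  case (add f g)
  then obtain D E where D: "\<And>x. (f has_derivative (\<lambda>v. \<Sum>c\<in>UNIV. v $ c * D c x)) (at x)" "\<And>c. elementary (D c)"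
    and E: "\<And>x. (g has_derivative (\<lambda>v. \<Sum>c\<in>UNIV. v $ c * E c x)) (at x)" "\<And>c. elementary (E c)" by blast
  have "((\<lambda>x. f x + g x) has_derivative (\<lambda>v. \<Sum>c\<in>UNIV. v $ c * (D c x + E c x))) (at x)" for x
    using has_derivative_add[OF D(1) E(1), of x] by (simp add: distrib_left sum.distrib)
  moreover have "elementary (\<lambda>x. D c x + E c x)" for c by (rule elementary.add[OF D(2) E(2)])
  ultimately show ?case by (intro exI[of _ "\<lambda>c x. D c x + E c x"]) simp
next
  case (mult f g)
  then obtain D E where D: "\<And>x. (f has_derivative (\<lambda>v. \<Sum>c\<in>UNIV. v $ c * D c x)) (at x)" "\<And>c. elementary (D c)"
    and E: "\<And>x. (g has_derivative (\<lambda>v. \<Sum>c\<in>UNIV. v $ c * E c x)) (at x)" "\<And>c. elementary (E c)" by blast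
  have "((\<lambda>x. f x * g x) has_derivative (\<lambda>v. \<Sum>c\<in>UNIV. v $ c * (f x * E c x + D c x * g x))) (at x)" for x
  proof -
    have "(\<lambda>v. \<Sum>c\<in>UNIV. v $ c * (f x * E c x + D c x * g x))
      = (\<lambda>v. f x * (\<Sum>c\<in>UNIV. v $ c * E c x) + (\<Sum>c\<in>UNIV. v $ c * D c x) * g x)"
      by (simp add: fun_eq_iff sum_distrib_left sum_distrib_right sum.distrib[symmetric] algebra_simps)
    then show ?thesis using has_derivative_mult[OF D(1) E(1), of x] by simp
  qed
  moreover have "elementary (\<lambda>x. f x * E c x + D c x * g x)" for c
    by (intro elementary.add elementary.mult mult.hyps D(2) E(2))
  ultimately show ?case by (intro exI[of _ "\<lambda>c x. f x * E c x + D c x * g x"]) simp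
qed

lemma elementary_smooth:
  assumes "elementary f"
  shows "smooth f"
proof -
  have "elementary (iterated_partial js f)" for js
  proof (induction js)
    case (Cons c js)
    then obtain D where D: "\<And>x. (iterated_partial js f has_derivative (\<lambda>v. \<Sum>c\<in>UNIV. v $ c * D c x)) (at x)"
      "\<And>c. elementary (D c)" using elementary_derivative by blast
    have "partial_deriv c (iterated_partial js f) = D c" by (rule ext) (rule partial_deriv_eq[OF D(1)])
    then show ?case using D(2) by simp
  qed (use assms in simp)
  then show ?thesis unfolding smooth_def using elementary_derivative differentiable_def by blast
qed

lemma elementary_prod: "finite I \<Longrightarrow> (\<And>i. i \<in> I \<Longrightarrow> elementary (f i)) \<Longrightarrow> elementary (\<lambda>x. \<Prod>i\<in>I. f i x)"
proof (induction I rule: finite_induct)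
  case empty
  then show ?case using elementary.const[of 1] by simp
next
  case (insert i I)
  then show ?case using elementary.mult[of "f i" "\<lambda>x. \<Prod>i\<in>I. f i x"] by simp
qed

text \<open>The argument is scaled, not the height: as m grows each factor tends to 1 on the open
  box, so the bumps tend boundedly to its indicator. This is all that the fundamental lemma
  needs.\<close>

definition bump :: "real^'n::finite \<Rightarrow> real^'n \<Rightarrow> nat \<Rightarrow> real^'n \<Rightarrow> real" where
  "bump a b m x = (\<Prod>c\<in>UNIV. flat 1 (real (Suc m) * (x $ c - a $ c)) * flat 1 (real (Suc m) * (b $ c - x $ c)))"

lemma elementary_bump:
  fixes a b :: "real^'n::finite"
  shows "elementary (bump a b m)"
proof -
  have "elementary (\<lambda>x::real^'n. flat 1 (real (Suc m) * (x $ c - a $ c)))" for c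
    using elementary.base[of 1 "real (Suc m)" c "- real (Suc m) * a $ c"] by (simp add: algebra_simps del: of_nat_Suc)
  moreover have "elementary (\<lambda>x::real^'n. flat 1 (real (Suc m) * (b $ c - x $ c)))" for c
    using elementary.base[of 1 "- real (Suc m)" c "real (Suc m) * b $ c"]
    by (simp add: algebra_simps del: of_nat_Suc)
  ultimately show ?thesis unfolding bump_def[abs_def]
    by (intro elementary_prod elementary.mult) auto
qed

lemma flat_bounds: "0 \<le> flat 1 t" "flat 1 t \<le> 1"
  by (auto simp: flat_def)

lemma bump_bounds: "0 \<le> bump a b m x" "bump a b m x \<le> 1"
proof -
  have f: "0 \<le> flat 1 s * flat 1 t \<and> flat 1 s * flat 1 t \<le> 1" for s t
    using mult_le_one[OF flat_bounds(2)[of s] flat_bounds(1)[of t] flat_bounds(2)[of t]]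
    by (simp add: flat_bounds(1))
  show "0 \<le> bump a b m x" unfolding bump_def using f by (intro prod_nonneg) blast
  show "bump a b m x \<le> 1" unfolding bump_def using f by (intro prod_le_1) blast
qed

lemma bump_eq_0: "x \<notin> box a b \<Longrightarrow> bump a b m x = 0"
proof -
  assume "x \<notin> box a b"
  then obtain c where "x $ c - a $ c \<le> 0 \<or> b $ c - x $ c \<le> 0" by (auto simp: mem_box_cart not_less)
  then have "flat 1 (real (Suc m) * (x $ c - a $ c)) * flat 1 (real (Suc m) * (b $ c - x $ c)) = 0"
    by (auto simp: flat_def zero_less_mult_iff)
  then show ?thesis unfolding bump_def by (subst prod_zero_iff) auto
qed

lemma flat_tendsto_1:
  assumes "0 < t"
  shows "(\<lambda>m. flat 1 (real (Suc m) * t)) \<longlonglongrightarrow> 1"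
proof -
  have "(\<lambda>m. exp (- (inverse (real (Suc m)) * (1 / t)))) \<longlonglongrightarrow> exp (- (0 * (1 / t)))"
    by (intro tendsto_intros LIMSEQ_inverse_real_of_nat)
  moreover have "exp (- (inverse (real (Suc m)) * (1 / t))) = flat 1 (real (Suc m) * t)" for m
    using assms by (simp add: flat_def inverse_eq_divide del: of_nat_Suc)
  ultimately show ?thesis by simp
qed

lemma bump_tendsto:
  fixes a b :: "real^'n::finite"
  shows "(\<lambda>m. bump a b m x) \<longlonglongrightarrow> indicator (box a b) x"
proof (cases "x \<in> box a b")
  case True
  then have "(\<lambda>m. bump a b m x) \<longlonglongrightarrow> (\<Prod>c\<in>(UNIV::'n set). 1 * 1)"
    unfolding bump_def by (intro tendsto_prod tendsto_mult flat_tendsto_1) (auto simp: mem_box_cart)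
  then show ?thesis using True by simp
qed (simp add: bump_eq_0)

lemma bump_test_function:
  assumes "cbox a b \<subseteq> \<Omega>"
  shows "bump a b m \<in> test_functions \<Omega>"
proof (rule test_functionsI[OF elementary_smooth[OF elementary_bump] compact_cbox assms])
  fix x assume "x \<notin> cbox a b"
  then have "x \<notin> box a b" using box_subset_cbox by blast
  then show "bump a b m x = 0" by (rule bump_eq_0)
qed

section \<open>The fundamental lemma and the uniqueness of weak derivatives\<close>

lemma integral_box_eq_0:
  assumes w: "w locally_integrable_on \<Omega>"
    and 0: "\<And>\<phi>. \<phi> \<in> test_functions \<Omega> \<Longrightarrow> (LINT x:\<Omega>|lebesgue. w x * \<phi> x) = 0"
    and sub: "cbox a b \<subseteq> \<Omega>"
  shows "(LINT x:box a b|lebesgue. w x) = 0"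
proof -
  have int: "integrable lebesgue (\<lambda>x. indicator (cbox a b) x *\<^sub>R w x)"
    using w sub unfolding locally_integrable_on_def set_integrable_def by (metis compact_cbox)
  have box: "indicator (cbox a b) x * indicator (box a b) x = (indicator (box a b) x :: real)" for x
    using box_subset_cbox[of a b] by (auto simp: indicator_def)
  have "(\<lambda>m. LINT x|lebesgue. (indicator (cbox a b) x *\<^sub>R w x) * bump a b m x)
    \<longlonglongrightarrow> (LINT x|lebesgue. (indicator (cbox a b) x *\<^sub>R w x) * indicator (box a b) x)"
  proof (rule integral_dominated_convergence)
    show "integrable lebesgue (\<lambda>x. norm (indicator (cbox a b) x *\<^sub>R w x))" using int by (rule integrable_norm)
    have "bump a b m \<in> borel_measurable lborel" for m
      using smooth_borel_measurable[OF elementary_smooth[OF elementary_bump]] by simp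
    then have m: "bump a b m \<in> borel_measurable lebesgue" for m by (rule measurable_completion)
    show "(\<lambda>x. (indicator (cbox a b) x *\<^sub>R w x) * bump a b m x) \<in> borel_measurable lebesgue" for m
      using borel_measurable_integrable[OF int] m by (rule borel_measurable_times)
    show "(\<lambda>x. (indicator (cbox a b) x *\<^sub>R w x) * indicator (box a b) x) \<in> borel_measurable lebesgue"
      by (intro borel_measurable_times borel_measurable_integrable[OF int] borel_measurable_indicator) simp
    show "AE x in lebesgue. (\<lambda>m. (indicator (cbox a b) x *\<^sub>R w x) * bump a b m x)
        \<longlonglongrightarrow> (indicator (cbox a b) x *\<^sub>R w x) * indicator (box a b) x"
      by (intro AE_I2 tendsto_mult tendsto_const bump_tendsto)
    show "AE x in lebesgue. norm ((indicator (cbox a b) x *\<^sub>R w x) * bump a b m x) \<le> norm (indicator (cbox a b) x *\<^sub>R w x)" for m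
    proof (rule AE_I2)
      fix x
      show "norm ((indicator (cbox a b) x *\<^sub>R w x) * bump a b m x) \<le> norm (indicator (cbox a b) x *\<^sub>R w x)"
        unfolding norm_mult[of _ "bump a b m x"] using bump_bounds[of a b m x] by (intro mult_left_le) auto
    qed
  qed
  moreover have "(LINT x|lebesgue. (indicator (cbox a b) x *\<^sub>R w x) * bump a b m x) = 0" for m
  proof -
    have eq: "(indicator (cbox a b) x *\<^sub>R w x) * bump a b m x = indicator \<Omega> x *\<^sub>R (w x * bump a b m x)" for x
      using sub bump_eq_0[of x a b m] box_subset_cbox[of a b] by (auto simp: indicator_def)
    show ?thesis unfolding eq using 0[OF bump_test_function[OF sub, of m]] by (simp only: set_lebesgue_integral_def)
  qed
  ultimately have "(LINT x|lebesgue. (indicator (cbox a b) x *\<^sub>R w x) * indicator (box a b) x) = 0"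
    by (simp add: LIMSEQ_const_iff)
  moreover have eq: "(indicator (cbox a b) x *\<^sub>R w x) * indicator (box a b) x = indicator (box a b) x *\<^sub>R w x" for x
    using box_subset_cbox[of a b] by (auto simp: indicator_def)
  ultimately show ?thesis unfolding eq set_lebesgue_integral_def by blast
qed

text \<open>The measures with densities the positive and the negative part of g agree on open boxes,
  which are stable under intersection and generate the Borel sets, so they are equal. On the set
  where \<open>g > 0\<close> the second one vanishes, hence so does the first.\<close>

lemma AE_nonpos_of_box_integrals:
  fixes g :: "'a::euclidean_space \<Rightarrow> real"
  assumes g: "integrable lborel g" and box: "\<And>c d. (LINT x|lborel. g x * indicator (box c d) x) = 0"
  shows "AE x in lborel. g x \<le> 0"
proof -
  have [measurable]: "g \<in> borel_measurable borel" using g by (simp add: borel_measurable_integrable measurable_lborel1)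
  let ?M = "density lborel (\<lambda>x. ennreal (max 0 (g x)))" and ?N = "density lborel (\<lambda>x. ennreal (max 0 (- g x)))"
  have int: "integrable lborel (\<lambda>x. max 0 (g x) * indicator A x)" "integrable lborel (\<lambda>x. max 0 (- g x) * indicator A x)"
    if [measurable]: "A \<in> sets borel" for A
    by (rule Bochner_Integration.integrable_bound[OF g]; auto simp: indicator_def)+
  have em: "emeasure ?M A = ennreal (LINT x|lborel. max 0 (g x) * indicator A x)"
    "emeasure ?N A = ennreal (LINT x|lborel. max 0 (- g x) * indicator A x)"
    if [measurable]: "A \<in> sets borel" for A
  proof -
    have "emeasure ?M A = (\<integral>\<^sup>+x. ennreal (max 0 (g x) * indicator A x) \<partial>lborel)"
      by (subst emeasure_density) (auto intro!: nn_integral_cong simp: indicator_def)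
    also have "\<dots> = ennreal (LINT x|lborel. max 0 (g x) * indicator A x)"
      by (intro nn_integral_eq_integral int) auto
    finally show "emeasure ?M A = ennreal (LINT x|lborel. max 0 (g x) * indicator A x)" .
    have "emeasure ?N A = (\<integral>\<^sup>+x. ennreal (max 0 (- g x) * indicator A x) \<partial>lborel)"
      by (subst emeasure_density) (auto intro!: nn_integral_cong simp: indicator_def)
    also have "\<dots> = ennreal (LINT x|lborel. max 0 (- g x) * indicator A x)"
      by (intro nn_integral_eq_integral int) auto
    finally show "emeasure ?N A = ennreal (LINT x|lborel. max 0 (- g x) * indicator A x)" .
  qed
  have "?M = ?N"
  proof (rule measure_eqI_generator_eq)
    let ?E = "range (\<lambda>(a, b). box a b :: 'a set)"
    show "Int_stable ?E"
      by (auto simp: Int_stable_def box_Int_box)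
    show "?E \<subseteq> Pow UNIV" by simp
    show "sets ?M = sigma_sets UNIV ?E" "sets ?N = sigma_sets UNIV ?E"
      by (simp_all add: borel_eq_box)
    show "emeasure ?M X = emeasure ?N X" if "X \<in> ?E" for X
    proof -
      obtain c d where X: "X = box c d" using \<open>X \<in> ?E\<close> by auto
      have "(LINT x|lborel. max 0 (g x) * indicator X x) - (LINT x|lborel. max 0 (- g x) * indicator X x)
        = (LINT x|lborel. max 0 (g x) * indicator X x - max 0 (- g x) * indicator X x)"
        using int[of X] by (simp add: X)
      also have "\<dots> = (LINT x|lborel. g x * indicator X x)"
        by (intro Bochner_Integration.integral_cong) (auto simp: indicator_def)
      finally have "(LINT x|lborel. max 0 (g x) * indicator X x) = (LINT x|lborel. max 0 (- g x) * indicator X x)"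
        using box[of c d] by (simp add: X)
      then show ?thesis using em[of X] by (simp add: X)
    qed
    show "range (\<lambda>n::nat. box (- (real n *\<^sub>R One)) (real n *\<^sub>R One)) \<subseteq> ?E" by auto
    show "(\<Union>n::nat. box (- (real n *\<^sub>R One)) (real n *\<^sub>R One)) = (UNIV :: 'a set)" by (rule UN_box_eq_UNIV)
    show "emeasure ?M (box (- (real n *\<^sub>R One)) (real n *\<^sub>R One)) \<noteq> \<infinity>" for n by (subst em) auto
  qed
  then have "emeasure ?M {x. 0 < g x} = emeasure ?N {x. 0 < g x}" by simp
  also have "\<dots> = (\<integral>\<^sup>+x\<in>{x. 0 < g x}. ennreal (max 0 (- g x)) \<partial>lborel)"
    by (rule emeasure_density) auto
  also have "\<dots> = (\<integral>\<^sup>+x. 0 \<partial>(lborel :: 'a measure))"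
    by (intro nn_integral_cong) (simp add: indicator_def max_def)
  finally have "(\<integral>\<^sup>+x. ennreal (max 0 (g x)) * indicator {x. 0 < g x} x \<partial>lborel) = 0"
    by (subst (asm) emeasure_density) auto
  then have "AE x in lborel. ennreal (max 0 (g x)) * indicator {x. 0 < g x} x = 0"
    by (subst (asm) nn_integral_0_iff_AE) auto
  then show ?thesis
    by eventually_elim (auto simp: indicator_def max_def split: if_splits)
qed

text \<open>The argument is local: for each closed box in \<Omega>, the restriction of w to the open
  box has a Borel version whose integrals over all boxes vanish. Countably many closed boxes exhaust
  \<Omega>, and their boundaries are negligible.\<close>

lemma fundamental_lemma:
  fixes w :: "real^'n::finite \<Rightarrow> real"
  assumes \<Omega>: "open \<Omega>" and w: "w locally_integrable_on \<Omega>"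
    and 0: "\<And>\<phi>. \<phi> \<in> test_functions \<Omega> \<Longrightarrow> (LINT x:\<Omega>|lebesgue. w x * \<phi> x) = 0"
  shows "AE x in lebesgue. x \<in> \<Omega> \<longrightarrow> w x = 0"
proof -
  have one: "AE x in lebesgue. x \<in> box a b \<longrightarrow> w x = 0" if sub: "cbox a b \<subseteq> \<Omega>" for a b
  proof -
    let ?f = "\<lambda>x. indicator (box a b) x *\<^sub>R w x"
    have "integrable lebesgue (\<lambda>x. indicator (cbox a b) x *\<^sub>R w x)"
      using w sub unfolding locally_integrable_on_def set_integrable_def by (metis compact_cbox)
    then have "set_integrable lebesgue (cbox a b) w" by (simp add: set_integrable_def)
    then have "set_integrable lebesgue (box a b) w"
      by (rule set_integrable_subset) (simp, rule box_subset_cbox)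
    then have int: "integrable lebesgue ?f" by (simp add: set_integrable_def)
    obtain g where g: "g \<in> borel_measurable lborel" "AE x in lborel. ?f x = g x"
      using completion_ex_borel_measurable_real[OF borel_measurable_integrable[OF int]] by blast
    have gc: "AE x in lebesgue. ?f x = g x" by (rule AE_completion[OF g(2)])
    have gm: "g \<in> borel_measurable lebesgue" by (rule measurable_completion[OF g(1)])
    have "integrable lebesgue g"
      using int gc by (subst integrable_cong_AE[symmetric, OF borel_measurable_integrable[OF int] gm gc])
    then have gi: "integrable lborel g" using g(1) by (simp add: integrable_completion)
    have box: "(LINT x|lborel. g x * indicator (box c d) x) = 0" for c d
    proof -
      have "(LINT x|lborel. g x * indicator (box c d) x) = (LINT x|lebesgue. g x * indicator (box c d) x)"
        using g(1) by (subst integral_completion) auto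
      also have "\<dots> = (LINT x|lebesgue. ?f x * indicator (box c d) x)"
      proof (rule integral_cong_AE)
        show "AE x in lebesgue. g x * indicator (box c d) x = ?f x * indicator (box c d) x"
          using gc by eventually_elim simp
      qed (intro borel_measurable_times gm borel_measurable_integrable[OF int] borel_measurable_indicator, simp)+
      also have "\<dots> = (LINT x:box a b \<inter> box c d|lebesgue. w x)"
        unfolding set_lebesgue_integral_def
        by (intro Bochner_Integration.integral_cong) (auto simp: indicator_def)
      also have "\<dots> = 0"
      proof -
        obtain c' d' where eq: "box a b \<inter> box c d = box c' d'" using box_Int_box[of a b c d] by blast
        show ?thesis
        proof (cases "box c' d' = {}")
          case True
          then show ?thesis unfolding eq by (simp add: set_lebesgue_integral_def)
        next
          case False
          \<comment> \<open>The bumps need the closed box inside \<Omega>. For a nonempty open box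
            the closed one is its closure, which lies in \<open>cbox a b\<close>; the empty box is
            treated apart because its corners are arbitrary.\<close>
          have "cbox c' d' = closure (box c' d')" using False by simp
          also have "\<dots> \<subseteq> closure (box a b)" using eq by (intro closure_mono) blast
          also have "\<dots> \<subseteq> cbox a b" by (intro closure_minimal box_subset_cbox closed_cbox)
          finally have "cbox c' d' \<subseteq> \<Omega>" using sub by blast
          then show ?thesis unfolding eq by (intro integral_box_eq_0[OF w 0]) auto
        qed
      qed
      finally show ?thesis .
    qed
    have "AE x in lborel. g x \<le> 0" by (rule AE_nonpos_of_box_integrals[OF gi box])
    moreover have "AE x in lborel. - g x \<le> 0"
      using gi box by (intro AE_nonpos_of_box_integrals) auto
    ultimately have "AE x in lborel. g x = 0" by eventually_elim simp
    then have "AE x in lebesgue. g x = 0" by (rule AE_completion)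
    with gc show ?thesis by eventually_elim auto
  qed
  obtain D where D: "countable D" "D \<subseteq> Pow \<Omega>" "\<And>X. X \<in> D \<Longrightarrow> \<exists>a b. X = cbox a b" "\<Union>D = \<Omega>"
    using open_countable_Union_open_cbox[OF \<Omega>] by blast
  have "AE x in lebesgue. x \<in> X \<longrightarrow> w x = 0" if X: "X \<in> D" for X
  proof -
    obtain a b where ab: "X = cbox a b" "cbox a b \<subseteq> \<Omega>" using D X by blast
    have "negligible (cbox a b - box a b)" by (rule negligible_frontier_interval)
    then have "AE x in lebesgue. x \<notin> cbox a b - box a b"
      by (intro AE_not_in) (simp add: negligible_iff_null_sets)
    with one[OF ab(2)] show ?thesis unfolding ab(1) by eventually_elim auto
  qed
  then have "AE x in lebesgue. \<forall>X\<in>D. x \<in> X \<longrightarrow> w x = 0" unfolding AE_ball_countable[OF D(1)] by blast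
  then show ?thesis by eventually_elim (use D(4) in blast)
qed

text \<open>The difference of two weak derivatives of u is a weak derivative of 0, hence annihilates
  all test functions.\<close>

lemma weak_deriv_unique:
  fixes u :: "real^'n::finite \<Rightarrow> real"
  assumes \<Omega>: "open \<Omega>" and "has_weak_deriv \<Omega> js u v" "has_weak_deriv \<Omega> js u v'"
  shows "AE x in lebesgue. x \<in> \<Omega> \<longrightarrow> v x = v' x"
proof -
  have d: "has_weak_deriv \<Omega> js (\<lambda>x. u x - u x) (\<lambda>x. v x - v' x)" by (rule has_weak_deriv_diff[OF assms(2,3)])
  have "AE x in lebesgue. x \<in> \<Omega> \<longrightarrow> v x - v' x = 0"
  proof (rule fundamental_lemma[OF \<Omega>])
    show "(\<lambda>x. v x - v' x) locally_integrable_on \<Omega>" using d by (simp add: has_weak_deriv_def)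
    fix \<phi> assume "\<phi> \<in> test_functions \<Omega>"
    then have "(LINT x:\<Omega>|lebesgue. (u x - u x) * iterated_partial js \<phi> x) =
        (-1) ^ length js * (LINT x:\<Omega>|lebesgue. (v x - v' x) * \<phi> x)"
      using d unfolding has_weak_deriv_def by blast
    then show "(LINT x:\<Omega>|lebesgue. (v x - v' x) * \<phi> x) = 0" by (simp add: set_lebesgue_integral_def)
  qed
  then show ?thesis by eventually_elim auto
qed

lemma has_weak_deriv_weak_deriv:
  "has_weak_deriv \<Omega> js u v \<Longrightarrow> has_weak_deriv \<Omega> js u (weak_deriv \<Omega> js u)"
  unfolding weak_deriv_def by (rule someI[of "has_weak_deriv \<Omega> js u"])

subsection \<open>Approximation of the precise representative\<close>

lemma ennreal_le_of_geometric:
  fixes X A D :: ennreal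
  assumes le: "\<And>m. X \<le> A + D * ennreal ((1/2) ^ m)" and D: "D < top"
  shows "X \<le> A"
proof (rule ennreal_le_epsilon)
  fix e :: real assume e: "0 < e"
  obtain d where d: "D = ennreal d" "0 \<le> d" using D by (cases D) auto
  have "(\<lambda>m. d * (1/2) ^ m) \<longlonglongrightarrow> d * 0"
    by (intro tendsto_mult tendsto_const LIMSEQ_realpow_zero) auto
  then have "\<forall>\<^sub>F m in sequentially. d * (1/2) ^ m < e" using e by (intro order_tendstoD(2)) auto
  then obtain m where "d * (1/2) ^ m < e" by (auto simp: eventually_sequentially)
  then have "D * ennreal ((1/2) ^ m) \<le> ennreal e"
    unfolding d(1) using d(2) by (subst ennreal_mult[symmetric]) (auto intro!: ennreal_leI simp del: power_one_over)
  then show "X \<le> A + ennreal e" using le[of m] add_left_mono order_trans by blast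
qed

text \<open>\<open>V\<close> is used instead of \<^const>\<open>weak_deriv\<close> because it is integrable on all of \<open>\<Omega>\<close>.\<close>

lemma sobolev1_0_approx:
  fixes u :: "real^'n::finite \<Rightarrow> real"
  assumes \<Omega>: "open \<Omega>" and u: "u \<in> sobolev1_0 k \<Omega>"
  obtains \<phi> V where "\<And>m::nat. \<phi> m \<in> test_functions \<Omega>"
    "\<And>js. length js \<le> k \<Longrightarrow> has_weak_deriv \<Omega> js u (V js)"
    "\<And>js. length js \<le> k \<Longrightarrow> set_integrable lebesgue \<Omega> (V js)"
    "\<And>js m. length js \<le> k \<Longrightarrow>
      (\<integral>\<^sup>+x\<in>\<Omega>. ennreal \<bar>V js x - iterated_partial (rev js) (\<phi> m) x\<bar> \<partial>lebesgue) \<le> ennreal ((1/2) ^ m)"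
proof -
  have "\<forall>js. \<exists>v. length js \<le> k \<longrightarrow> has_weak_deriv \<Omega> js u v \<and> set_integrable lebesgue \<Omega> v"
    using u unfolding sobolev1_0_def sobolev1_def by blast
  from choice[OF this] obtain V where V: "\<And>js. length js \<le> k \<Longrightarrow> has_weak_deriv \<Omega> js u (V js)"
    "\<And>js. length js \<le> k \<Longrightarrow> set_integrable lebesgue \<Omega> (V js)" by blast
  have "\<forall>m. \<exists>\<phi>. \<phi> \<in> test_functions \<Omega> \<and> sobolev1_norm k \<Omega> (\<lambda>x. u x - \<phi> x) < ennreal ((1/2) ^ m)"
  proof
    fix m :: nat
    have "0 < ennreal ((1/2) ^ m)" by simp
    then show "\<exists>\<phi>. \<phi> \<in> test_functions \<Omega> \<and> sobolev1_norm k \<Omega> (\<lambda>x. u x - \<phi> x) < ennreal ((1/2) ^ m)"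
      using u unfolding sobolev1_0_def by blast
  qed
  from choice[OF this] obtain \<phi> where \<phi>: "\<And>m. \<phi> m \<in> test_functions \<Omega>"
    "\<And>m. sobolev1_norm k \<Omega> (\<lambda>x. u x - \<phi> m x) < ennreal ((1/2) ^ m)" by blast
  have "(\<integral>\<^sup>+x\<in>\<Omega>. ennreal \<bar>V js x - iterated_partial (rev js) (\<phi> m) x\<bar> \<partial>lebesgue) \<le> ennreal ((1/2) ^ m)"
    if js: "length js \<le> k" for js m
  proof -
    \<comment> \<open>\<open>sobolev1_norm\<close> is built from the selected versions
      \<open>weak_deriv\<close>. The difference of \<open>V js\<close> and the derivative of
      \<open>\<phi> m\<close> is another weak derivative of the same function, so it agrees with the
      selected one almost everywhere in \<Omega>.\<close>
    have d: "has_weak_deriv \<Omega> js (\<lambda>x. u x - \<phi> m x) (\<lambda>x. V js x - iterated_partial (rev js) (\<phi> m) x)"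
      by (intro has_weak_deriv_diff V(1)[OF js] has_weak_deriv_test_function \<phi>(1))
    have ae: "AE x in lebesgue. x \<in> \<Omega> \<longrightarrow> V js x - iterated_partial (rev js) (\<phi> m) x
        = weak_deriv \<Omega> js (\<lambda>x. u x - \<phi> m x) x"
      by (rule weak_deriv_unique[OF \<Omega> d has_weak_deriv_weak_deriv[OF d]])
    have "(\<integral>\<^sup>+x\<in>\<Omega>. ennreal \<bar>V js x - iterated_partial (rev js) (\<phi> m) x\<bar> \<partial>lebesgue)
        = (\<integral>\<^sup>+x\<in>\<Omega>. ennreal \<bar>weak_deriv \<Omega> js (\<lambda>x. u x - \<phi> m x) x\<bar> \<partial>lebesgue)"
    proof (rule nn_integral_cong_AE)
      show "AE x in lebesgue. ennreal \<bar>V js x - iterated_partial (rev js) (\<phi> m) x\<bar> * indicator \<Omega> x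
          = ennreal \<bar>weak_deriv \<Omega> js (\<lambda>x. u x - \<phi> m x) x\<bar> * indicator \<Omega> x"
        using ae by eventually_elim (simp add: indicator_def)
    qed
    also have "\<dots> \<le> sobolev1_norm k \<Omega> (\<lambda>x. u x - \<phi> m x)"
      unfolding sobolev1_norm_def using js finite_lists_length_le[of "UNIV :: 'n set" k]
      by (intro member_le_sum) auto
    also have "\<dots> \<le> ennreal ((1/2) ^ m)" using \<phi>(2) by (rule less_imp_le)
    finally show ?thesis .
  qed
  then show ?thesis using that[of \<phi> V] \<phi>(1) V by blast
qed

lemma borel_measurable_abs_indicator:
  assumes "(\<lambda>x. indicator \<Omega> x *\<^sub>R f x :: real) \<in> borel_measurable M"
  shows "(\<lambda>x. ennreal \<bar>f x\<bar> * indicator \<Omega> x) \<in> borel_measurable M"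
proof -
  have "(\<lambda>x. ennreal \<bar>f x\<bar> * indicator \<Omega> x) = (\<lambda>x. ennreal \<bar>indicator \<Omega> x *\<^sub>R f x\<bar>)"
    by (auto simp: fun_eq_iff indicator_def)
  also have "\<dots> \<in> borel_measurable M" using assms by measurable
  finally show ?thesis .
qed

text \<open>Measurability is assumed only after restriction to \<open>S\<close>, since u and its
  weak derivatives are arbitrary outside \<Omega>.\<close>

lemma nn_integral_abs_diff_triangle:
  assumes f: "(\<lambda>x. indicator S x *\<^sub>R f x :: real) \<in> borel_measurable M"
    and g: "(\<lambda>x. indicator S x *\<^sub>R g x :: real) \<in> borel_measurable M"
    and h: "(\<lambda>x. indicator S x *\<^sub>R h x :: real) \<in> borel_measurable M"
  shows "(\<integral>\<^sup>+x\<in>S. ennreal \<bar>f x - h x\<bar> \<partial>M) \<le> (\<integral>\<^sup>+x\<in>S. ennreal \<bar>g x - f x\<bar> \<partial>M) + (\<integral>\<^sup>+x\<in>S. ennreal \<bar>g x - h x\<bar> \<partial>M)"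
proof -
  have m: "(\<lambda>x. ennreal \<bar>g x - f x\<bar> * indicator S x) \<in> borel_measurable M"
    "(\<lambda>x. ennreal \<bar>g x - h x\<bar> * indicator S x) \<in> borel_measurable M"
    using borel_measurable_abs_indicator[of S "\<lambda>x. g x - f x" M] borel_measurable_diff[OF g f]
      borel_measurable_abs_indicator[of S "\<lambda>x. g x - h x" M] borel_measurable_diff[OF g h]
    by (simp_all only: scaleR_diff_right)
  have "(\<integral>\<^sup>+x\<in>S. ennreal \<bar>f x - h x\<bar> \<partial>M)
      \<le> (\<integral>\<^sup>+x. ennreal \<bar>g x - f x\<bar> * indicator S x + ennreal \<bar>g x - h x\<bar> * indicator S x \<partial>M)"
    by (intro nn_integral_mono) (auto simp: indicator_def simp flip: ennreal_plus intro!: ennreal_leI)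
  also have "\<dots> = (\<integral>\<^sup>+x\<in>S. ennreal \<bar>g x - f x\<bar> \<partial>M) + (\<integral>\<^sup>+x\<in>S. ennreal \<bar>g x - h x\<bar> \<partial>M)"
    by (rule nn_integral_add[OF m])
  finally show ?thesis .
qed

lemma indicator_measurable_lebesgue:
  fixes f :: "'a::euclidean_space \<Rightarrow> real"
  assumes "f \<in> borel_measurable borel" "S \<in> sets lebesgue"
  shows "(\<lambda>x. indicator S x *\<^sub>R f x) \<in> borel_measurable lebesgue"
proof -
  have "f \<in> borel_measurable lebesgue" using assms(1) by (intro measurable_completion) simp
  then show ?thesis using assms(2) by (intro borel_measurable_scaleR borel_measurable_indicator)
qed

text \<open>The increments have their support in \<Omega>, so the integral over all of space is one
  over \<Omega>, where the derivatives of both test functions are close to V.\<close>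

lemma approx_increment_le:
  fixes V :: "real^'n::finite \<Rightarrow> real"
  assumes \<Omega>: "open \<Omega>" and \<phi>: "\<phi> \<in> test_functions \<Omega>" "\<psi> \<in> test_functions \<Omega>"
    and V: "set_integrable lebesgue \<Omega> V"
    and le: "(\<integral>\<^sup>+x\<in>\<Omega>. ennreal \<bar>V x - iterated_partial js \<phi> x\<bar> \<partial>lebesgue) \<le> A"
      "(\<integral>\<^sup>+x\<in>\<Omega>. ennreal \<bar>V x - iterated_partial js \<psi> x\<bar> \<partial>lebesgue) \<le> B"
  shows "(\<integral>\<^sup>+x. ennreal \<bar>iterated_partial js (\<lambda>x. \<phi> x - \<psi> x) x\<bar> \<partial>lborel) \<le> A + B"
proof -
  have sm: "smooth \<phi>" "smooth \<psi>" using \<phi> by (auto intro: test_functions_smooth)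
  have z: "iterated_partial js (\<lambda>x. \<phi> x - \<psi> x) x = 0" if "x \<notin> \<Omega>" for x
    using test_function_support[OF test_functions_diff[OF \<phi>]] that by (metis subset_iff)
  have [simp]: "\<Omega> \<in> sets lebesgue" using \<Omega> by simp
  have m: "(\<lambda>x. indicator \<Omega> x *\<^sub>R iterated_partial js \<phi> x) \<in> borel_measurable lebesgue"
    "(\<lambda>x. indicator \<Omega> x *\<^sub>R iterated_partial js \<psi> x) \<in> borel_measurable lebesgue"
    by (intro indicator_measurable_lebesgue smooth_borel_measurable smooth_iterated_partial sm; simp)+
  have "(\<integral>\<^sup>+x. ennreal \<bar>iterated_partial js (\<lambda>x. \<phi> x - \<psi> x) x\<bar> \<partial>lborel)
    = (\<integral>\<^sup>+x. ennreal \<bar>iterated_partial js (\<lambda>x. \<phi> x - \<psi> x) x\<bar> \<partial>lebesgue)"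
    by (rule nn_integral_completion[symmetric])
  also have "\<dots> = (\<integral>\<^sup>+x\<in>\<Omega>. ennreal \<bar>iterated_partial js \<phi> x - iterated_partial js \<psi> x\<bar> \<partial>lebesgue)"
    using z by (intro nn_integral_cong) (auto simp: indicator_def iterated_partial_diff[OF sm])
  also have "\<dots> \<le> A + B"
    using V unfolding set_integrable_def
    by (intro order_trans[OF nn_integral_abs_diff_triangle add_mono[OF le]] m borel_measurable_integrable)
  finally show ?thesis .
qed

lemma approx_integral_le:
  fixes V :: "real^'n::finite \<Rightarrow> real"
  assumes \<phi>: "\<phi> \<in> test_functions \<Omega>" and Q: "Q \<in> sets borel" "Q \<subseteq> \<Omega>"
    and V: "set_integrable lebesgue \<Omega> V"
    and le: "(\<integral>\<^sup>+x\<in>\<Omega>. ennreal \<bar>V x - iterated_partial js \<phi> x\<bar> \<partial>lebesgue) \<le> A"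
  shows "(\<integral>\<^sup>+x\<in>Q. ennreal \<bar>iterated_partial js \<phi> x\<bar> \<partial>lborel) \<le> (\<integral>\<^sup>+x\<in>Q. ennreal \<bar>V x\<bar> \<partial>lebesgue) + A"
proof -
  have sm: "smooth \<phi>" using \<phi> by (rule test_functions_smooth)
  have Q': "Q \<in> sets lebesgue" using Q(1) by simp
  have VQ: "set_integrable lebesgue Q V" using V Q' Q(2) by (rule set_integrable_subset)
  have "(\<integral>\<^sup>+x\<in>Q. ennreal \<bar>iterated_partial js \<phi> x\<bar> \<partial>lborel) = (\<integral>\<^sup>+x\<in>Q. ennreal \<bar>iterated_partial js \<phi> x - 0\<bar> \<partial>lebesgue)"
    by (simp add: nn_integral_completion)
  also have "\<dots> \<le> (\<integral>\<^sup>+x\<in>Q. ennreal \<bar>V x - iterated_partial js \<phi> x\<bar> \<partial>lebesgue) + (\<integral>\<^sup>+x\<in>Q. ennreal \<bar>V x - 0\<bar> \<partial>lebesgue)"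
  proof (rule nn_integral_abs_diff_triangle)
    show "(\<lambda>x. indicator Q x *\<^sub>R iterated_partial js \<phi> x) \<in> borel_measurable lebesgue"
      by (intro indicator_measurable_lebesgue smooth_borel_measurable smooth_iterated_partial sm Q')
    show "(\<lambda>x. indicator Q x *\<^sub>R V x) \<in> borel_measurable lebesgue"
      using VQ unfolding set_integrable_def by (rule borel_measurable_integrable)
  qed simp
  also have "(\<integral>\<^sup>+x\<in>Q. ennreal \<bar>V x - iterated_partial js \<phi> x\<bar> \<partial>lebesgue) \<le> (\<integral>\<^sup>+x\<in>\<Omega>. ennreal \<bar>V x - iterated_partial js \<phi> x\<bar> \<partial>lebesgue)"
    using Q(2) by (intro nn_integral_mono) (auto simp: indicator_def)
  also have "\<dots> \<le> A" by (rule le)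
  finally show ?thesis by (simp add: add.commute add_left_mono)
qed

text \<open>The point x is fixed. The numbers \<open>B p\<close> bound both the increment from
  \<open>\<phi> p\<close> to \<open>\<phi> (Suc p)\<close> at x and its averages over small balls
  about x, as a maximal function does. Their summability at this single point is what makes x a
  Lebesgue point of u.\<close>

context
  fixes \<Omega> :: "(real^'n::finite) set" and u :: "real^'n \<Rightarrow> real" and \<phi> :: "nat \<Rightarrow> real^'n \<Rightarrow> real"
    and x :: "real^'n" and R :: real and B :: "nat \<Rightarrow> ennreal"
  assumes \<Omega>: "open \<Omega>" and x: "x \<in> \<Omega>" and R: "0 < R"
    and u: "set_integrable lebesgue \<Omega> u"
    and smooth_\<phi>: "\<And>m. smooth (\<phi> m)"
    and conv: "\<And>m. (\<integral>\<^sup>+y\<in>\<Omega>. ennreal \<bar>u y - \<phi> m y\<bar> \<partial>lebesgue) \<le> ennreal ((1/2) ^ m)"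
    and ptw: "\<And>p. ennreal \<bar>\<phi> (Suc p) x - \<phi> p x\<bar> \<le> B p"
    and avg: "\<And>p r. 0 < r \<Longrightarrow> r \<le> R \<Longrightarrow> ball x r \<subseteq> \<Omega> \<Longrightarrow>
      (\<integral>\<^sup>+y\<in>ball x r. ennreal \<bar>\<phi> (Suc p) y - \<phi> p y\<bar> \<partial>lborel) \<le> emeasure lborel (ball x r) * B p"
    and fin: "(\<Sum>p. B p) < top"
begin

text \<open>Telescoping from m to \<open>m + q\<close> splits \<open>u - c\<close> into the
  increments, which B bounds in proportion to the volume of the ball, the term
  \<open>\<phi> m - c\<close>, and the remainder \<open>u - \<phi> (m + q)\<close>. The remainder is
  bounded by \<open>(1/2) ^ q\<close> without the volume, but q tends to infinity while the ball is
  fixed.\<close>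

lemma series_ball_integral_le:
  assumes r: "0 < r" "r \<le> R" "ball x r \<subseteq> \<Omega>" and d: "\<And>y. y \<in> ball x r \<Longrightarrow> \<bar>\<phi> m y - c\<bar> \<le> d" and d0: "0 \<le> d"
  shows "(\<integral>\<^sup>+y\<in>ball x r. ennreal \<bar>u y - c\<bar> \<partial>lebesgue)
    \<le> emeasure lborel (ball x r) * ((\<Sum>p. B (m + p)) + ennreal d)"
proof (rule ennreal_le_of_geometric[where D=1])
  fix q
  let ?b = "ball x r"
  let ?f = "\<lambda>p y. ennreal \<bar>\<phi> (Suc (m + p)) y - \<phi> (m + p) y\<bar> * indicator ?b y"
  have [simp]: "\<Omega> \<in> sets lebesgue" using \<Omega> by simp
  have mf: "?f p \<in> borel_measurable lebesgue" for p
    by (intro borel_measurable_abs_indicator indicator_measurable_lebesgue borel_measurable_diff smooth_borel_measurable smooth_\<phi>) simp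
  have mu: "(\<lambda>y. indicator ?b y *\<^sub>R u y) \<in> borel_measurable lebesgue"
  proof -
    have "set_integrable lebesgue ?b u" using u _ r(3) by (rule set_integrable_subset) simp
    then show ?thesis unfolding set_integrable_def by (rule borel_measurable_integrable)
  qed
  have m\<phi>: "(\<lambda>y. indicator ?b y *\<^sub>R \<phi> p y) \<in> borel_measurable lebesgue" for p
    by (intro indicator_measurable_lebesgue smooth_borel_measurable smooth_\<phi>) simp
  have mu\<phi>: "(\<lambda>y. ennreal \<bar>u y - \<phi> (m + q) y\<bar> * indicator ?b y) \<in> borel_measurable lebesgue"
    using borel_measurable_diff[OF mu m\<phi>[of "m + q"]]
    by (intro borel_measurable_abs_indicator) (simp add: right_diff_distrib)
  have mb: "emeasure lebesgue ?b = emeasure lborel ?b" by simp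
  have ms: "(\<lambda>y. \<Sum>p<q. ?f p y) \<in> borel_measurable lebesgue" by (intro borel_measurable_sum mf)
  have mc: "(\<lambda>y. ennreal d * indicator ?b y) \<in> borel_measurable lebesgue"
    by (intro borel_measurable_times_ennreal borel_measurable_const borel_measurable_indicator) simp
  have "(\<integral>\<^sup>+y\<in>?b. ennreal \<bar>u y - c\<bar> \<partial>lebesgue) \<le> (\<integral>\<^sup>+y. ennreal \<bar>u y - \<phi> (m + q) y\<bar> * indicator ?b y
      + ((\<Sum>p<q. ?f p y) + ennreal d * indicator ?b y) \<partial>lebesgue)"
  proof (rule nn_integral_mono)
    fix y
    show "ennreal \<bar>u y - c\<bar> * indicator ?b y \<le> ennreal \<bar>u y - \<phi> (m + q) y\<bar> * indicator ?b y
      + ((\<Sum>p<q. ?f p y) + ennreal d * indicator ?b y)"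
    proof (cases "y \<in> ?b")
      case True
      have tel: "(\<Sum>p<q. \<phi> (Suc (m + p)) y - \<phi> (m + p) y) = \<phi> (m + q) y - \<phi> m y"
        using sum_lessThan_telescope[of "\<lambda>p. \<phi> (m + p) y" q] by simp
      have "\<bar>u y - c\<bar> \<le> \<bar>u y - \<phi> (m + q) y\<bar> + (\<bar>\<phi> (m + q) y - \<phi> m y\<bar> + d)"
        using d[OF True] by linarith
      also have "\<bar>\<phi> (m + q) y - \<phi> m y\<bar> \<le> (\<Sum>p<q. \<bar>\<phi> (Suc (m + p)) y - \<phi> (m + p) y\<bar>)"
        unfolding tel[symmetric] by (rule sum_abs)
      finally have "ennreal \<bar>u y - c\<bar> \<le> ennreal (\<bar>u y - \<phi> (m + q) y\<bar> + ((\<Sum>p<q. \<bar>\<phi> (Suc (m + p)) y - \<phi> (m + p) y\<bar>) + d))"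
        by (intro ennreal_leI) simp
      also have "\<dots> = ennreal \<bar>u y - \<phi> (m + q) y\<bar> + ((\<Sum>p<q. ennreal \<bar>\<phi> (Suc (m + p)) y - \<phi> (m + p) y\<bar>) + ennreal d)"
        using d0 by (simp add: ennreal_plus sum_nonneg sum_ennreal)
      finally show ?thesis using True by simp
    qed simp
  qed
  also have "\<dots> = (\<integral>\<^sup>+y\<in>?b. ennreal \<bar>u y - \<phi> (m + q) y\<bar> \<partial>lebesgue)
      + ((\<Sum>p<q. \<integral>\<^sup>+y. ?f p y \<partial>lebesgue) + (\<integral>\<^sup>+y. ennreal d * indicator ?b y \<partial>lebesgue))"
    using nn_integral_add[OF mu\<phi> borel_measurable_add[OF ms mc]] nn_integral_add[OF ms mc]
      nn_integral_sum[of "{..<q}" ?f lebesgue] mf by simp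
  also have "\<dots> \<le> ennreal ((1/2) ^ q) + (emeasure lborel ?b * (\<Sum>p. B (m + p)) + emeasure lborel ?b * ennreal d)"
  proof (intro add_mono)
    have "(\<integral>\<^sup>+y\<in>?b. ennreal \<bar>u y - \<phi> (m + q) y\<bar> \<partial>lebesgue) \<le> (\<integral>\<^sup>+y\<in>\<Omega>. ennreal \<bar>u y - \<phi> (m + q) y\<bar> \<partial>lebesgue)"
      using r(3) by (intro nn_integral_mono) (auto simp: indicator_def)
    also have "\<dots> \<le> ennreal ((1/2) ^ (m + q))" by (rule conv)
    also have "\<dots> \<le> ennreal ((1/2) ^ q)" by (intro ennreal_leI power_decreasing) auto
    finally show "(\<integral>\<^sup>+y\<in>?b. ennreal \<bar>u y - \<phi> (m + q) y\<bar> \<partial>lebesgue) \<le> ennreal ((1/2) ^ q)" .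
    have "(\<Sum>p<q. \<integral>\<^sup>+y. ?f p y \<partial>lebesgue) \<le> (\<Sum>p<q. emeasure lborel ?b * B (m + p))"
      unfolding nn_integral_completion using r by (intro sum_mono avg)
    also have "\<dots> \<le> (\<Sum>p. emeasure lborel ?b * B (m + p))" by (intro sum_le_suminf) auto
    finally show "(\<Sum>p<q. \<integral>\<^sup>+y. ?f p y \<partial>lebesgue) \<le> emeasure lborel ?b * (\<Sum>p. B (m + p))" by simp
    show "(\<integral>\<^sup>+y. ennreal d * indicator ?b y \<partial>lebesgue) \<le> emeasure lborel ?b * ennreal d"
      unfolding nn_integral_completion by (subst nn_integral_cmult_indicator) (auto simp: mult.commute)
  qed
  finally show "(\<integral>\<^sup>+y\<in>?b. ennreal \<bar>u y - c\<bar> \<partial>lebesgue)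
      \<le> emeasure lborel ?b * ((\<Sum>p. B (m + p)) + ennreal d) + 1 * ennreal ((1/2) ^ q)"
    by (simp add: distrib_left add.commute)
qed simp

text \<open>The candidate is c, the limit of \<open>\<phi> m x\<close>. The averages of
  \<open>\<bar>u y - c\<bar>\<close> over small balls are bounded by the tail of the series, the
  oscillation of the continuous function \<open>\<phi> m\<close> near x and
  \<open>\<bar>\<phi> m x - c\<bar>\<close>; choosing m first and then the radius makes them small.
  So c is the precise value, and \<open>c - \<phi> m x\<close> is the tail of the increments at
  x.\<close>

lemma precise_rep_of_series:
  shows "ennreal \<bar>precise_rep u x - \<phi> m x\<bar> \<le> (\<Sum>p. B (m + p))"
proof -
  have Bfin: "B p < top" for p using ennreal_suminf_lessD[OF fin] .
  define bs where "bs p = enn2real (B p)" for p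
  have bs: "B p = ennreal (bs p)" "0 \<le> bs p" for p using Bfin[of p] by (auto simp: bs_def)
  have sb: "summable bs" using fin by (intro summable_suminf_not_top bs(2)) (simp add: bs(1)[symmetric])
  define g where "g p = \<phi> (Suc p) x - \<phi> p x" for p
  have gb: "norm (g p) \<le> bs p" for p using ptw[of p] bs[of p] by (simp add: g_def)
  have sg: "summable g" by (rule summable_comparison_test'[OF sb]) (rule gb)
  define c where "c = \<phi> 0 x + suminf g"
  define \<tau> where "\<tau> m = (\<Sum>p. bs (p + m))" for m
  have c: "\<bar>c - \<phi> m x\<bar> \<le> \<tau> m" for m
  proof -
    have "sum g {..<m} = \<phi> m x - \<phi> 0 x"
      unfolding g_def by (rule sum_lessThan_telescope)
    then have "c - \<phi> m x = (\<Sum>p. g (p + m))"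
      using suminf_minus_initial_segment[OF sg, of m] by (simp add: c_def)
    then show ?thesis unfolding \<tau>_def
      using norm_suminf_le[of "\<lambda>p. g (p + m)" "\<lambda>p. bs (p + m)"] gb sb by (simp add: summable_iff_shift)
  qed
  have \<tau>: "(\<Sum>p. B (m + p)) = ennreal (\<tau> m)" "0 \<le> \<tau> m" for m
  proof -
    show "0 \<le> \<tau> m" unfolding \<tau>_def using sb bs by (intro suminf_nonneg) (auto simp: summable_iff_shift)
    show "(\<Sum>p. B (m + p)) = ennreal (\<tau> m)"
      unfolding \<tau>_def bs(1) using sb bs(2) by (subst suminf_ennreal2) (auto simp: summable_iff_shift add.commute)
  qed
  have "(\<lambda>m. suminf bs - sum bs {..<m}) \<longlonglongrightarrow> suminf bs - suminf bs"
    by (intro tendsto_diff tendsto_const summable_LIMSEQ sb)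
  then have \<tau>0: "\<tau> \<longlonglongrightarrow> 0" unfolding \<tau>_def suminf_minus_initial_segment[OF sb] by simp
  obtain r1 where r1: "0 < r1" "ball x r1 \<subseteq> \<Omega>" using \<Omega> x openE by blast
  have int: "set_integrable lebesgue (ball x r) u" if "r \<le> r1" for r
    using u by (rule set_integrable_subset) (use that r1 in auto)
  have intc: "set_integrable lebesgue (ball x r) (\<lambda>y. u y - c)" if "r \<le> r1" for r
  proof -
    have "set_integrable lebesgue (ball x r) (\<lambda>y. c)"
      unfolding set_integrable_def
      by (intro integrable_scaleR_left integrable_real_indicator)
        (simp_all add: emeasure_bounded_finite[OF bounded_ball, simplified])
    then show ?thesis using int[OF that] by (intro set_integral_diff) auto
  qed
  have pos: "0 < measure lebesgue (ball x r)" if "0 < r" for r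
    using content_ball_pos[OF that, of x] by simp
  have em: "emeasure lborel (ball x r) = ennreal (measure lebesgue (ball x r))" for r
    using emeasure_bounded_finite[OF bounded_ball, of x r] by (simp add: emeasure_eq_ennreal_measure)
  have small: "\<exists>r0>0. \<forall>r. 0 < r \<longrightarrow> r < r0 \<longrightarrow> average (ball x r) (\<lambda>y. \<bar>u y - c\<bar>) < e" if e: "0 < e" for e
  proof -
    \<comment> \<open>The tail occurs twice in the final bound, once from the increments and once
      from \<open>\<bar>c - \<phi> m x\<bar>\<close>; with the oscillation this adds up to less than
      \<open>3 * e / 4\<close>.\<close>
    have "\<forall>\<^sub>F m in sequentially. \<tau> m < e / 4" using \<tau>0 e by (intro order_tendstoD(2)) auto
    then obtain m where m: "\<tau> m < e / 4" by (auto simp: eventually_sequentially)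
    have "isCont (\<phi> m) x" using smooth_continuous_on[OF smooth_\<phi>, of UNIV m] by (simp add: continuous_on_eq_continuous_at)
    then obtain \<delta> where \<delta>: "0 < \<delta>" "\<And>y. dist y x < \<delta> \<Longrightarrow> dist (\<phi> m y) (\<phi> m x) < e / 4"
      using e unfolding continuous_at_eps_delta by (metis zero_less_divide_iff zero_less_numeral)
    show ?thesis
    proof (intro exI[of _ "min (min R r1) \<delta>"] conjI allI impI)
      show "0 < min (min R r1) \<delta>" using R r1 \<delta> by simp
      fix r assume r: "0 < r" "r < min (min R r1) \<delta>"
      have sub: "ball x r \<subseteq> \<Omega>" using r r1 by (auto simp: subset_iff)
      have "\<bar>\<phi> m y - c\<bar> \<le> e / 4 + \<tau> m" if "y \<in> ball x r" for y
      proof -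
        have "dist y x < \<delta>" using that r by (simp add: dist_commute)
        from \<delta>(2)[OF this] have "\<bar>\<phi> m y - \<phi> m x\<bar> < e / 4" by (simp add: dist_real_def)
        then show ?thesis using c[of m] by linarith
      qed
      from series_ball_integral_le[OF _ _ sub this]
      have "(\<integral>\<^sup>+y\<in>ball x r. ennreal \<bar>u y - c\<bar> \<partial>lebesgue)
        \<le> emeasure lborel (ball x r) * (ennreal (\<tau> m) + ennreal (e / 4 + \<tau> m))"
        using r e \<tau>(2)[of m] by (simp add: \<tau>(1))
      also have "\<dots> = ennreal (measure lebesgue (ball x r) * (\<tau> m + (e / 4 + \<tau> m)))"
      proof -
        have "ennreal (\<tau> m) + ennreal (e / 4 + \<tau> m) = ennreal (\<tau> m + (e / 4 + \<tau> m))"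
          using \<tau>(2)[of m] e by (intro ennreal_plus[symmetric]) auto
        then show ?thesis unfolding em
          by (simp only:) (rule ennreal_mult[symmetric], use \<tau>(2)[of m] e in auto)
      qed
      finally have up: "(\<integral>\<^sup>+y\<in>ball x r. ennreal \<bar>u y - c\<bar> \<partial>lebesgue)
        \<le> ennreal (measure lebesgue (ball x r) * (\<tau> m + (e / 4 + \<tau> m)))" .
      have "(\<integral>\<^sup>+y\<in>ball x r. ennreal \<bar>u y - c\<bar> \<partial>lebesgue) = (\<integral>\<^sup>+y. ennreal (indicator (ball x r) y *\<^sub>R \<bar>u y - c\<bar>) \<partial>lebesgue)"
        by (intro nn_integral_cong) (auto simp: indicator_def)
      also have "\<dots> = ennreal (LINT y:ball x r|lebesgue. \<bar>u y - c\<bar>)"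
        unfolding set_lebesgue_integral_def
        using set_integrable_abs[OF intc[of r]] r unfolding set_integrable_def
        by (intro nn_integral_eq_integral) (auto simp: indicator_def)
      finally have "ennreal (LINT y:ball x r|lebesgue. \<bar>u y - c\<bar>)
          \<le> ennreal (measure lebesgue (ball x r) * (\<tau> m + (e / 4 + \<tau> m)))"
        using up by (simp only:)
      moreover have "0 \<le> measure lebesgue (ball x r) * (\<tau> m + (e / 4 + \<tau> m))"
        using \<tau>(2)[of m] e by (intro mult_nonneg_nonneg) auto
      ultimately have "(LINT y:ball x r|lebesgue. \<bar>u y - c\<bar>) \<le> measure lebesgue (ball x r) * (\<tau> m + (e / 4 + \<tau> m))"
        by (simp only: ennreal_le_iff)
      then have "average (ball x r) (\<lambda>y. \<bar>u y - c\<bar>) \<le> \<tau> m + (e / 4 + \<tau> m)"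
        unfolding average_def using pos[OF r(1)] by (simp add: divide_le_eq mult.commute)
      then show "average (ball x r) (\<lambda>y. \<bar>u y - c\<bar>) < e" using m e by linarith
    qed
  qed
  have nonneg: "0 \<le> average (ball x r) (\<lambda>y. \<bar>u y - c\<bar>)" for r
    unfolding average_def set_lebesgue_integral_def
    by (intro divide_nonneg_nonneg integral_nonneg_AE AE_I2) (auto simp: indicator_def)
  have lim0: "((\<lambda>r. average (ball x r) (\<lambda>y. \<bar>u y - c\<bar>)) \<longlongrightarrow> 0) (at_right 0)"
  proof (rule tendstoI)
    fix e :: real assume "0 < e"
    from small[OF this] obtain r0 where "0 < r0" "\<And>r. 0 < r \<Longrightarrow> r < r0 \<Longrightarrow> average (ball x r) (\<lambda>y. \<bar>u y - c\<bar>) < e" by blast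
    then show "\<forall>\<^sub>F r in at_right 0. dist (average (ball x r) (\<lambda>y. \<bar>u y - c\<bar>)) 0 < e"
      unfolding eventually_at_right_field using nonneg by (intro exI[of _ r0]) auto
  qed
  have lp: "lebesgue_point u x"
    unfolding lebesgue_point_def using r1(1) int[of r1] lim0 by blast
  have diff: "\<bar>average (ball x r) u - c\<bar> \<le> average (ball x r) (\<lambda>y. \<bar>u y - c\<bar>)" if r: "0 < r" "r < r1" for r
  proof -
    let ?b = "ball x r"
    let ?\<mu> = "measure lebesgue ?b"
    have ic: "set_integrable lebesgue ?b (\<lambda>y. c)"
      using set_integral_diff(1)[OF int[of r] intc[of r]] r by simp
    have "(LINT y:?b|lebesgue. u y - c) = (LINT y:?b|lebesgue. u y) - (LINT y:?b|lebesgue. c)"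
      using int[of r] ic r by (intro set_integral_diff) auto
    also have "(LINT y:?b|lebesgue. c) = c * ?\<mu>"
      unfolding set_lebesgue_integral_def by (simp add: mult.commute)
    finally have "average ?b u - c = (LINT y:?b|lebesgue. u y - c) / ?\<mu>"
      using pos[OF r(1)] by (simp add: average_def field_simps)
    moreover have "\<bar>LINT y:?b|lebesgue. u y - c\<bar> \<le> (LINT y:?b|lebesgue. \<bar>u y - c\<bar>)"
      unfolding set_lebesgue_integral_def
      using integral_norm_bound[of lebesgue "\<lambda>y. indicator ?b y *\<^sub>R (u y - c)"] by (simp add: abs_mult)
    ultimately show ?thesis unfolding average_def using pos[OF r(1)] by (simp add: abs_divide divide_right_mono)
  qed
  have "((\<lambda>r. average (ball x r) u - c) \<longlongrightarrow> 0) (at_right 0)"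
  proof (rule Lim_null_comparison[OF _ lim0])
    show "\<forall>\<^sub>F r in at_right 0. norm (average (ball x r) u - c) \<le> average (ball x r) (\<lambda>y. \<bar>u y - c\<bar>)"
      unfolding eventually_at_right_field using diff r1(1) by (intro exI[of _ r1]) auto
  qed
  then have "((\<lambda>r. average (ball x r) u) \<longlongrightarrow> c) (at_right 0)" by (simp add: LIM_zero_iff)
  then have "Lim (at_right 0) (\<lambda>r. average (ball x r) u) = c" by (intro tendsto_Lim) simp_all
  then have "precise_rep u x = c" using lp by (simp add: precise_rep_def)
  then show ?thesis using c[of m] unfolding \<tau>(1) by (intro ennreal_leI) simp
qed

end

context grid
begin

text \<open>The weights for all increments are added before the Choquet integral is estimated: the
  sum over p is still adapted and its cost is the sum of the costs, so the geometric decay survives.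
  The factor 2 in \<open>?D\<close> is that of the geometric tail
  \<open>(\<Sum>p. (1/2) ^ (m + p)) = 2 * (1/2) ^ m\<close>.\<close>

lemma series_maximal:
  assumes g: "\<And>p. smooth (g p)" and k: "1 \<le> k" "k < CARD('n)"
    and S: "\<And>p. sob k (g p) \<le> S * ennreal ((1/2) ^ p)" "S < top"
  obtains B :: "nat \<Rightarrow> real^'n \<Rightarrow> ennreal" and D :: ennreal where "D < top"
    "\<And>p x. x \<in> top_cell \<Longrightarrow> ennreal \<bar>g p x\<bar> \<le> B p x"
    "\<And>p x r. 0 < r \<Longrightarrow> r \<le> L \<Longrightarrow> ball x r \<subseteq> top_cell \<Longrightarrow>
      (\<integral>\<^sup>+y\<in>ball x r. ennreal \<bar>g p y\<bar> \<partial>lborel) \<le> emeasure lborel (ball x r) * B p x"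
    "\<And>m. choquet_integral (real CARD('n) - real k) UNIV (\<lambda>x. \<Sum>p. B (m + p) x) \<le> D * ennreal ((1/2) ^ m)"
proof -
  let ?C = "(4 ^ Suc CARD('n)) ^ k :: ennreal" and ?s = "\<lambda>i. ennreal ((1 / side i) ^ k)"
  let ?M = "of_nat (card shifts) * (1 + ennreal ball_const)"
  have "\<forall>p. \<exists>b. adapted b \<and> (\<forall>x\<in>top_cell. ennreal \<bar>g p x\<bar> \<le> (\<Sum>i. b i x)) \<and>
    (\<forall>x r. 0 < r \<longrightarrow> r \<le> L \<longrightarrow> ball x r \<subseteq> top_cell \<longrightarrow>
      (\<integral>\<^sup>+y\<in>ball x r. ennreal \<bar>g p y\<bar> \<partial>lborel) \<le> emeasure lborel (ball x r) * (\<Sum>i. b i x)) \<and>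
    (\<Sum>i. ?s i * (\<integral>\<^sup>+x. b i x \<partial>lborel)) \<le> ?M * (?C * (S * ennreal ((1/2) ^ p)))"
  proof
    fix p
    have "dominated k (g p) (?C * sob k (g p))" using dominated_smooth[OF g, of "k - 1"] k by simp
    then have "dominated k (g p) (?C * (S * ennreal ((1/2) ^ p)))"
      by (rule dominated_mono) (intro mult_left_mono S, simp)
    then obtain a where a: "adapted a" "\<And>x. x \<in> top_cell \<Longrightarrow> ennreal \<bar>g p x\<bar> \<le> (\<Sum>i. a i x)"
      "cost k a \<le> ?C * (S * ennreal ((1/2) ^ p))" unfolding dominated_def by blast
    let ?a = "\<lambda>i x. a i x * indicator top_cell x"
    obtain b where b: "adapted b" "\<And>x. (\<Sum>i. ?a i x) \<le> (\<Sum>i. b i x)"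
      "\<And>x r. 0 < r \<Longrightarrow> r \<le> L \<Longrightarrow> (\<integral>\<^sup>+y\<in>ball x r. (\<Sum>i. ?a i y) \<partial>lborel) \<le> emeasure lborel (ball x r) * (\<Sum>i. b i x)"
      "(\<Sum>i. ?s i * (\<integral>\<^sup>+x. b i x \<partial>lborel)) \<le> ?M * (\<Sum>i. ?s i * (\<integral>\<^sup>+x. ?a i x \<partial>lborel))"
      using maximal_bound[OF adapted_indicator[OF a(1)] k(1)] by blast
    have ga: "ennreal \<bar>g p x\<bar> \<le> (\<Sum>i. ?a i x)" if "x \<in> top_cell" for x using a(2)[OF that] that by simp
    have "(\<integral>\<^sup>+y\<in>ball x r. ennreal \<bar>g p y\<bar> \<partial>lborel) \<le> emeasure lborel (ball x r) * (\<Sum>i. b i x)"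
      if r: "0 < r" "r \<le> L" "ball x r \<subseteq> top_cell" for x r
    proof -
      have "(\<integral>\<^sup>+y\<in>ball x r. ennreal \<bar>g p y\<bar> \<partial>lborel) \<le> (\<integral>\<^sup>+y\<in>ball x r. (\<Sum>i. ?a i y) \<partial>lborel)"
      proof (rule nn_integral_mono)
        fix y
        show "ennreal \<bar>g p y\<bar> * indicator (ball x r) y \<le> (\<Sum>i. ?a i y) * indicator (ball x r) y"
        proof (cases "y \<in> ball x r")
          case True
          then have "y \<in> top_cell" using r(3) by blast
          then show ?thesis using True ga[of y] by simp
        qed simp
      qed
      also have "\<dots> \<le> emeasure lborel (ball x r) * (\<Sum>i. b i x)" by (rule b(3)[OF r(1,2)])
      finally show ?thesis .
    qed
    moreover have "(\<Sum>i. ?s i * (\<integral>\<^sup>+x. b i x \<partial>lborel)) \<le> ?M * (?C * (S * ennreal ((1/2) ^ p)))"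
      by (rule order_trans[OF b(4)]) (unfold cost_indicator, intro mult_left_mono a(3), simp)
    moreover have "ennreal \<bar>g p x\<bar> \<le> (\<Sum>i. b i x)" if "x \<in> top_cell" for x
      using ga[OF that] b(2)[of x] by (rule order_trans)
    ultimately show "\<exists>b. adapted b \<and> (\<forall>x\<in>top_cell. ennreal \<bar>g p x\<bar> \<le> (\<Sum>i. b i x)) \<and>
      (\<forall>x r. 0 < r \<longrightarrow> r \<le> L \<longrightarrow> ball x r \<subseteq> top_cell \<longrightarrow>
        (\<integral>\<^sup>+y\<in>ball x r. ennreal \<bar>g p y\<bar> \<partial>lborel) \<le> emeasure lborel (ball x r) * (\<Sum>i. b i x)) \<and>
      (\<Sum>i. ?s i * (\<integral>\<^sup>+x. b i x \<partial>lborel)) \<le> ?M * (?C * (S * ennreal ((1/2) ^ p)))"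
      using b(1) by blast
  qed
  from choice[OF this] obtain b where b: "\<And>p. adapted (b p)"
    "\<And>p x. x \<in> top_cell \<Longrightarrow> ennreal \<bar>g p x\<bar> \<le> (\<Sum>i. b p i x)"
    "\<And>p x r. 0 < r \<Longrightarrow> r \<le> L \<Longrightarrow> ball x r \<subseteq> top_cell \<Longrightarrow>
        (\<integral>\<^sup>+y\<in>ball x r. ennreal \<bar>g p y\<bar> \<partial>lborel) \<le> emeasure lborel (ball x r) * (\<Sum>i. b p i x)"
    "\<And>p. (\<Sum>i. ?s i * (\<integral>\<^sup>+x. b p i x \<partial>lborel)) \<le> ?M * (?C * (S * ennreal ((1/2) ^ p)))"
    by blast
  have [measurable]: "\<And>p i. b p i \<in> borel_measurable borel" using b(1) by (rule adapted_measurable)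
  let ?K = "ennreal (content_const (real CARD('n) - real k))"
  let ?D = "?K * (?M * (?C * S)) * 2"
  have "choquet_integral (real CARD('n) - real k) UNIV (\<lambda>x. \<Sum>p. \<Sum>i. b (m + p) i x) \<le> ?D * ennreal ((1/2) ^ m)" for m
  proof -
    have ad: "adapted (\<lambda>i x. \<Sum>p. b (m + p) i x)"
    proof (rule adaptedI)
      fix i x y assume "idx i x = idx i y"
      then show "(\<Sum>p. b (m + p) i x) = (\<Sum>p. b (m + p) i y)" by (intro suminf_cong adaptedD[OF b(1)])
    qed
    \<comment> \<open>Exchanging the sums turns the double series into a single family of weights
      indexed by the level.\<close>
    have "choquet_integral (real CARD('n) - real k) UNIV (\<lambda>x. \<Sum>p. \<Sum>i. b (m + p) i x)
      = choquet_integral (real CARD('n) - real k) UNIV (\<lambda>x. \<Sum>i. \<Sum>p. b (m + p) i x)"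
      by (subst suminf_ennreal_swap) (rule refl)
    also have "\<dots> \<le> ?K * (\<Sum>i. ?s i * (\<integral>\<^sup>+x. (\<Sum>p. b (m + p) i x) \<partial>lborel))"
      by (rule choquet_adapted_le[OF ad k(2) refl])
    also have "(\<Sum>i. ?s i * (\<integral>\<^sup>+x. (\<Sum>p. b (m + p) i x) \<partial>lborel)) = (\<Sum>i. \<Sum>p. ?s i * (\<integral>\<^sup>+x. b (m + p) i x \<partial>lborel))"
      by (simp add: nn_integral_suminf)
    also have "\<dots> = (\<Sum>p. \<Sum>i. ?s i * (\<integral>\<^sup>+x. b (m + p) i x \<partial>lborel))" by (rule suminf_ennreal_swap)
    also have "?K * \<dots> \<le> ?K * (\<Sum>p. ?M * (?C * (S * ennreal ((1/2) ^ (m + p)))))"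
      by (intro mult_left_mono suminf_le b(4)) auto
    also have "\<dots> = ?K * (?M * (?C * (S * (\<Sum>p. ennreal ((1/2) ^ (m + p))))))" by simp
    also have "(\<Sum>p. ennreal ((1/2) ^ (m + p))) = ennreal (2 * (1/2) ^ m)"
    proof (rule suminf_ennreal_eq)
      show "(\<lambda>p. (1/2::real) ^ (m + p)) sums (2 * (1/2) ^ m)"
        using sums_mult[OF geometric_sums[of "1/2::real"], of "(1/2) ^ m"] by (simp add: power_add mult.commute)
    qed simp
    also have "ennreal (2 * (1/2) ^ m) = 2 * ennreal ((1/2) ^ m)" by (simp add: ennreal_mult)
    finally show ?thesis by (simp only: mult_ac)
  qed
  moreover have "?D < top" using S(2) by (simp add: ennreal_mult_less_top power_less_top_ennreal of_nat_less_top)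
  ultimately show ?thesis using that[of ?D "\<lambda>p x. \<Sum>i. b p i x"] b(2,3) by blast
qed

end

subsection \<open>The estimate on a cube\<close>

lemma (in grid) mem_top_cell: "x \<in> top_cell \<longleftrightarrow> (\<forall>c. p $ c \<le> x $ c \<and> x $ c < p $ c + L)"
  by (simp add: top_cell_def idx_eq_int_iff side_0)

lemma cube_subset_ball:
  fixes a :: "real^'n::finite"
  assumes "0 < l"
  shows "cube a l \<subseteq> ball a (real CARD('n) * l)"
proof
  fix y assume y: "y \<in> cube a l"
  have "norm (y - a) \<le> (\<Sum>c\<in>UNIV. \<bar>(y - a) $ c\<bar>)" by (rule norm_le_l1_cart)
  also have "\<dots> \<le> (\<Sum>c\<in>(UNIV::'n set). l / 2)"
    using y by (intro sum_mono) (simp add: cube_def)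
  also have "\<dots> < real CARD('n) * l" using assms by simp
  finally show "y \<in> ball a (real CARD('n) * l)" by (simp add: dist_norm norm_minus_commute)
qed

lemma abs_le_weak_grad_norm:
  fixes u :: "real^'n::finite \<Rightarrow> real"
  assumes "length js = j"
  shows "\<bar>weak_deriv \<Omega> js u x\<bar> \<le> \<bar>weak_grad_norm \<Omega> j u x\<bar>"
proof -
  have "(weak_deriv \<Omega> js u x)\<^sup>2 \<le> (\<Sum>js | length js = j. (weak_deriv \<Omega> js u x)\<^sup>2)"
    using assms by (intro member_le_sum) auto
  then have "sqrt ((weak_deriv \<Omega> js u x)\<^sup>2) \<le> weak_grad_norm \<Omega> j u x"
    unfolding weak_grad_norm_def L2_set_def by (rule real_sqrt_le_mono)
  then show ?thesis by simp
qed

lemma morrey_integral_le: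
  fixes f :: "'a::euclidean_space \<Rightarrow> real"
  assumes "x \<in> \<Omega>" "0 < r"
  shows "(\<integral>\<^sup>+y\<in>\<Omega> \<inter> ball x r. ennreal \<bar>f y\<bar> \<partial>lebesgue) \<le> ennreal (r powr \<beta>) * morrey_norm \<beta> \<Omega> f"
proof -
  let ?I = "\<integral>\<^sup>+y\<in>\<Omega> \<inter> ball x r. ennreal \<bar>f y\<bar> \<partial>lebesgue"
  have "ennreal (r powr (- \<beta>)) * ?I \<le> morrey_norm \<beta> \<Omega> f"
    unfolding morrey_norm_def using assms by (intro SUP_upper2[of "(x, r)"]) auto
  then have "ennreal (r powr \<beta>) * (ennreal (r powr (- \<beta>)) * ?I) \<le> ennreal (r powr \<beta>) * morrey_norm \<beta> \<Omega> f"
    by (rule mult_left_mono) simp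
  moreover have "ennreal (r powr \<beta>) * ennreal (r powr (- \<beta>)) = 1"
    using assms by (simp add: powr_minus flip: ennreal_mult)
  ultimately show ?thesis by (simp flip: mult.assoc)
qed

text \<open>The scaled Sobolev norm contributes \<open>l ^ (j - k)\<close> at order j and the Morrey
  norm \<open>l ^ (n - j)\<close>, so every order yields the same power \<open>l ^ (n - k)\<close>,
  the one in the BMO norm. The ball radius \<open>n * (2 * l)\<close> is responsible for the factor
  \<open>n ^ n\<close>.\<close>

lemma oscillation_scaling:
  fixes l :: real
  assumes "j \<le> k" "k < n" "0 < l"
  shows "(1 / (2 * l)) ^ (k - j) * (real n * (2 * l)) powr (real n - real j)
    \<le> real n ^ n * 2 ^ n * l powr (real n - real k)"
proof -
  have n: "1 \<le> real n" using assms by simp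
  have e: "n - j = (n - k) + (k - j)" using assms by simp
  have "(real n * (2 * l)) powr (real n - real j) = (real n * (2 * l)) ^ (n - j)"
    using assms by (subst powr_realpow[symmetric]) (auto simp: of_nat_diff)
  also have "\<dots> = real n ^ (n - j) * ((2 * l) ^ (n - k) * (2 * l) ^ (k - j))"
    by (simp add: power_mult_distrib e power_add)
  finally have "(1 / (2 * l)) ^ (k - j) * (real n * (2 * l)) powr (real n - real j)
    = real n ^ (n - j) * (2 ^ (n - k) * l ^ (n - k)) * ((1 / (2 * l)) ^ (k - j) * (2 * l) ^ (k - j))"
    by (simp add: power_mult_distrib mult_ac)
  also have "(1 / (2 * l)) ^ (k - j) * (2 * l) ^ (k - j) = 1"
    using assms by (subst power_mult_distrib[symmetric]) simp
  also have "real n ^ (n - j) * (2 ^ (n - k) * l ^ (n - k)) * 1 \<le> real n ^ n * (2 ^ n * l ^ (n - k))"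
    unfolding mult_1_right using n assms
    by (intro mult_mono[OF power_increasing mult_right_mono[OF power_increasing]]) auto
  also have "l ^ (n - k) = l powr (real n - real k)"
    using assms by (subst powr_realpow[symmetric]) (auto simp: of_nat_diff)
  finally show ?thesis by (simp add: mult_ac)
qed

text \<open>One grid on a cube around \<Omega> treats all points at once, so the approximation and
  its exceptional set do not depend on the cube of the BMO norm. Test functions vanish outside
  \<Omega>, so their increments are controlled on the whole top cell.\<close>

lemma precise_rep_approx:
  fixes \<Omega> :: "(real^'n::finite) set"
  assumes \<Omega>: "open \<Omega>" "bounded \<Omega>" and k: "1 \<le> k" "k < CARD('n)"
    and u: "set_integrable lebesgue \<Omega> u"
    and \<phi>: "\<And>m::nat. \<phi> m \<in> test_functions \<Omega>"
    and V: "\<And>js. length js \<le> k \<Longrightarrow> has_weak_deriv \<Omega> js u (V js)"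
      "\<And>js. length js \<le> k \<Longrightarrow> set_integrable lebesgue \<Omega> (V js)"
    and le: "\<And>js m. length js \<le> k \<Longrightarrow>
      (\<integral>\<^sup>+x\<in>\<Omega>. ennreal \<bar>V js x - iterated_partial (rev js) (\<phi> m) x\<bar> \<partial>lebesgue) \<le> ennreal ((1/2) ^ m)"
  obtains T :: "nat \<Rightarrow> real^'n \<Rightarrow> ennreal" and D Z where "D < top"
    "hausdorff_content (real CARD('n) - real k) Z = 0"
    "\<And>m x. x \<in> \<Omega> - Z \<Longrightarrow> ennreal \<bar>precise_rep u x - \<phi> m x\<bar> \<le> T m x"
    "\<And>m. choquet_integral (real CARD('n) - real k) UNIV (T m) \<le> D * ennreal ((1/2) ^ m)"
proof -
  obtain R where R: "0 < R" "\<Omega> \<subseteq> ball 0 R" using bounded_subset_ballD[OF \<Omega>(2), of 0] by blast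
  interpret G: grid "(\<chi> c. - R) :: real^'n" "2 * R" by unfold_locales (use R in simp)
  have sub: "\<Omega> \<subseteq> G.top_cell"
  proof
    fix x assume "x \<in> \<Omega>"
    then have "norm x < R" using R(2) by auto
    then have "\<bar>x $ c\<bar> < R" for c using component_le_norm_cart[of x c] by linarith
    then show "x \<in> G.top_cell" by (auto simp: G.mem_top_cell abs_less_iff less_imp_le) (smt (verit))
  qed
  define g where "g p = (\<lambda>x. \<phi> (Suc p) x - \<phi> p x)" for p
  have sg: "smooth (g p)" for p unfolding g_def by (intro smooth_diff test_functions_smooth[OF \<phi>])
  \<comment> \<open>The errors of two consecutive test functions, \<open>(1/2) ^ Suc p\<close> and
    \<open>(1/2) ^ p\<close>, add up to at most \<open>2 * (1/2) ^ p\<close>; this is the 2 in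
    \<open>S\<close>.\<close>
  define S where "S = (\<Sum>m\<le>k. ennreal ((1 / (2 * R)) ^ (k - m)) * (\<Sum>js\<in>{js :: 'n list. length js = m}. 2))"
  have "S < top" unfolding S_def by (auto simp: ennreal_mult_less_top of_nat_less_top)
  have sob: "G.sob k (g p) \<le> S * ennreal ((1/2) ^ p)" for p
    unfolding G.sob_def S_def sum_distrib_right mult.assoc
  proof (intro sum_mono mult_left_mono)
    fix m js assume m: "m \<in> {..k}" and js: "js \<in> {js :: 'n list. length js = m}"
    then have l: "length (rev js) \<le> k" by simp
    have "(\<integral>\<^sup>+x\<in>G.top_cell. ennreal \<bar>iterated_partial js (g p) x\<bar> \<partial>lborel) \<le> (\<integral>\<^sup>+x. ennreal \<bar>iterated_partial js (g p) x\<bar> \<partial>lborel)"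
      by (intro nn_integral_mono) (auto simp: indicator_def)
    also have "\<dots> \<le> ennreal ((1/2) ^ Suc p) + ennreal ((1/2) ^ p)"
      unfolding g_def using le[OF l, of p] le[OF l, of "Suc p"]
      by (intro approx_increment_le[OF \<Omega>(1) \<phi> \<phi> V(2)[OF l]]) simp_all
    also have "\<dots> \<le> ennreal ((1/2) ^ p) + ennreal ((1/2) ^ p)"
      by (intro add_right_mono ennreal_leI power_decreasing) auto
    finally show "(\<integral>\<^sup>+x\<in>G.top_cell. ennreal \<bar>iterated_partial js (g p) x\<bar> \<partial>lborel) \<le> 2 * ennreal ((1/2) ^ p)"
      unfolding mult_2 .
  qed simp
  obtain B D where B: "D < top" "\<And>p x. x \<in> G.top_cell \<Longrightarrow> ennreal \<bar>g p x\<bar> \<le> B p x"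
    "\<And>p x r. 0 < r \<Longrightarrow> r \<le> 2 * R \<Longrightarrow> ball x r \<subseteq> G.top_cell \<Longrightarrow>
      (\<integral>\<^sup>+y\<in>ball x r. ennreal \<bar>g p y\<bar> \<partial>lborel) \<le> emeasure lborel (ball x r) * B p x"
    "\<And>m. choquet_integral (real CARD('n) - real k) UNIV (\<lambda>x. \<Sum>p. B (m + p) x) \<le> D * ennreal ((1/2) ^ m)"
    by (rule G.series_maximal[OF sg k sob \<open>S < top\<close>]) (rule that)
  define T where "T m x = (\<Sum>p. B (m + p) x)" for m x
  define Z where "Z = {x \<in> UNIV. T 0 x = top}"
  have "choquet_integral (real CARD('n) - real k) UNIV (T 0) \<le> D * ennreal ((1/2) ^ 0)"
    unfolding T_def by (rule B(4))
  also have "\<dots> < top" using B(1) by simp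
  finally have Z: "hausdorff_content (real CARD('n) - real k) Z = 0"
    unfolding Z_def by (rule hausdorff_content_infinity_eq_0)
  have conv: "(\<integral>\<^sup>+y\<in>\<Omega>. ennreal \<bar>u y - \<phi> m y\<bar> \<partial>lebesgue) \<le> ennreal ((1/2) ^ m)" for m
  proof -
    \<comment> \<open>At order 0, u is its own weak derivative, so \<open>V []\<close> is another
      version of u.\<close>
    have w: "has_weak_deriv \<Omega> [] u (V [])" by (rule V(1)) simp
    then have "has_weak_deriv \<Omega> [] u u" by (simp add: has_weak_deriv_def)
    from weak_deriv_unique[OF \<Omega>(1) this w]
    have "(\<integral>\<^sup>+y\<in>\<Omega>. ennreal \<bar>u y - \<phi> m y\<bar> \<partial>lebesgue) = (\<integral>\<^sup>+y\<in>\<Omega>. ennreal \<bar>V [] y - \<phi> m y\<bar> \<partial>lebesgue)"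
      by (intro nn_integral_cong_AE) (elim eventually_mono, simp add: indicator_def)
    also have "\<dots> \<le> ennreal ((1/2) ^ m)" using le[of "[]" m] by simp
    finally show ?thesis .
  qed
  have "ennreal \<bar>precise_rep u x - \<phi> m x\<bar> \<le> T m x" if x: "x \<in> \<Omega> - Z" for m x
  proof -
    have xO: "x \<in> \<Omega>" using x by blast
    have fin: "(\<Sum>p. B p x) < top" using x by (auto simp: Z_def T_def less_top)
    show ?thesis unfolding T_def
    proof (rule precise_rep_of_series[OF \<Omega>(1) xO _ u, where R = "2 * R"])
      show "0 < 2 * R" using R by simp
      show "smooth (\<phi> m)" for m by (rule test_functions_smooth[OF \<phi>])
      show "ennreal \<bar>\<phi> (Suc p) x - \<phi> p x\<bar> \<le> B p x" for p
        using B(2)[of x p] sub xO by (auto simp: g_def)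
      show "(\<integral>\<^sup>+y\<in>ball x r. ennreal \<bar>\<phi> (Suc p) y - \<phi> p y\<bar> \<partial>lborel) \<le> emeasure lborel (ball x r) * B p x"
        if "0 < r" "r \<le> 2 * R" "ball x r \<subseteq> \<Omega>" for p r
        using B(3)[of r x p] that sub by (auto simp: g_def)
    qed (fact conv fin)+
  qed
  moreover have "choquet_integral (real CARD('n) - real k) UNIV (T m) \<le> D * ennreal ((1/2) ^ m)" for m
    unfolding T_def by (rule B(4))
  ultimately show ?thesis using that[OF B(1) Z] by blast
qed

text \<open>The first factor is \<open>content_const\<close> in dimension \<open>n - k\<close>,
  written without reference to a grid because the constant must not depend on the cube; the second
  comes from \<open>choquet_oscillation_le\<close>.\<close>

definition oscillation_const :: "'n::finite itself \<Rightarrow> nat \<Rightarrow> ennreal" where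
  "oscillation_const _ k = ennreal (pi powr ((real CARD('n) - real k) / 2) / Gamma ((real CARD('n) - real k) / 2 + 1)
      * real CARD('n) powr (real CARD('n) - real k)) * ((4 ^ Suc CARD('n)) ^ k * (2 ^ Suc CARD('n) + 1))"

text \<open>The leading 2 is the loss in \<open>choquet_integral_add_le\<close>, the cardinality
  bounds the number of derivatives of any one order, and the real factor comes from
  \<open>oscillation_scaling\<close>.\<close>

definition bmo_const :: "'n::finite itself \<Rightarrow> nat \<Rightarrow> ennreal" where
  "bmo_const TYPE_n k = 2 * (oscillation_const TYPE_n k *
      (of_nat (card {js :: 'n list. length js \<le> k}) * ennreal (real CARD('n) ^ CARD('n) * 2 ^ CARD('n))))"

lemma oscillation_const_less_top: "oscillation_const TYPE('n::finite) k < top"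
proof -
  have "(4 ^ Suc CARD('n)) ^ k < (top::ennreal)" "2 ^ Suc CARD('n) < (top::ennreal)"
    by (simp_all add: power_less_top_ennreal ennreal_mult_less_top)
  then show ?thesis unfolding oscillation_const_def by (simp add: ennreal_mult_less_top)
qed

lemma bmo_const_less_top: "bmo_const TYPE('n::finite) k < top"
  unfolding bmo_const_def using oscillation_const_less_top[where 'n='n, of k]
  by (simp add: ennreal_mult_less_top of_nat_less_top)

text \<open>The grid of side length \<open>2 * l\<close> with corner \<open>a - l\<close> in each
  coordinate has a half-open top cell between \<open>cube a l\<close> and
  \<open>cube a (2 * l)\<close>: the closed cube fits into it, and it fits into \<Omega>. As a lies
  in \<Omega>, the Morrey norms apply to a ball about a that contains the top cell. The summand with
  q is the error of replacing V by the derivatives of \<phi>; its constant may depend on l.\<close>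

lemma cube_oscillation_le:
  fixes \<Omega> :: "(real^'n::finite) set"
  assumes \<Omega>: "open \<Omega>" and k: "1 \<le> k" "k < CARD('n)"
    and \<phi>: "\<phi> \<in> test_functions \<Omega>"
    and V: "\<And>js. length js \<le> k \<Longrightarrow> has_weak_deriv \<Omega> js u (V js)"
      "\<And>js. length js \<le> k \<Longrightarrow> set_integrable lebesgue \<Omega> (V js)"
    and le: "\<And>js. length js \<le> k \<Longrightarrow>
      (\<integral>\<^sup>+x\<in>\<Omega>. ennreal \<bar>V js x - iterated_partial (rev js) \<phi> x\<bar> \<partial>lebesgue) \<le> q"
    and l: "0 < l" and sub: "cube a (2 * l) \<subseteq> \<Omega>"
  shows "\<exists>c. choquet_integral (real CARD('n) - real k) (cube a l) (\<lambda>x. ennreal \<bar>\<phi> x - c\<bar>)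
    \<le> oscillation_const TYPE('n) k * (of_nat (card {js :: 'n list. length js \<le> k})
        * ennreal (real CARD('n) ^ CARD('n) * 2 ^ CARD('n)) * ennreal (l powr (real CARD('n) - real k))
        * (\<Sum>j=1..k. morrey_norm (real CARD('n) - real j) \<Omega> (weak_grad_norm \<Omega> j u))
      + (\<Sum>j=1..k. ennreal ((1 / (2 * l)) ^ (k - j)) * of_nat (card {js :: 'n list. length js \<le> k})) * q)"
proof -
  let ?n = "CARD('n)"
  interpret H: grid "(\<chi> c. a $ c - l) :: real^'n" "2 * l" by unfold_locales (use l in simp)
  let ?Q = H.top_cell and ?\<rho> = "real ?n * (2 * l)"
  let ?M = "\<lambda>j. morrey_norm (real ?n - real j) \<Omega> (weak_grad_norm \<Omega> j u)"
  let ?N = "of_nat (card {js :: 'n list. length js \<le> k}) :: ennreal"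
  have Q1: "cube a l \<subseteq> ?Q"
  proof
    fix x assume "x \<in> cube a l"
    then have "\<bar>x $ c - a $ c\<bar> \<le> l / 2" for c by (simp add: cube_def)
    then show "x \<in> ?Q" unfolding H.mem_top_cell using l by (simp add: abs_le_iff) (smt (verit) field_sum_of_halves)
  qed
  have Q2: "?Q \<subseteq> cube a (2 * l)"
    by (auto simp: H.mem_top_cell cube_def abs_le_iff) (smt (verit))+
  have QO: "?Q \<subseteq> \<Omega>" using Q2 sub by blast
  have Qb: "?Q \<subseteq> ball a ?\<rho>" using Q2 cube_subset_ball[of "2 * l" a] l by auto
  have aO: "a \<in> \<Omega>" using sub l by (auto simp: cube_def)
  have VQ: "(\<integral>\<^sup>+x\<in>?Q. ennreal \<bar>V js x\<bar> \<partial>lebesgue) \<le> ennreal (?\<rho> powr (real ?n - real j)) * ?M j"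
    if js: "length js = j" "j \<le> k" for js j
  proof -
    have l': "length js \<le> k" using js by simp
    \<comment> \<open>The Morrey norms are formed with the selected versions
      \<open>weak_deriv\<close>, so V is exchanged for them almost everywhere.\<close>
    have ae: "AE x in lebesgue. x \<in> \<Omega> \<longrightarrow> V js x = weak_deriv \<Omega> js u x"
      by (rule weak_deriv_unique[OF \<Omega> V(1)[OF l'] has_weak_deriv_weak_deriv[OF V(1)[OF l']]])
    have "(\<integral>\<^sup>+x\<in>?Q. ennreal \<bar>V js x\<bar> \<partial>lebesgue)
        \<le> (\<integral>\<^sup>+x\<in>\<Omega> \<inter> ball a ?\<rho>. ennreal \<bar>weak_grad_norm \<Omega> j u x\<bar> \<partial>lebesgue)"
    proof (rule nn_integral_mono_AE)
      show "AE x in lebesgue. ennreal \<bar>V js x\<bar> * indicator ?Q x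
          \<le> ennreal \<bar>weak_grad_norm \<Omega> j u x\<bar> * indicator (\<Omega> \<inter> ball a ?\<rho>) x"
        using ae
      proof eventually_elim
        case (elim x)
        show ?case
        proof (cases "x \<in> ?Q")
          case True
          then have "x \<in> \<Omega> \<inter> ball a ?\<rho>" using QO Qb by blast
          then show ?thesis using elim abs_le_weak_grad_norm[OF js(1), of \<Omega> u x] True
            by (simp add: ennreal_leI)
        qed simp
      qed
    qed
    also have "\<dots> \<le> ennreal (?\<rho> powr (real ?n - real j)) * ?M j"
      using l by (intro morrey_integral_le[OF aO]) simp
    finally show ?thesis .
  qed
  have level: "ennreal ((1 / (2 * l)) ^ (k - j)) * (\<Sum>js | length js = j. \<integral>\<^sup>+x\<in>?Q. ennreal \<bar>iterated_partial js \<phi> x\<bar> \<partial>lborel)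
      \<le> ?N * ennreal (real ?n ^ ?n * 2 ^ ?n) * ennreal (l powr (real ?n - real k)) * ?M j
        + ennreal ((1 / (2 * l)) ^ (k - j)) * ?N * q" if j: "j \<in> {1..k}" for j
  proof -
    let ?s = "ennreal ((1 / (2 * l)) ^ (k - j))" and ?r = "ennreal (?\<rho> powr (real ?n - real j))"
    have "(\<integral>\<^sup>+x\<in>?Q. ennreal \<bar>iterated_partial js \<phi> x\<bar> \<partial>lborel) \<le> ?r * ?M j + q" if js: "length js = j" for js
    proof -
      \<comment> \<open>The derivatives of \<phi> approximate V for the reversed list, and reversal
        preserves the length.\<close>
      have l': "length (rev js) \<le> k" using js j by simp
      have "(\<integral>\<^sup>+x\<in>?Q. ennreal \<bar>iterated_partial js \<phi> x\<bar> \<partial>lborel) \<le> (\<integral>\<^sup>+x\<in>?Q. ennreal \<bar>V (rev js) x\<bar> \<partial>lebesgue) + q"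
        using le[OF l'] by (intro approx_integral_le[OF \<phi> H.top_cell_borel QO V(2)[OF l']]) simp
      also have "\<dots> \<le> ?r * ?M j + q" using VQ[of "rev js" j] js j by (intro add_right_mono) simp
      finally show ?thesis .
    qed
    then have "(\<Sum>js | length js = j. \<integral>\<^sup>+x\<in>?Q. ennreal \<bar>iterated_partial js \<phi> x\<bar> \<partial>lborel)
        \<le> (\<Sum>js\<in>{js :: 'n list. length js = j}. ?r * ?M j + q)" by (intro sum_mono) simp
    also have "\<dots> = of_nat (card {js :: 'n list. length js = j}) * (?r * ?M j + q)" by simp
    also have "\<dots> \<le> ?N * (?r * ?M j + q)"
      using j finite_lists_length_le[of "UNIV :: 'n set" k]
      by (intro mult_right_mono of_nat_mono card_mono) auto
    finally have "?s * (\<Sum>js | length js = j. \<integral>\<^sup>+x\<in>?Q. ennreal \<bar>iterated_partial js \<phi> x\<bar> \<partial>lborel)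
        \<le> ?s * (?N * (?r * ?M j + q))" by (rule mult_left_mono) simp
    also have "\<dots> = ?N * (?s * ?r) * ?M j + ?s * ?N * q" by (simp add: distrib_left mult_ac)
    also have "?s * ?r \<le> ennreal (real ?n ^ ?n * 2 ^ ?n) * ennreal (l powr (real ?n - real k))"
      using oscillation_scaling[of j k ?n l] j k(2) l
      by (simp add: ennreal_mult[symmetric] ennreal_leI)
    finally show ?thesis
      by (simp only: mult.assoc) (meson add_right_mono mult_left_mono mult_right_mono order_trans zero_le)
  qed
  obtain c where c: "choquet_integral (real ?n - real k) (cube a l) (\<lambda>x. ennreal \<bar>\<phi> x - c\<bar>)
    \<le> ennreal (H.content_const (real ?n - real k)) * ((4 ^ Suc ?n) ^ k * (2 ^ Suc ?n + 1)
      * (\<Sum>m=1..k. ennreal ((1 / (2 * l)) ^ (k - m)) *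
      (\<Sum>js | length js = m. \<integral>\<^sup>+x\<in>?Q. ennreal \<bar>iterated_partial js \<phi> x\<bar> \<partial>lborel)))"
    using H.choquet_oscillation_le[OF test_functions_smooth[OF \<phi>] k] Q1 by blast
  also have "\<dots> = oscillation_const TYPE('n) k * (\<Sum>m=1..k. ennreal ((1 / (2 * l)) ^ (k - m)) *
      (\<Sum>js | length js = m. \<integral>\<^sup>+x\<in>?Q. ennreal \<bar>iterated_partial js \<phi> x\<bar> \<partial>lborel))"
    by (simp add: oscillation_const_def H.content_const_def mult.assoc)
  also have "\<dots> \<le> oscillation_const TYPE('n) k * (\<Sum>j=1..k.
      ?N * ennreal (real ?n ^ ?n * 2 ^ ?n) * ennreal (l powr (real ?n - real k)) * ?M j
        + ennreal ((1 / (2 * l)) ^ (k - j)) * ?N * q)"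
    by (intro mult_left_mono sum_mono level) simp_all
  also have "\<dots> = oscillation_const TYPE('n) k * (?N * ennreal (real ?n ^ ?n * 2 ^ ?n) * ennreal (l powr (real ?n - real k)) * (\<Sum>j=1..k. ?M j)
      + (\<Sum>j=1..k. ennreal ((1 / (2 * l)) ^ (k - j)) * ?N) * q)"
    by (simp only: sum.distrib sum_distrib_left sum_distrib_right)
  finally show ?thesis by blast
qed

theorem theorem1p5:
  fixes \<Omega> :: "(real^'n::finite) set" and k :: nat
  assumes "open \<Omega>" and "bounded \<Omega>"
    and "1 \<le> k" and "k \<le> CARD('n) - 1"
  shows "\<exists>C::real. C \<ge> 0 \<and>
    (\<forall>u \<in> sobolev1_0 k \<Omega>.
       (\<forall>j\<in>{1..k}. weak_grad_norm \<Omega> j u \<in> morrey_space (real CARD('n) - real j) \<Omega>) \<longrightarrow>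
       bmo_norm (real CARD('n) - real k) \<Omega> (precise_rep u)
         \<le> ennreal C * (\<Sum>j=1..k. morrey_norm (real CARD('n) - real j) \<Omega> (weak_grad_norm \<Omega> j u)))"
proof (intro exI conjI ballI impI)
  let ?n = "CARD('n)"
  let ?\<beta> = "real ?n - real k"
  have k: "1 \<le> k" "k < ?n" using assms by auto
  have \<beta>: "0 < ?\<beta>" using k by simp
  \<comment> \<open>The constant depends only on the dimension and k; being finite, it is a real
    number as the statement requires.\<close>
  have C: "ennreal (enn2real (bmo_const TYPE('n) k)) = bmo_const TYPE('n) k"
    using bmo_const_less_top[where 'n='n, of k] by simp
  show "0 \<le> enn2real (bmo_const TYPE('n) k)" by simp
  fix u :: "real^'n \<Rightarrow> real"
  assume u: "u \<in> sobolev1_0 k \<Omega>"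
  let ?M = "\<Sum>j=1..k. morrey_norm (real ?n - real j) \<Omega> (weak_grad_norm \<Omega> j u)"
  have ui: "set_integrable lebesgue \<Omega> u" using u by (simp add: sobolev1_0_def sobolev1_def)
  obtain \<phi> V where \<phi>: "\<And>m::nat. \<phi> m \<in> test_functions \<Omega>"
    and V: "\<And>js. length js \<le> k \<Longrightarrow> has_weak_deriv \<Omega> js u (V js)"
      "\<And>js. length js \<le> k \<Longrightarrow> set_integrable lebesgue \<Omega> (V js)"
    and le: "\<And>js m. length js \<le> k \<Longrightarrow>
      (\<integral>\<^sup>+x\<in>\<Omega>. ennreal \<bar>V js x - iterated_partial (rev js) (\<phi> m) x\<bar> \<partial>lebesgue) \<le> ennreal ((1/2) ^ m)"
    using sobolev1_0_approx[OF assms(1) u] by blast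
  obtain T D Z where T: "D < top" "hausdorff_content ?\<beta> Z = 0"
    "\<And>m x. x \<in> \<Omega> - Z \<Longrightarrow> ennreal \<bar>precise_rep u x - \<phi> m x\<bar> \<le> T m x"
    "\<And>m. choquet_integral ?\<beta> UNIV (T m) \<le> D * ennreal ((1/2) ^ m)"
    by (rule precise_rep_approx[OF assms(1,2) k ui \<phi> V le]; (assumption | rule that))
  show "bmo_norm ?\<beta> \<Omega> (precise_rep u) \<le> ennreal (enn2real (bmo_const TYPE('n) k)) * ?M"
    unfolding C bmo_norm_def
  proof (rule SUP_least)
    fix al :: "(real^'n) \<times> real"
    assume "al \<in> {(a, l). 0 < l \<and> cube a (2 * l) \<subseteq> \<Omega>}"
    then obtain a l where al: "al = (a, l)" and l: "0 < l" and sub: "cube a (2 * l) \<subseteq> \<Omega>" by auto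
    let ?X = "INF c :: real. choquet_integral ?\<beta> (cube a l) (\<lambda>x. ennreal \<bar>precise_rep u x - c\<bar>) / ennreal (l powr ?\<beta>)"
    define e where "e = ennreal (l powr ?\<beta>)"
    define K where "K = oscillation_const TYPE('n) k"
    define N where "N = of_nat (card {js :: 'n list. length js \<le> k}) * ennreal (real ?n ^ ?n * 2 ^ ?n)"
    define W where "W = (\<Sum>j=1..k. ennreal ((1 / (2 * l)) ^ (k - j)) * of_nat (card {js :: 'n list. length js \<le> k}))"
    have K: "K < top" unfolding K_def by (rule oscillation_const_less_top)
    have W: "W < top" unfolding W_def by (auto simp: ennreal_mult_less_top of_nat_less_top)
    have e: "e * inverse e = 1"
      unfolding e_def using l by (subst inverse_ennreal, simp, subst ennreal_mult[symmetric]) auto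
    have ie: "inverse e < top" unfolding e_def using l by (simp add: inverse_ennreal)
    have cube: "cube a l \<subseteq> \<Omega>"
    proof
      fix x assume "x \<in> cube a l"
      then have "\<bar>x $ c - a $ c\<bar> \<le> l / 2" for c by (simp add: cube_def)
      moreover have "l / 2 \<le> l" using l by simp
      ultimately have "\<bar>x $ c - a $ c\<bar> \<le> l" for c using order_trans by blast
      then show "x \<in> \<Omega>" using sub by (auto simp: cube_def)
    qed
    have "?X \<le> bmo_const TYPE('n) k * ?M"
    \<comment> \<open>The limit in m is taken for each cube separately, so it does no harm that
      \<open>W\<close> and \<open>inverse e\<close> depend on l. The centre c depends on m as well,
      but \<open>?X\<close> is an infimum over all c.\<close>
    proof (rule ennreal_le_of_geometric[where D = "2 * (D + K * W) * inverse e"])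
      fix m
      let ?q = "ennreal ((1/2) ^ m)"
      have "\<exists>c. choquet_integral ?\<beta> (cube a l) (\<lambda>x. ennreal \<bar>\<phi> m x - c\<bar>) \<le> K * (N * e * ?M + W * ?q)"
        unfolding K_def N_def e_def W_def
        by (rule cube_oscillation_le[OF assms(1) k \<phi> _ _ _ l sub]; (rule V | rule le); assumption)
      then obtain c where c: "choquet_integral ?\<beta> (cube a l) (\<lambda>x. ennreal \<bar>\<phi> m x - c\<bar>) \<le> K * (N * e * ?M + W * ?q)"
        by blast
      have "choquet_integral ?\<beta> (cube a l) (\<lambda>x. ennreal \<bar>precise_rep u x - c\<bar>)
          \<le> 2 * (choquet_integral ?\<beta> (cube a l) (T m) + choquet_integral ?\<beta> (cube a l) (\<lambda>x. ennreal \<bar>\<phi> m x - c\<bar>))"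
      \<comment> \<open>\<open>T m\<close> bounds the error of the approximation off the set
        \<open>Z\<close> of content zero, and the smooth oscillation bounds the rest.\<close>
      proof (rule choquet_integral_add_le[OF \<beta> T(2)])
        fix x assume x: "x \<in> cube a l - Z"
        have "ennreal \<bar>precise_rep u x - c\<bar> \<le> ennreal (\<bar>precise_rep u x - \<phi> m x\<bar> + \<bar>\<phi> m x - c\<bar>)"
          by (intro ennreal_leI) linarith
        also have "\<dots> = ennreal \<bar>precise_rep u x - \<phi> m x\<bar> + ennreal \<bar>\<phi> m x - c\<bar>" by (rule ennreal_plus) auto
        also have "\<dots> \<le> T m x + ennreal \<bar>\<phi> m x - c\<bar>"
          using x cube by (intro add_right_mono T(3)) auto
        finally show "ennreal \<bar>precise_rep u x - c\<bar> \<le> T m x + ennreal \<bar>\<phi> m x - c\<bar>" .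
      qed
      also have "\<dots> \<le> 2 * (D * ?q + K * (N * e * ?M + W * ?q))"
        by (intro mult_left_mono add_mono c order_trans[OF choquet_integral_mono T(4)]) auto
      finally have main: "choquet_integral ?\<beta> (cube a l) (\<lambda>x. ennreal \<bar>precise_rep u x - c\<bar>)
          \<le> 2 * (D * ?q + K * (N * e * ?M + W * ?q))" .
      have "?X \<le> choquet_integral ?\<beta> (cube a l) (\<lambda>x. ennreal \<bar>precise_rep u x - c\<bar>) / e"
        unfolding e_def by (rule INF_lower) simp
      also have "\<dots> \<le> 2 * (D * ?q + K * (N * e * ?M + W * ?q)) * inverse e"
        unfolding divide_ennreal_def by (intro mult_right_mono main) simp
      \<comment> \<open>The normalisation cancels against the factor e of the Morrey term only; the
        error term keeps \<open>inverse e\<close>, which is finite for fixed l.\<close>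
      also have "\<dots> = 2 * (K * N) * (e * inverse e) * ?M + 2 * (D + K * W) * inverse e * ?q"
        by (simp only: distrib_left distrib_right mult_ac add_ac)
      also have "\<dots> = bmo_const TYPE('n) k * ?M + 2 * (D + K * W) * inverse e * ?q"
        unfolding e by (simp add: bmo_const_def K_def N_def mult_ac)
      finally show "?X \<le> bmo_const TYPE('n) k * ?M + 2 * (D + K * W) * inverse e * ?q" .
    next
      show "2 * (D + K * W) * inverse e < top"
        using T(1) K W ie by (simp add: ennreal_mult_less_top)
    qed
    then show "(case al of (a, l) \<Rightarrow> INF c :: real. choquet_integral ?\<beta> (cube a l)
        (\<lambda>x. ennreal \<bar>precise_rep u x - c\<bar>) / ennreal (l powr ?\<beta>)) \<le> bmo_const TYPE('n) k * ?M"
      by (simp only: al prod.case)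
  qed
qed

end
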